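(* Let $\mathbb{F}$ be an algebraically closed field and let $n\geq 2$. Then each of the groups ${\rm SL}_n(\mathbb{F})$ and ${\rm GL}_n(\mathbb{F})$ possesses the $R_\infty$-property if and only if $\mathbb{F}$ has characteristic zero and the transcendence degree of $\mathbb{F}$ over $\mathbb{Q}$ is finite.
   Context: For a group $G$ and an endomorphism $\varphi$ of $G$, elements $x,y\in G$ are $\varphi$-conjugated if $x=zy\varphi(z)^{-1}$ for some $z\in G$; this is an equivalence relation, whose classes are the $\varphi$-conjugacy (twisted conjugacy) classes. The Reidemeister number $R(\varphi)$ is the number of $\varphi$-conjugacy classes, an element of $\mathbb{N}\cup\{\infty\}$ (all infinite cardinals are identified with $\infty$). The Reidemeister spectrum of $G$ is $Spec_R(G)=\{R(\varphi)\mid \varphi \text{ an automorphism of } G\}$. $G$ possesses the $R_\infty$-property if $Spec_R(G)=\{\infty\}$. *)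

theory Defs
  imports "HOL-Analysis.Analysis" "HOL-Computational_Algebra.Polynomial"
          "HOL-Library.Poly_Mapping" "HOL-Library.Extended_Nat" "HOL-Algebra.Group"
begin

section \<open>Twisted conjugacy, Reidemeister numbers, R-infinity property\<close>

definition twisted_conj :: "('g, 'm) monoid_scheme \<Rightarrow> ('g \<Rightarrow> 'g) \<Rightarrow> 'g \<Rightarrow> 'g \<Rightarrow> bool" where
  "twisted_conj G \<phi> x y \<longleftrightarrow>
     (\<exists>z \<in> carrier G. x = z \<otimes>\<^bsub>G\<^esub> y \<otimes>\<^bsub>G\<^esub> inv\<^bsub>G\<^esub> (\<phi> z))"

definition twisted_classes :: "('g, 'm) monoid_scheme \<Rightarrow> ('g \<Rightarrow> 'g) \<Rightarrow> 'g set set" where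
  "twisted_classes G \<phi> =
     carrier G // {(x, y). x \<in> carrier G \<and> y \<in> carrier G \<and> twisted_conj G \<phi> x y}"

text \<open>Reidemeister number; all infinite cardinals are identified with infinity.\<close>
definition reidemeister_number :: "('g, 'm) monoid_scheme \<Rightarrow> ('g \<Rightarrow> 'g) \<Rightarrow> enat" where
  "reidemeister_number G \<phi> =
     (if finite (twisted_classes G \<phi>) then enat (card (twisted_classes G \<phi>)) else \<infinity>)"

definition reidemeister_spectrum :: "('g, 'm) monoid_scheme \<Rightarrow> enat set" where
  "reidemeister_spectrum G = reidemeister_number G ` iso G G"

definition R_infinity_property :: "('g, 'm) monoid_scheme \<Rightarrow> bool" where
  "R_infinity_property G \<longleftrightarrow> reidemeister_spectrum G = {\<infinity>}"

section \<open>The groups GL_n and SL_n\<close>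

definition GL_group :: "('a::field ^'n::finite ^'n) monoid" where
  "GL_group = \<lparr>carrier = {A. det A \<noteq> 0}, mult = (**), one = mat 1\<rparr>"

definition SL_group :: "('a::field ^'n::finite ^'n) monoid" where
  "SL_group = \<lparr>carrier = {A. det A = 1}, mult = (**), one = mat 1\<rparr>"

section \<open>Transcendence degree over Q\<close>

text \<open>The canonical image of a rational number in a field (the embedding of Q when the
  characteristic is zero).\<close>
definition rat_in :: "rat \<Rightarrow> 'a::field" where
  "rat_in q = (case quotient_of q of (a, b) \<Rightarrow> of_int a / of_int b)"

text \<open>Multivariate polynomials over Q whose variables are indexed by field elements:
  a monomial is a finitely supported exponent function, a polynomial a finitely supported
  coefficient function on monomials.\<close>
definition mpoly_eval :: "(('a::field \<Rightarrow>\<^sub>0 nat) \<Rightarrow>\<^sub>0 rat) \<Rightarrow> 'a" where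
  "mpoly_eval p = (\<Sum>m \<in> Poly_Mapping.keys p. rat_in (Poly_Mapping.lookup p m) * (\<Prod>x \<in> Poly_Mapping.keys m. (x::'a) ^ (Poly_Mapping.lookup m x :: nat)))"

definition alg_independent_over_Q :: "'a::field set \<Rightarrow> bool" where
  "alg_independent_over_Q S \<longleftrightarrow>
     (\<forall>p :: ('a \<Rightarrow>\<^sub>0 nat) \<Rightarrow>\<^sub>0 rat. p \<noteq> 0 \<longrightarrow> (\<forall>m \<in> Poly_Mapping.keys p. Poly_Mapping.keys m \<subseteq> S) \<longrightarrow> mpoly_eval p \<noteq> 0)"

text \<open>A transcendence basis over Q is a maximal algebraically independent subset.\<close>
definition transcendence_basis_over_Q :: "'a::field set \<Rightarrow> bool" where
  "transcendence_basis_over_Q S \<longleftrightarrow>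
     alg_independent_over_Q S \<and> (\<forall>x. x \<notin> S \<longrightarrow> \<not> alg_independent_over_Q (insert x S))"

definition finite_trdeg_over_Q :: "'a::field itself \<Rightarrow> bool" where
  "finite_trdeg_over_Q _ \<longleftrightarrow> (\<exists>S :: 'a set. transcendence_basis_over_Q S \<and> finite S)"

end

theory Submission
  imports Defs
begin

text \<open>
If some field automorphism \<open>\<delta>\<close> has the property that \<open>\<delta>(z) = A z\<close> has an invertible solution \<open>z\<close>
for every invertible \<open>A\<close>, then the induced automorphisms of \<open>GL\<close> and \<open>SL\<close> have a single twisted
conjugacy class. In positive characteristic the Frobenius map has this property (Lang's theorem).
In characteristic zero with an infinite transcendence basis \<open>B\<close>, we have \<open>|B| = |F|\<close>, so \<open>B\<close> contains
pairwise disjoint blocks \<open>z\<^sub>A\<close> indexed by the invertible matrices; prescribing \<open>\<delta>(z\<^sub>A) = A z\<^sub>A\<close>, where the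
entries of \<open>A\<close> are algebraic over basis elements of lower level, maps \<open>B\<close> to another transcendence
basis and therefore extends to an automorphism of \<open>F\<close>.

Conversely, in characteristic zero every automorphism of \<open>SL\<close> is, up to conjugation, induced by a
field automorphism \<open>\<delta>\<close>, possibly composed with inverse transpose: after conjugation it preserves the
diagonal subgroup (the centralizer of a finite group of commuting elements of order three), hence it
permutes the root subgroups. Were the number of classes finite, infinitely many of the elements
\<open>diag(p, 1/p, 1, ..., 1)\<close> with \<open>p\<close> prime (suitably modified in the inverse transpose case) would be
twisted conjugate to a single one. Ratios of entries of the conjugating matrices are eigenvectors
of \<open>\<delta>\<close> (or of its square) with multiplicatively independent rational eigenvalues, so monomials in them
have pairwise distinct eigenvalues and the eigenvectors are algebraically independent; this forces an
infinite transcendence degree.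
\<close>

section \<open>Algebraic closure inside a field as a pregeometry\<close>

text \<open>The obstacle in the converse is that an abstract automorphism of \<open>SL\<close>
  carries no algebraic structure, so everything has to be recovered from commutation and
  conjugation. Order three works for all n \<ge> 2: with a primitive cube root \<zeta> of unity,
  diag(\<zeta>, 1/\<zeta>, 1, ...) separates its first two coordinates, whereas diag(-1, -1) is
  central for n = 2; finite order makes the images diagonalizable. For \<open>GL\<close> the
  conjugation relation is reduced to matrices of \<open>SL\<close> at the price of an unknown scalar
  that depends on the prime, hence the ratios of entries; the pigeonhole principle fixes the rows
  from which they are taken. In the generic construction the danger is that the prescribed images
  might be dependent. The levels exclude this: the matrix A is available before its block z, so z
  can be recovered from the image A z, and counting ranks turns generation into
  independence.\<close>

definition subring_set :: "'a::field set \<Rightarrow> bool" where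
  "subring_set R \<longleftrightarrow> 0 \<in> R \<and> 1 \<in> R \<and> (\<forall>x\<in>R. \<forall>y\<in>R. x + y \<in> R \<and> x * y \<in> R) \<and> (\<forall>x\<in>R. - x \<in> R)"

definition poly_over :: "'a::field set \<Rightarrow> 'a poly \<Rightarrow> bool" where
  "poly_over R p \<longleftrightarrow> (\<forall>i. coeff p i \<in> R)"

text \<open>For a subring \<open>R\<close> that is not a field, admitting arbitrary nonzero
  polynomials makes this algebraicity over the fraction field of \<open>R\<close>.\<close>

definition alg_over :: "'a::field set \<Rightarrow> 'a set" where
  "alg_over R = {x. \<exists>p. p \<noteq> 0 \<and> poly_over R p \<and> poly p x = 0}"

lemma subring_setD:
  assumes "subring_set R"
  shows "0 \<in> R" "1 \<in> R" "x \<in> R \<Longrightarrow> y \<in> R \<Longrightarrow> x + y \<in> R" "x \<in> R \<Longrightarrow> y \<in> R \<Longrightarrow> x * y \<in> R"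
    "x \<in> R \<Longrightarrow> - x \<in> R"
  using assms by (auto simp: subring_set_def)

lemma subring_set_power: "subring_set R \<Longrightarrow> x \<in> R \<Longrightarrow> x ^ n \<in> R"
  by (induction n) (auto simp: subring_setD)

lemma subring_set_sum: "subring_set R \<Longrightarrow> (\<And>i. i \<in> I \<Longrightarrow> f i \<in> R) \<Longrightarrow> sum f I \<in> R"
  by (induction I rule: infinite_finite_induct) (auto simp: subring_setD)

lemma subring_set_prod: "subring_set R \<Longrightarrow> (\<And>i. i \<in> I \<Longrightarrow> f i \<in> R) \<Longrightarrow> prod f I \<in> R"
  by (induction I rule: infinite_finite_induct) (auto simp: subring_setD)

lemma subring_set_of_nat: "subring_set R \<Longrightarrow> of_nat n \<in> R"
  by (induction n) (auto simp: subring_setD)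

lemma subring_set_of_int: "subring_set R \<Longrightarrow> of_int n \<in> R"
  by (cases n rule: int_cases2) (auto simp: subring_set_of_nat subring_setD)

lemma poly_over_mono: "poly_over R p \<Longrightarrow> R \<subseteq> R' \<Longrightarrow> poly_over R' p"
  by (auto simp: poly_over_def)

lemma alg_over_mono: "R \<subseteq> R' \<Longrightarrow> alg_over R \<subseteq> alg_over R'"
  unfolding alg_over_def using poly_over_mono by blast

lemma alg_over_coeffsI:
  assumes "\<And>i. i \<le> n \<Longrightarrow> r i \<in> R" "0 \<in> R" "k \<le> n" "r k \<noteq> 0" "(\<Sum>i\<le>n. r i * x ^ i) = 0"
  shows "x \<in> alg_over R"
proof -
  define p where "p = (\<Sum>i\<le>n. monom (r i) i)"
  have c: "coeff p i = (if i \<le> n then r i else 0)" for i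
    by (simp add: p_def coeff_sum if_distrib[of "\<lambda>x. x = _"] sum.delta)
  have "p \<noteq> 0" using c[of k] assms by auto
  moreover have "poly_over R p" using c assms by (simp add: poly_over_def)
  moreover have "poly p x = 0" by (simp add: p_def poly_sum poly_monom assms(5))
  ultimately show ?thesis unfolding alg_over_def by blast
qed

lemma subset_alg_over: "subring_set R \<Longrightarrow> R \<subseteq> alg_over R"
proof
  fix x assume R: "subring_set R" and x: "x \<in> R"
  have "poly_over R [:-x, 1:]"
    using R x by (auto simp: poly_over_def coeff_pCons subring_setD split: nat.splits)
  then show "x \<in> alg_over R" unfolding alg_over_def by (auto intro!: exI[of _ "[:-x,1:]"])
qed

section \<open>Finitely generated modules over a subring\<close>

inductive_set module_span :: "'a::field set \<Rightarrow> 'a set \<Rightarrow> 'a set" for R W where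
  span_0: "0 \<in> module_span R W"
| span_step: "s \<in> module_span R W \<Longrightarrow> r \<in> R \<Longrightarrow> w \<in> W \<Longrightarrow> s + r * w \<in> module_span R W"

lemma module_span_add:
  assumes "s \<in> module_span R W" "t \<in> module_span R W"
  shows "s + t \<in> module_span R W"
  using assms(2,1)
proof (induction arbitrary: s rule: module_span.induct)
  case (span_step t r w)
  show ?case using module_span.span_step[OF span_step.IH[OF span_step.prems] span_step.hyps(2,3)]
    by (simp add: add.assoc)
qed simp

lemma module_span_scale:
  assumes "subring_set R" "r \<in> R" "s \<in> module_span R W"
  shows "r * s \<in> module_span R W"
  using assms(3,1,2)
proof (induction rule: module_span.induct)
  case (span_step s t w)
  then have "r * s + (r * t) * w \<in> module_span R W"
    by (intro module_span.span_step) (auto simp: subring_setD)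
  then show ?case by (simp add: algebra_simps)
qed (auto intro: span_0)

lemma module_span_base: "r \<in> R \<Longrightarrow> w \<in> W \<Longrightarrow> r * w \<in> module_span R W"
  using span_step[OF span_0, of r R w W] by simp

lemma module_span_sum: "(\<And>i. i \<in> I \<Longrightarrow> f i \<in> module_span R W) \<Longrightarrow> sum f I \<in> module_span R W"
  by (induction I rule: infinite_finite_induct) (auto intro: module_span_add span_0)

lemma module_span_trans_mult:
  assumes "subring_set R" "\<And>w. w \<in> W \<Longrightarrow> c * w \<in> module_span R W'" "s \<in> module_span R W"
  shows "c * s \<in> module_span R W'"
  using assms(3)
proof (induction rule: module_span.induct)
  case (span_step s r w)
  then have "c * s + r * (c * w) \<in> module_span R W'"
    using assms by (auto intro: module_span_add module_span_scale)
  then show ?case by (simp add: algebra_simps)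
qed (auto intro: span_0)

lemma module_span_insertE:
  assumes "subring_set R" "s \<in> module_span R (insert w W)"
  obtains t r where "t \<in> module_span R W" "r \<in> R" "s = t + r * w"
proof -
  have "\<exists>t r. t \<in> module_span R W \<and> r \<in> R \<and> s = t + r * w"
    using assms(2)
  proof (induction rule: module_span.induct)
    case span_0
    show ?case using subring_setD(1)[OF assms(1)] module_span.span_0[of R W] by (intro exI[of _ 0]) auto
  next
    case (span_step s r' w')
    then obtain t r where *: "t \<in> module_span R W" "r \<in> R" "s = t + r * w" by auto
    show ?case
    proof (cases "w' = w")
      case True
      then show ?thesis using * span_step subring_setD(3)[OF assms(1)]
        by (intro exI[of _ t] exI[of _ "r + r'"]) (auto simp: algebra_simps)
    next
      case False
      then show ?thesis using * span_step
        by (intro exI[of _ "t + r' * w'"] exI[of _ r]) (auto simp: algebra_simps intro: module_span.span_step)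
    qed
  qed
  then show ?thesis using that by blast
qed

text \<open>Gaussian elimination without fractions, by induction on \<open>W\<close>: a vector with
  nonzero coefficient at the generator \<open>w\<close> serves as pivot, and cross multiplication
  removes \<open>w\<close> from all other vectors. This leaves one vector and one generator
  less.\<close>

lemma module_span_dependent:
  assumes R: "subring_set R" and "finite W" "finite I" "card W < card I"
    "\<And>i. i \<in> I \<Longrightarrow> v i \<in> module_span R W"
  shows "\<exists>r. (\<forall>i\<in>I. r i \<in> R) \<and> (\<exists>i\<in>I. r i \<noteq> 0) \<and> (\<Sum>i\<in>I. r i * v i) = 0"
  using assms(2-)
proof (induction W arbitrary: I v rule: finite_induct)
  case empty
  have "s = 0" if "s \<in> module_span R {}" for s using that by (induction rule: module_span.induct) auto
  then have "\<forall>i\<in>I. v i = 0" using empty by auto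
  moreover have "I \<noteq> {}" using empty by auto
  ultimately show ?case using subring_setD(2)[OF R] by (intro exI[of _ "\<lambda>_. 1"]) auto
next
  case (insert w W)
  have "\<forall>i. \<exists>t r. i \<in> I \<longrightarrow> t \<in> module_span R W \<and> r \<in> R \<and> v i = t + r * w"
    using insert.prems(3) module_span_insertE[OF R] by metis
  then obtain t r where tr: "\<And>i. i \<in> I \<Longrightarrow> t i \<in> module_span R W \<and> r i \<in> R \<and> v i = t i + r i * w"
    by metis
  show ?case
  proof (cases "\<exists>k\<in>I. r k \<noteq> 0")
    case False
    then have "\<And>i. i \<in> I \<Longrightarrow> v i \<in> module_span R W" using tr by auto
    then show ?thesis using insert.IH[of I v] insert by auto
  next
    case True
    then obtain k where k: "k \<in> I" "r k \<noteq> 0" by auto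
    define u where "u i = r k * v i - r i * v k" for i
    have u: "u i \<in> module_span R W" if "i \<in> I - {k}" for i
    proof -
      have "u i = r k * t i + (- r i) * t k"
        using tr[of i] tr[OF k(1)] that by (simp add: u_def algebra_simps)
      moreover have "r k * t i + (- r i) * t k \<in> module_span R W" using tr[of i] tr[OF k(1)] that R
        by (intro module_span_add module_span_scale) (auto simp: subring_setD)
      ultimately show ?thesis by metis
    qed
    have "card W < card (I - {k})" using insert k by simp
    then obtain q where q: "\<forall>i\<in>I-{k}. q i \<in> R" "\<exists>i\<in>I-{k}. q i \<noteq> 0" "(\<Sum>i\<in>I-{k}. q i * u i) = 0"
      using insert.IH[of "I - {k}" u] u insert.prems(1) by auto
    \<comment> \<open>The coefficient at \<open>k\<close> is forced: it accounts for the multiples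
      of \<open>v k\<close> contained in the \<open>u i\<close>.\<close>
    define q' where "q' i = (if i = k then - (\<Sum>i\<in>I-{k}. q i * r i) else q i * r k)" for i
    have "(\<Sum>i\<in>I. q' i * v i) = q' k * v k + (\<Sum>i\<in>I-{k}. q' i * v i)"
      using k insert.prems by (simp add: sum.remove)
    also have "(\<Sum>i\<in>I-{k}. q' i * v i) = (\<Sum>i\<in>I-{k}. q i * u i + (q i * r i) * v k)"
      by (intro sum.cong) (auto simp: q'_def u_def algebra_simps)
    also have "\<dots> = (\<Sum>i\<in>I-{k}. q i * r i) * v k" using q by (simp add: sum.distrib sum_distrib_right)
    finally have "(\<Sum>i\<in>I. q' i * v i) = 0" by (simp add: q'_def)
    moreover have "\<forall>i\<in>I. q' i \<in> R" using q tr k R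
      by (auto simp: q'_def intro!: subring_setD subring_set_sum)
    moreover have "\<exists>i\<in>I. q' i \<noteq> 0" using q k by (auto simp: q'_def)
    ultimately show ?thesis by blast
  qed
qed

text \<open>The denominator \<open>c\<close> lets the finite-module criterion for algebraicity work over a subring,
  without passing to its fraction field.\<close>

definition stable_under :: "'a::field set \<Rightarrow> 'a set \<Rightarrow> 'a \<Rightarrow> bool" where
  "stable_under R W x \<longleftrightarrow> (\<exists>c\<in>R. c \<noteq> 0 \<and> (\<forall>w\<in>W. c * x * w \<in> module_span R W))"

text \<open>Since \<open>1\<close> is in \<open>W\<close>, all powers of \<open>c * x\<close> lie in
  the span of \<open>W\<close>. The exponents from 0 to \<open>card W\<close> give more powers than
  generators, hence a linear relation over \<open>R\<close>, which is a polynomial relation for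
  \<open>x\<close>.\<close>

lemma alg_overI_stable:
  assumes R: "subring_set R" and W: "finite W" "1 \<in> W" and st: "stable_under R W x"
  shows "x \<in> alg_over R"
proof -
  obtain c where c: "c \<in> R" "c \<noteq> 0" "\<And>w. w \<in> W \<Longrightarrow> c * x * w \<in> module_span R W"
    using st by (auto simp: stable_under_def)
  have pw: "(c * x) ^ k \<in> module_span R W" for k
  proof (induction k)
    case 0 show ?case using module_span_base[of 1 R 1 W] W subring_setD[OF R] by simp
  next
    case (Suc k)
    show ?case using module_span_trans_mult[OF R c(3) Suc] by simp
  qed
  obtain r where r: "\<forall>i\<in>{..card W}. r i \<in> R" "\<exists>i\<in>{..card W}. r i \<noteq> 0" "(\<Sum>i\<le>card W. r i * (c*x)^i) = 0"
    using module_span_dependent[OF R W(1), of "{..card W}" "\<lambda>i. (c*x)^i"] pw by auto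
  then obtain k where k: "k \<le> card W" "r k \<noteq> 0" by auto
  show ?thesis
  proof (rule alg_over_coeffsI[of "card W" "\<lambda>i. r i * c ^ i"])
    show "(\<Sum>i\<le>card W. r i * c ^ i * x ^ i) = 0" using r(3) by (simp add: power_mult_distrib mult.assoc)
    show "r k * c ^ k \<noteq> 0" using k c by simp
  qed (use r R c k in \<open>auto intro!: subring_setD subring_set_power\<close>)
qed

lemma alg_over_relation:
  assumes "x \<in> alg_over R"
  obtains d r where "\<And>i. i \<le> d \<Longrightarrow> r i \<in> R" "d > 0" "r d \<noteq> 0" "(\<Sum>i\<le>d. r i * x ^ i) = 0"
proof -
  obtain p where p: "p \<noteq> 0" "poly_over R p" "poly p x = 0" using assms by (auto simp: alg_over_def)
  have "degree p > 0" using p by (auto elim!: degree_eq_zeroE intro!: Nat.gr0I)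
  then show ?thesis using p that[of "degree p" "coeff p"] by (auto simp: poly_over_def poly_altdef)
qed

text \<open>The products of \<open>W\<close> with the powers of \<open>x\<close> below
  \<open>d\<close> generate a module that absorbs \<open>x\<close>: multiplication raises the
  exponent, and at exponent \<open>d\<close> the relation for \<open>x\<close> brings it back, with
  coefficients under which \<open>W\<close> is already stable.\<close>

lemma stable_under_adjoin:
  assumes R: "subring_set R" and W: "finite W" "1 \<in> W" and d: "d > 0"
    and b: "\<And>i. i < d \<Longrightarrow> stable_under R W (b i)" and x: "x ^ d = (\<Sum>i<d. b i * x ^ i)"
  defines "W' \<equiv> (\<lambda>(w, i). w * x ^ i) ` (W \<times> {..<d})"
  shows "finite W'" "1 \<in> W'" "stable_under R W' x" "\<And>y. stable_under R W y \<Longrightarrow> stable_under R W' y"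
proof -
  show "finite W'" using W by (simp add: W'_def)
  show "1 \<in> W'" using W d unfolding W'_def by (intro image_eqI[of _ _ "(1,0)"]) auto
  have lift: "s * x ^ i \<in> module_span R W'" if "s \<in> module_span R W" "i < d" for s i
  proof -
    have "x ^ i * s \<in> module_span R W'"
    proof (rule module_span_trans_mult[OF R _ that(1)])
      fix w assume "w \<in> W"
      then have "w * x ^ i \<in> W'" using that(2) by (auto simp: W'_def)
      then have "1 * (w * x^i) \<in> module_span R W'" by (intro module_span_base subring_setD[OF R])
      then show "x ^ i * w \<in> module_span R W'" by (simp add: mult.commute)
    qed
    then show ?thesis by (simp add: mult.commute)
  qed
  show "stable_under R W' y" if y: "stable_under R W y" for y
  proof -
    obtain c where c: "c \<in> R" "c \<noteq> 0" "\<And>w. w \<in> W \<Longrightarrow> c * y * w \<in> module_span R W"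
      using y unfolding stable_under_def by blast
    have "c * y * w' \<in> module_span R W'" if "w' \<in> W'" for w'
    proof -
      obtain w i where "w' = w * x ^ i" "w \<in> W" "i < d" using \<open>w' \<in> W'\<close> by (auto simp: W'_def)
      then show ?thesis using lift[OF c(3), of w i] by (simp add: mult.assoc)
    qed
    then show ?thesis using c by (auto simp: stable_under_def)
  qed
  have "\<forall>i. \<exists>c. i < d \<longrightarrow> c \<in> R \<and> c \<noteq> 0 \<and> (\<forall>w\<in>W. c * b i * w \<in> module_span R W)"
    using b by (auto simp: stable_under_def)
  then obtain c where c: "\<And>i. i < d \<Longrightarrow> c i \<in> R \<and> c i \<noteq> 0 \<and> (\<forall>w\<in>W. c i * b i * w \<in> module_span R W)" by metis
  \<comment> \<open>A common denominator for all the \<open>b i\<close>.\<close>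
  define C where "C = (\<Prod>i<d. c i)"
  have C: "C \<in> R" "C \<noteq> 0" using c R by (auto simp: C_def intro!: subring_set_prod)
  have Cb: "C * b i * w \<in> module_span R W" if "i < d" "w \<in> W" for i w
  proof -
    have "C = (\<Prod>j\<in>{..<d}-{i}. c j) * c i" using that by (simp add: C_def prod.remove mult.commute)
    then have "C * b i * w = (\<Prod>j\<in>{..<d}-{i}. c j) * (c i * b i * w)" by (simp add: mult.assoc)
    also have "\<dots> \<in> module_span R W"
      using c that by (intro module_span_scale[OF R subring_set_prod[OF R]]) auto
    finally show ?thesis .
  qed
  have "C * x * w' \<in> module_span R W'" if "w' \<in> W'" for w'
  proof -
    obtain w i where w: "w' = w * x ^ i" "w \<in> W" "i < d" using \<open>w' \<in> W'\<close> by (auto simp: W'_def)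
    show ?thesis
    proof (cases "Suc i < d")
      case True
      have "(C * w) * x ^ (Suc i) \<in> module_span R W'"
        using True C w by (intro lift module_span_base) auto
      then show ?thesis using w by (simp add: algebra_simps)
    next
      case False
      then have "d = Suc i" using w by simp
      then have "C * x * w' = C * w * x ^ d" using w by (simp add: algebra_simps)
      also have "\<dots> = (\<Sum>i<d. (C * b i * w) * x ^ i)"
        by (simp add: x sum_distrib_left algebra_simps)
      also have "\<dots> \<in> module_span R W'"
        using Cb w by (intro module_span_sum lift) auto
      finally show ?thesis .
    qed
  qed
  then show "stable_under R W' x" using C by (auto simp: stable_under_def)
qed

lemma stable_under_div:
  assumes R: "subring_set R" and "finite W" "r \<in> R" "s \<in> R" "s \<noteq> 0"
  shows "stable_under R W (r / s)"
  unfolding stable_under_def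
  using assms by (intro bexI[of _ s]) (auto intro!: module_span_base)

text \<open>One \<open>W\<close> shared by several elements makes sums and products accessible,
  because the elements under which a given \<open>W\<close> is stable are closed under both.\<close>

lemma stable_under_finite:
  assumes R: "subring_set R" and X: "finite X" "X \<subseteq> alg_over R"
  shows "\<exists>W. finite W \<and> 1 \<in> W \<and> (\<forall>x\<in>X. stable_under R W x)"
  using X
proof (induction X rule: finite_induct)
  case empty
  show ?case by (rule exI[of _ "{1}"]) auto
next
  case (insert x X)
  then obtain W where W: "finite W" "1 \<in> W" "\<forall>x\<in>X. stable_under R W x" by auto
  obtain d r where r: "\<And>i. i \<le> d \<Longrightarrow> r i \<in> R" "d > 0" "r d \<noteq> 0" "(\<Sum>i\<le>d. r i * x ^ i) = 0"
    using alg_over_relation insert.prems by blast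
  \<comment> \<open>Dividing by the leading coefficient makes the relation monic; its coefficients
    are now fractions over \<open>R\<close>, under which every finite \<open>W\<close> is
    stable.\<close>
  define b where "b i = (- r i) / r d" for i
  have "r d * x ^ d = - (\<Sum>i<d. r i * x ^ i)"
    using r(4) by (simp add: lessThan_Suc_atMost[symmetric] eq_neg_iff_add_eq_0 add.commute)
  then have "x ^ d = (\<Sum>i<d. b i * x ^ i)"
    using r(3) by (simp add: b_def field_simps sum_divide_distrib[symmetric] sum_negf)
  moreover have "stable_under R W (b i)" if "i < d" for i
    unfolding b_def using r that by (intro stable_under_div R W) (auto simp: subring_setD[OF R])
  ultimately show ?case using stable_under_adjoin[OF R W(1,2) r(2), of b x] W(3) by blast
qed

lemma stable_under_add:
  assumes R: "subring_set R" and "stable_under R W x" "stable_under R W y"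
  shows "stable_under R W (x + y)" "stable_under R W (x * y)"
proof -
  obtain c d where c: "c \<in> R" "c \<noteq> 0" "\<And>w. w \<in> W \<Longrightarrow> c * x * w \<in> module_span R W"
     and d: "d \<in> R" "d \<noteq> 0" "\<And>w. w \<in> W \<Longrightarrow> d * y * w \<in> module_span R W"
    using assms by (auto simp: stable_under_def)
  have "c * d * (x + y) * w \<in> module_span R W" if "w \<in> W" for w
  proof -
    have "d * (c * x * w) + c * (d * y * w) \<in> module_span R W"
      using c d that R by (intro module_span_add[OF module_span_scale module_span_scale]) auto
    then show ?thesis by (simp add: algebra_simps)
  qed
  moreover have "c * d * (x * y) * w \<in> module_span R W" if "w \<in> W" for w
  proof -
    have "c * x * (d * y * w) \<in> module_span R W"
      by (rule module_span_trans_mult[OF R c(3) d(3)[OF that]])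
    then show ?thesis by (simp add: algebra_simps)
  qed
  ultimately show "stable_under R W (x + y)" "stable_under R W (x * y)"
    using c d subring_setD(4)[OF R] by (auto simp: stable_under_def intro!: bexI[of _ "c * d"])
qed

lemma subring_alg_over:
  assumes R: "subring_set R"
  shows "subring_set (alg_over R)"
proof -
  have *: "x + y \<in> alg_over R \<and> x * y \<in> alg_over R" if xy: "x \<in> alg_over R" "y \<in> alg_over R" for x y
  proof -
    obtain W where "finite W" "1 \<in> W" "\<forall>z\<in>{x,y}. stable_under R W z"
      using stable_under_finite[OF R, of "{x,y}"] xy by auto
    then show ?thesis using stable_under_add[OF R] alg_overI_stable[OF R] by auto
  qed
  have "-1 \<in> alg_over R" "0 \<in> alg_over R" "1 \<in> alg_over R"
    using subset_alg_over[OF R] R by (auto simp: subring_setD)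
  then show ?thesis unfolding subring_set_def using * by (metis mult_minus1)
qed

lemma alg_over_inverse:
  assumes R: "subring_set R" and "x \<in> alg_over R"
  shows "inverse x \<in> alg_over R"
proof (cases "x = 0")
  case True then show ?thesis using assms by simp
next
  case False
  obtain p where p: "p \<noteq> 0" "poly_over R p" "poly p x = 0" using assms by (auto simp: alg_over_def)
  have "poly_over R (reflect_poly p)"
    using p(2) subring_setD(1)[OF R] by (auto simp: poly_over_def coeff_reflect_poly)
  moreover have "poly (reflect_poly p) (inverse x) = 0"
    using poly_reflect_poly_nz[of "inverse x" p] False p by simp
  ultimately show ?thesis using p(1) unfolding alg_over_def by (auto intro!: exI[of _ "reflect_poly p"])
qed

text \<open>Transitivity: the finitely many coefficients of a relation for \<open>x\<close> share
  one \<open>W\<close> over \<open>R\<close>, and \<open>W\<close> enlarged by powers of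
  \<open>x\<close> exhibits \<open>x\<close> itself as algebraic over \<open>R\<close>.\<close>

lemma alg_over_idem:
  assumes R: "subring_set R"
  shows "alg_over (alg_over R) = alg_over R"
proof
  show "alg_over R \<subseteq> alg_over (alg_over R)" by (rule subset_alg_over[OF subring_alg_over[OF R]])
  show "alg_over (alg_over R) \<subseteq> alg_over R"
  proof
    fix x assume "x \<in> alg_over (alg_over R)"
    then obtain d r where r: "\<And>i. i \<le> d \<Longrightarrow> r i \<in> alg_over R" "d > 0" "r d \<noteq> 0" "(\<Sum>i\<le>d. r i * x ^ i) = 0"
      using alg_over_relation by blast
    note A = subring_alg_over[OF R]
    define b where "b i = - (r i * inverse (r d))" for i
    have "r d * x ^ d = - (\<Sum>i<d. r i * x ^ i)"
      using r(4) by (simp add: lessThan_Suc_atMost[symmetric] eq_neg_iff_add_eq_0 add.commute)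
    then have x: "x ^ d = (\<Sum>i<d. b i * x ^ i)"
      using r(3) by (simp add: b_def field_simps sum_divide_distrib[symmetric] sum_negf)
    have "b ` {..<d} \<subseteq> alg_over R"
      using r alg_over_inverse[OF R] subring_setD[OF A] by (auto simp: b_def)
    then obtain W where W: "finite W" "1 \<in> W" "\<forall>z\<in>b ` {..<d}. stable_under R W z"
      using stable_under_finite[OF R, of "b ` {..<d}"] by auto
    show "x \<in> alg_over R"
      using stable_under_adjoin(1-3)[OF R W(1,2) r(2) _ x] W(3) alg_overI_stable[OF R] by blast
  qed
qed

section \<open>The closure operator, its exchange property, and bases\<close>

inductive_set ring_gen :: "'a::field set \<Rightarrow> 'a set" for S where
  ring_gen_base: "x \<in> S \<Longrightarrow> x \<in> ring_gen S"
| ring_gen_0: "0 \<in> ring_gen S"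
| ring_gen_1: "1 \<in> ring_gen S"
| ring_gen_add: "x \<in> ring_gen S \<Longrightarrow> y \<in> ring_gen S \<Longrightarrow> x + y \<in> ring_gen S"
| ring_gen_mult: "x \<in> ring_gen S \<Longrightarrow> y \<in> ring_gen S \<Longrightarrow> x * y \<in> ring_gen S"
| ring_gen_minus: "x \<in> ring_gen S \<Longrightarrow> - x \<in> ring_gen S"

lemma subring_ring_gen: "subring_set (ring_gen S)"
  by (auto simp: subring_set_def intro: ring_gen.intros)

lemma ring_gen_least: "subring_set R \<Longrightarrow> S \<subseteq> R \<Longrightarrow> ring_gen S \<subseteq> R"
proof
  fix x assume "x \<in> ring_gen S" "subring_set R" "S \<subseteq> R"
  then show "x \<in> R" by (induction rule: ring_gen.induct) (auto simp: subring_setD) 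
qed

lemma ring_gen_mono: "S \<subseteq> T \<Longrightarrow> ring_gen S \<subseteq> ring_gen T"
  by (rule ring_gen_least[OF subring_ring_gen]) (auto intro: ring_gen_base)

lemma ring_gen_finitary: "x \<in> ring_gen S \<Longrightarrow> \<exists>S0. finite S0 \<and> S0 \<subseteq> S \<and> x \<in> ring_gen S0"
proof (induction rule: ring_gen.induct)
  case (ring_gen_base x) then show ?case by (intro exI[of _ "{x}"]) (auto intro: ring_gen.intros)
next
  case (ring_gen_add x y)
  then obtain A B where "finite A" "A \<subseteq> S" "x \<in> ring_gen A" "finite B" "B \<subseteq> S" "y \<in> ring_gen B" by auto
  moreover have "x \<in> ring_gen (A \<union> B)" "y \<in> ring_gen (A \<union> B)"
    using calculation ring_gen_mono[of A "A \<union> B"] ring_gen_mono[of B "A \<union> B"] by auto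
  ultimately show ?case by (intro exI[of _ "A \<union> B"]) (auto intro: ring_gen.intros)
next
  case (ring_gen_mult x y)
  then obtain A B where "finite A" "A \<subseteq> S" "x \<in> ring_gen A" "finite B" "B \<subseteq> S" "y \<in> ring_gen B" by auto
  moreover have "x \<in> ring_gen (A \<union> B)" "y \<in> ring_gen (A \<union> B)"
    using calculation ring_gen_mono[of A "A \<union> B"] ring_gen_mono[of B "A \<union> B"] by auto
  ultimately show ?case by (intro exI[of _ "A \<union> B"]) (auto intro: ring_gen.intros)
qed (auto intro: ring_gen.intros)

lemma ring_gen_insert:
  assumes "y \<in> ring_gen (insert x S)"
  shows "\<exists>p. poly_over (ring_gen S) p \<and> y = poly p x"
  using assms
proof (induction rule: ring_gen.induct)
  note D = subring_setD[OF subring_ring_gen[of S]]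
  have const: "poly_over (ring_gen S) [:c:]" if "c \<in> ring_gen S" for c
    using that D by (auto simp: poly_over_def coeff_pCons split: nat.splits)
  case (ring_gen_base y)
  have X: "poly_over (ring_gen S) [:0,1:]"
    using D by (auto simp: poly_over_def coeff_pCons split: nat.splits)
  show ?case
  proof (cases "y = x")
    case True then show ?thesis using X by (intro exI[of _ "[:0,1:]"]) auto
  next
    case False then show ?thesis using const[of y] ring_gen_base by (intro exI[of _ "[:y:]"]) (auto intro: ring_gen.intros)
  qed
next
  case ring_gen_0 show ?case by (intro exI[of _ 0]) (auto simp: poly_over_def intro: ring_gen.intros)
next
  case ring_gen_1 show ?case by (intro exI[of _ 1]) (auto simp: poly_over_def intro: ring_gen.intros)
next
  case (ring_gen_add y z)
  then obtain p q where "poly_over (ring_gen S) p" "y = poly p x" "poly_over (ring_gen S) q" "z = poly q x" by auto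
  then show ?case by (intro exI[of _ "p + q"]) (auto simp: poly_over_def intro: ring_gen.intros)
next
  case (ring_gen_mult y z)
  then obtain p q where "poly_over (ring_gen S) p" "y = poly p x" "poly_over (ring_gen S) q" "z = poly q x" by auto
  then show ?case by (intro exI[of _ "p * q"])
      (auto simp: poly_over_def coeff_mult intro!: subring_set_sum subring_ring_gen intro: ring_gen.intros)
next
  case (ring_gen_minus y)
  then obtain p where "poly_over (ring_gen S) p" "y = poly p x" by auto
  then show ?case by (intro exI[of _ "- p"]) (auto simp: poly_over_def intro: ring_gen.intros)
qed

definition alg_cl :: "'a::field set \<Rightarrow> 'a set" where
  "alg_cl S = alg_over (ring_gen S)"

lemma alg_cl_subring: "subring_set (alg_cl S)"
  unfolding alg_cl_def by (rule subring_alg_over[OF subring_ring_gen])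

lemma alg_cl_inverse: "x \<in> alg_cl S \<Longrightarrow> inverse x \<in> alg_cl S"
  unfolding alg_cl_def by (rule alg_over_inverse[OF subring_ring_gen])

lemma alg_cl_divide: "x \<in> alg_cl S \<Longrightarrow> y \<in> alg_cl S \<Longrightarrow> x / y \<in> alg_cl S"
  by (simp add: divide_inverse alg_cl_inverse subring_setD(4)[OF alg_cl_subring])

lemma alg_over_alg_cl: "alg_over (alg_cl S) = alg_cl S"
  unfolding alg_cl_def by (rule alg_over_idem[OF subring_ring_gen])

lemma ring_gen_subset_alg_cl: "ring_gen S \<subseteq> alg_cl S"
  unfolding alg_cl_def by (rule subset_alg_over[OF subring_ring_gen])

lemma alg_cl_extensive: "S \<subseteq> alg_cl S"
  using ring_gen_subset_alg_cl ring_gen_base by blast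

lemma alg_cl_mono: "S \<subseteq> T \<Longrightarrow> alg_cl S \<subseteq> alg_cl T"
  unfolding alg_cl_def by (intro alg_over_mono ring_gen_mono)

lemma alg_cl_least: "S \<subseteq> alg_cl T \<Longrightarrow> alg_cl S \<subseteq> alg_cl T"
proof -
  assume "S \<subseteq> alg_cl T"
  then have "ring_gen S \<subseteq> alg_cl T" by (rule ring_gen_least[OF alg_cl_subring])
  then show ?thesis using alg_over_mono[of "ring_gen S" "alg_cl T"] alg_over_alg_cl[of T]
    by (simp add: alg_cl_def)
qed

lemma alg_cl_finitary: "x \<in> alg_cl S \<Longrightarrow> \<exists>S0. finite S0 \<and> S0 \<subseteq> S \<and> x \<in> alg_cl S0"
proof -
  assume "x \<in> alg_cl S"
  then obtain d r where r: "\<And>i. i \<le> d \<Longrightarrow> r i \<in> ring_gen S" "d > 0" "r d \<noteq> 0" "(\<Sum>i\<le>d. r i * x ^ i) = 0"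
    using alg_over_relation unfolding alg_cl_def by blast
  have "\<forall>i. \<exists>F. i \<le> d \<longrightarrow> finite F \<and> F \<subseteq> S \<and> r i \<in> ring_gen F"
    using ring_gen_finitary[OF r(1)] by meson
  then obtain F where F: "\<And>i. i \<le> d \<Longrightarrow> finite (F i) \<and> F i \<subseteq> S \<and> r i \<in> ring_gen (F i)" by metis
  let ?U = "\<Union>i\<le>d. F i"
  have "r i \<in> ring_gen ?U" if "i \<le> d" for i
  proof -
    have "F i \<subseteq> ?U" using that by blast
    then show ?thesis using F[OF that] ring_gen_mono by blast
  qed
  then have "x \<in> alg_cl ?U" unfolding alg_cl_def using r
    by (intro alg_over_coeffsI[of d r _ d]) (auto intro: ring_gen_0)
  moreover have "finite ?U" "?U \<subseteq> S" using F by auto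
  ultimately show ?thesis by blast
qed

text \<open>A relation for \<open>y\<close> over the ring generated by \<open>x\<close> and
  \<open>S\<close> is a polynomial expression in both. Sorted by powers of \<open>x\<close> instead
  of \<open>y\<close>, it becomes a relation for \<open>x\<close> over the ring generated by
  \<open>y\<close> and \<open>S\<close>.\<close>

lemma alg_cl_exchange:
  assumes "y \<in> alg_cl (insert x S)" "y \<notin> alg_cl S"
  shows "x \<in> alg_cl (insert y S)"
proof -
  let ?R = "ring_gen S"
  obtain d r where r: "\<And>i. i \<le> d \<Longrightarrow> r i \<in> ring_gen (insert x S)" "d > 0" "r d \<noteq> 0" "(\<Sum>i\<le>d. r i * y ^ i) = 0"
    using alg_over_relation assms(1) unfolding alg_cl_def by blast
  have "\<forall>i. \<exists>p. i \<le> d \<longrightarrow> poly_over ?R p \<and> r i = poly p x" using ring_gen_insert[OF r(1)] by meson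
  then obtain Q where Q: "\<And>i. i \<le> d \<Longrightarrow> poly_over ?R (Q i) \<and> r i = poly (Q i) x" by metis
  define D where "D = (\<Sum>i\<le>d. degree (Q i))"
  have D: "degree (Q i) \<le> D" if "i \<le> d" for i
    unfolding D_def using that by (intro member_le_sum) auto
  have Qx: "poly (Q i) x = (\<Sum>j\<le>D. coeff (Q i) j * x ^ j)" if "i \<le> d" for i
    unfolding poly_altdef using D[OF that]
    by (intro sum.mono_neutral_left) (auto simp: coeff_eq_0)
  define T where "T j = (\<Sum>i\<le>d. coeff (Q i) j * y ^ i)" for j
  have "(\<Sum>j\<le>D. T j * x ^ j) = (\<Sum>j\<le>D. \<Sum>i\<le>d. coeff (Q i) j * y ^ i * x ^ j)"
    by (simp add: T_def sum_distrib_right)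
  also have "\<dots> = (\<Sum>i\<le>d. \<Sum>j\<le>D. coeff (Q i) j * y ^ i * x ^ j)" by (rule sum.swap)
  also have "\<dots> = (\<Sum>i\<le>d. r i * y ^ i)"
    by (intro sum.cong) (auto simp: Q Qx sum_distrib_left algebra_simps)
  finally have 0: "(\<Sum>j\<le>D. T j * x ^ j) = 0" using r by simp
  have "Q d \<noteq> 0" using Q[of d] r(3) by auto
  \<comment> \<open>Some power of \<open>x\<close> occurs in the leading coefficient
    \<open>Q d\<close>. The terms with this power form a nonzero polynomial in \<open>y\<close> over
    the ring of \<open>S\<close>, whose value cannot vanish because \<open>y\<close> is not
    algebraic over \<open>S\<close>.\<close>
  then obtain j0 where j0: "coeff (Q d) j0 \<noteq> 0" by (metis leading_coeff_0_iff)
  then have "j0 \<le> D" using D[of d] le_degree[of "Q d" j0] by simp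
  have "T j0 \<noteq> 0"
  proof
    assume "T j0 = 0"
    then have "y \<in> alg_over ?R" using Q j0 unfolding T_def
      by (intro alg_over_coeffsI[of d "\<lambda>i. coeff (Q i) j0" _ d]) (auto simp: poly_over_def intro: ring_gen_0)
    then show False using assms(2) by (simp add: alg_cl_def)
  qed
  moreover have "T j \<in> ring_gen (insert y S)" for j
    unfolding T_def using Q ring_gen_mono[of S "insert y S"]
    by (intro subring_set_sum subring_ring_gen ring_gen_mult subring_set_power)
       (auto simp: poly_over_def intro: ring_gen.intros)
  ultimately show ?thesis unfolding alg_cl_def using 0 \<open>j0 \<le> D\<close>
    by (intro alg_over_coeffsI[of D T _ j0]) (auto intro: ring_gen_0)
qed

text \<open>Independence in the sense of the closure operator makes sense in every characteristic.
  In characteristic zero it agrees with the polynomial notion of the statement, as shown further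
  below.\<close>

definition alg_indep :: "'a::field set \<Rightarrow> bool" where
  "alg_indep S \<longleftrightarrow> (\<forall>x\<in>S. x \<notin> alg_cl (S - {x}))"

lemma alg_indep_subset: "alg_indep S \<Longrightarrow> T \<subseteq> S \<Longrightarrow> alg_indep T"
  unfolding alg_indep_def using alg_cl_mono[of "T - {x}" "S - {x}" for x] by blast

lemma alg_indep_insert:
  assumes "alg_indep S" "x \<notin> alg_cl S"
  shows "alg_indep (insert x S)"
  unfolding alg_indep_def
proof
  fix y assume y: "y \<in> insert x S"
  have xS: "x \<notin> S" using assms(2) alg_cl_extensive[of S] by blast
  show "y \<notin> alg_cl (insert x S - {y})"
  proof (cases "y = x")
    case True then show ?thesis using assms xS by simp
  next
    case False
    then have "y \<in> S" and e: "insert x S - {y} = insert x (S - {y})" using y by auto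
    then have n: "y \<notin> alg_cl (S - {y})" using assms by (auto simp: alg_indep_def)
    show ?thesis
    proof
      assume "y \<in> alg_cl (insert x S - {y})"
      then have "x \<in> alg_cl (insert y (S - {y}))" using alg_cl_exchange n e by metis
      then show False using assms(2) \<open>y \<in> S\<close> by (simp add: insert_absorb)
    qed
  qed
qed

lemma alg_indep_finitary:
  assumes "\<And>T. finite T \<Longrightarrow> T \<subseteq> S \<Longrightarrow> alg_indep T"
  shows "alg_indep S"
  unfolding alg_indep_def
proof (intro ballI notI)
  fix x assume x: "x \<in> S" "x \<in> alg_cl (S - {x})"
  obtain F where F: "finite F" "F \<subseteq> S - {x}" "x \<in> alg_cl F" using alg_cl_finitary[OF x(2)] by auto
  have "insert x F \<subseteq> S" using F x by auto
  then have "alg_indep (insert x F)" using assms F(1) by simp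
  then have "x \<notin> alg_cl (insert x F - {x})" unfolding alg_indep_def by blast
  moreover have "insert x F - {x} = F" using F by auto
  ultimately show False using F by simp
qed

text \<open>Steinitz exchange: an element of \<open>I\<close> outside \<open>J\<close> is traded for
  an element of \<open>J\<close> that the rest of \<open>I\<close> does not generate, so
  \<open>I\<close> keeps its size and moves towards \<open>J\<close>.\<close>

lemma alg_indep_card_le:
  assumes "finite I" "finite J" "alg_indep I" "I \<subseteq> alg_cl J"
  shows "card I \<le> card J"
  using assms
proof (induction "card (I - J)" arbitrary: I rule: less_induct)
  case less
  show ?case
  proof (cases "I \<subseteq> J")
    case True then show ?thesis using less by (auto intro: card_mono)
  next
    case False
    then obtain x where x: "x \<in> I" "x \<notin> J" by auto
    have "\<not> J \<subseteq> alg_cl (I - {x})"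
    proof
      assume "J \<subseteq> alg_cl (I - {x})"
      then have "x \<in> alg_cl (I - {x})" using alg_cl_least less.prems x by blast
      then show False using less.prems x by (auto simp: alg_indep_def)
    qed
    then obtain y where y: "y \<in> J" "y \<notin> alg_cl (I - {x})" by auto
    let ?I = "insert y (I - {x})"
    have yI: "y \<notin> I - {x}" using y alg_cl_extensive[of "I - {x}"] by blast
    have "card ?I = card I" using yI x less.prems card.remove[of I x] by simp
    moreover have "?I - J \<subset> I - J" using x y by auto
    then have "card (?I - J) < card (I - J)" using less.prems by (intro psubset_card_mono) auto
    moreover have "alg_indep ?I" by (rule alg_indep_insert[OF alg_indep_subset[OF less.prems(3)] y(2)]) auto
    moreover have "?I \<subseteq> alg_cl J" using less.prems y alg_cl_extensive[of J] by blast
    ultimately show ?thesis using less.hyps[of ?I] less.prems by auto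
  qed
qed

text \<open>Dropping a redundant element of \<open>J\<close> would leave too few generators for the
  independent set \<open>I\<close>.\<close>

lemma alg_indep_of_card:
  assumes "finite I" "finite J" "alg_indep I" "I \<subseteq> alg_cl J" "card J \<le> card I"
  shows "alg_indep J"
  unfolding alg_indep_def
proof (intro ballI notI)
  fix x assume x: "x \<in> J" "x \<in> alg_cl (J - {x})"
  then have "J \<subseteq> alg_cl (J - {x})" using alg_cl_extensive[of "J - {x}"] by blast
  then have "I \<subseteq> alg_cl (J - {x})" using assms(4) alg_cl_least by blast
  then have "card I \<le> card (J - {x})" using alg_indep_card_le assms by blast
  then show False using assms x by (metis card_Diff1_less not_le order_trans)
qed

text \<open>Independence is of finite character, so Zorn's lemma applies; a maximal independent set
  generates everything, since an element outside its closure could be added.\<close>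

lemma alg_basis_exists: "\<exists>B::'a::field set. alg_indep B \<and> alg_cl B = UNIV"
proof -
  have "\<exists>M\<in>{S::'a set. alg_indep S}. \<forall>X\<in>{S. alg_indep S}. M \<subseteq> X \<longrightarrow> X = M"
  proof (rule subset_Zorn')
    fix C assume C: "subset.chain {S::'a set. alg_indep S} C"
    have "alg_indep (\<Union>C)"
    proof (rule alg_indep_finitary)
      fix T assume T: "finite T" "T \<subseteq> \<Union>C"
      show "alg_indep T"
      proof (cases "C = {}")
        case True then show ?thesis using T by (simp add: alg_indep_def)
      next
        case False
        then obtain M where "M \<in> C" "T \<subseteq> M"
          using finite_subset_Union_chain[OF T False C] by auto
        then show ?thesis using C alg_indep_subset by (auto simp: subset.chain_def)
      qed
    qed
    then show "\<Union>C \<in> {S. alg_indep S}" by simp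
  qed
  then obtain B :: "'a set" where B: "alg_indep B" "\<And>X. alg_indep X \<Longrightarrow> B \<subseteq> X \<Longrightarrow> X = B" by auto
  have "x \<in> alg_cl B" for x
    using B(2)[of "insert x B"] alg_indep_insert[OF B(1), of x] alg_cl_extensive[of B] by blast
  then show ?thesis using B by auto
qed

section \<open>Algebraic independence over the rationals\<close>

abbreviation "lu \<equiv> Poly_Mapping.lookup"
abbreviation "ks \<equiv> Poly_Mapping.keys"
abbreviation "sg \<equiv> Poly_Mapping.single"

lemma of_int_eq_0_iff_char_0: "CHAR('a::field) = 0 \<Longrightarrow> (of_int n :: 'a) = 0 \<longleftrightarrow> n = 0"
  by (simp add: of_int_eq_0_iff_char_dvd)

text \<open>\<open>rat_in\<close> is computed from the reduced fraction. Any other fraction gives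
  the same value because nonzero integers stay nonzero in characteristic zero.\<close>

lemma rat_in_eq:
  assumes "CHAR('a::field) = 0" "b \<noteq> 0" "q = of_int a / of_int b"
  shows "(rat_in q :: 'a) = of_int a / of_int b"
proof -
  obtain c d where cd: "quotient_of q = (c, d)" by fastforce
  then have "d > 0" and q: "q = of_int c / of_int d" by (auto simp: quotient_of_denom_pos quotient_of_div)
  then have "(of_int (c * b) :: rat) = of_int (a * d)"
    using assms by (simp add: field_simps)
  then have "c * b = a * d" by (simp only: of_int_eq_iff)
  then have "(of_int c * of_int b :: 'a) = of_int a * of_int d" by (metis of_int_mult)
  moreover have "(of_int b :: 'a) \<noteq> 0" "(of_int d :: 'a) \<noteq> 0"
    using assms \<open>d > 0\<close> by (simp_all add: of_int_eq_0_iff_char_0)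
  ultimately show ?thesis using cd by (simp add: rat_in_def frac_eq_eq)
qed

lemma rat_in_hom:
  assumes "CHAR('a::field) = 0"
  shows "(rat_in (p + q) :: 'a) = rat_in p + rat_in q" "(rat_in (p * q) :: 'a) = rat_in p * rat_in q"
    "(rat_in (of_int n) :: 'a) = of_int n" "(rat_in p :: 'a) = 0 \<longleftrightarrow> p = 0"
proof -
  obtain a b c d where "quotient_of p = (a, b)" "quotient_of q = (c, d)" by fastforce
  then have bd: "b \<noteq> 0" "d \<noteq> 0" and p: "p = of_int a / of_int b" and q: "q = of_int c / of_int d"
    using quotient_of_denom_pos by (force simp: quotient_of_div)+
  have nz: "(of_int b :: 'a) \<noteq> 0" "(of_int d :: 'a) \<noteq> 0"
    using assms bd by (simp_all add: of_int_eq_0_iff_char_0)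
  have pq: "(rat_in p :: 'a) = of_int a / of_int b" "(rat_in q :: 'a) = of_int c / of_int d"
    using rat_in_eq[OF assms] bd p q by auto
  have "p + q = of_int (a * d + c * b) / of_int (b * d)" using bd by (simp add: p q field_simps)
  from rat_in_eq[OF assms _ this] show "(rat_in (p + q) :: 'a) = rat_in p + rat_in q"
    using bd nz pq by (simp add: add_frac_eq mult.commute)
  have "p * q = of_int (a * c) / of_int (b * d)" by (simp add: p q)
  from rat_in_eq[OF assms _ this] show "(rat_in (p * q) :: 'a) = rat_in p * rat_in q"
    using bd pq by simp
  show "(rat_in (of_int n) :: 'a) = of_int n" using rat_in_eq[OF assms, of 1 "of_int n" n] by simp
  show "(rat_in p :: 'a) = 0 \<longleftrightarrow> p = 0" using pq nz bd assms by (simp add: p of_int_eq_0_iff_char_0)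
qed

lemma rat_in_0 [simp]: "rat_in 0 = 0" and rat_in_1 [simp]: "rat_in 1 = 1"
  by (simp_all add: rat_in_def)

section \<open>Evaluation of monomials and polynomials over the rationals\<close>

definition mon_eval :: "('a::field \<Rightarrow>\<^sub>0 nat) \<Rightarrow> 'a" where
  "mon_eval m = (\<Prod>x\<in>ks m. x ^ lu m x)"

lemma mpoly_eval_mon: "mpoly_eval p = (\<Sum>m\<in>ks p. rat_in (lu p m) * mon_eval m)"
  by (simp add: mpoly_eval_def mon_eval_def)

lemma mon_eval_superset: "finite V \<Longrightarrow> ks m \<subseteq> V \<Longrightarrow> mon_eval m = (\<Prod>x\<in>V. x ^ lu m x)"
  unfolding mon_eval_def by (rule prod.mono_neutral_left) (auto simp: in_keys_iff)

lemma mon_eval_add: "mon_eval (m + m') = mon_eval m * mon_eval m'"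
proof -
  let ?V = "ks m \<union> ks m'"
  have "ks (m + m') \<subseteq> ?V" by (rule keys_add)
  then show ?thesis
    by (simp add: mon_eval_superset[of ?V] lookup_add power_add prod.distrib)
qed

lemma mon_eval_single: "mon_eval (sg x i) = x ^ i"
  by (cases "i = 0") (auto simp: mon_eval_def)

lemma mpoly_eval_superset:
  "finite M \<Longrightarrow> ks p \<subseteq> M \<Longrightarrow> mpoly_eval p = (\<Sum>m\<in>M. rat_in (lu p m) * mon_eval m)"
  unfolding mpoly_eval_mon by (rule sum.mono_neutral_left) (auto simp: in_keys_iff)

lemma mpoly_eval_single: "mpoly_eval (sg m a) = rat_in a * mon_eval m"
  by (cases "a = 0") (auto simp: mpoly_eval_mon)

lemma mpoly_eval_add:
  assumes "CHAR('a::field) = 0"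
  shows "mpoly_eval (p + q) = mpoly_eval p + (mpoly_eval q :: 'a)"
proof -
  let ?V = "ks p \<union> ks q"
  have "ks (p + q) \<subseteq> ?V" by (rule keys_add)
  then show ?thesis
    by (simp add: mpoly_eval_superset[of ?V] lookup_add rat_in_hom[OF assms] distrib_right sum.distrib)
qed

lemma mpoly_eval_sum:
  assumes "CHAR('a::field) = 0"
  shows "mpoly_eval (sum f I) = (\<Sum>i\<in>I. mpoly_eval (f i) :: 'a)"
proof -
  have "mpoly_eval 0 = (0::'a)" by (simp add: mpoly_eval_mon)
  then show ?thesis by (induction I rule: infinite_finite_induct) (auto simp: mpoly_eval_add[OF assms])
qed

lemma mpoly_expansion: "p = (\<Sum>m\<in>ks p. sg m (lu p m))"
  by (rule poly_mapping_eqI) (auto simp: lookup_sum lookup_single when_def in_keys_iff)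

lemma mpoly_eval_mult:
  assumes "CHAR('a::field) = 0"
  shows "mpoly_eval (p * q) = mpoly_eval p * (mpoly_eval q :: 'a)"
proof -
  have "p * q = (\<Sum>m\<in>ks p. sg m (lu p m)) * (\<Sum>m\<in>ks q. sg m (lu q m))"
    using mpoly_expansion[of p] mpoly_expansion[of q] by simp
  also have "\<dots> = (\<Sum>m\<in>ks p. \<Sum>m'\<in>ks q. sg (m + m') (lu p m * lu q m'))"
    by (simp add: sum_product mult_single)
  finally have "mpoly_eval (p * q) = (\<Sum>m\<in>ks p. \<Sum>m'\<in>ks q. (rat_in (lu p m) * mon_eval m) * (rat_in (lu q m') * mon_eval m') :: 'a)"
    by (simp add: mpoly_eval_sum[OF assms] mpoly_eval_single mon_eval_add rat_in_hom[OF assms] algebra_simps)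
  then show ?thesis by (simp add: mpoly_eval_mon sum_product)
qed

definition vars_in :: "'a set \<Rightarrow> (('a::field \<Rightarrow>\<^sub>0 nat) \<Rightarrow>\<^sub>0 rat) \<Rightarrow> bool" where
  "vars_in V p \<longleftrightarrow> (\<forall>m\<in>ks p. ks m \<subseteq> V)"

lemma vars_in_add: "vars_in V p \<Longrightarrow> vars_in V q \<Longrightarrow> vars_in V (p + q)"
  using keys_add[of p q] by (auto simp: vars_in_def)

lemma vars_in_sum: "(\<And>i. i \<in> I \<Longrightarrow> vars_in V (f i)) \<Longrightarrow> vars_in V (sum f I)"
  by (induction I rule: infinite_finite_induct) (auto intro: vars_in_add, auto simp: vars_in_def)

lemma vars_in_mult: "vars_in V p \<Longrightarrow> vars_in V q \<Longrightarrow> vars_in V (p * q)"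
  unfolding vars_in_def
proof
  fix m assume pq: "\<forall>m\<in>ks p. ks m \<subseteq> V" "\<forall>m\<in>ks q. ks m \<subseteq> V" and m: "m \<in> ks (p * q)"
  then obtain a b where "a \<in> ks p" "b \<in> ks q" "m = a + b" using keys_mult[of p q] by auto
  then show "ks m \<subseteq> V" using keys_add[of a b] pq by blast
qed

lemma ring_gen_mpoly_eval:
  fixes S :: "'a::field set"
  assumes "CHAR('a) = 0" "r \<in> ring_gen S"
  shows "\<exists>p. vars_in S p \<and> r = mpoly_eval p"
  using assms(2)
proof (induction rule: ring_gen.induct)
  case (ring_gen_base x)
  then show ?case by (intro exI[of _ "sg (sg x 1) 1"]) (auto simp: vars_in_def mpoly_eval_single mon_eval_single)
next
  case ring_gen_0 show ?case by (intro exI[of _ 0]) (auto simp: vars_in_def mpoly_eval_mon)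
next
  case ring_gen_1 show ?case
    by (intro exI[of _ "sg 0 1"]) (auto simp: vars_in_def mpoly_eval_single mon_eval_def simp del: single_one)
next
  case (ring_gen_add x y)
  then obtain p q where "vars_in S p" "x = mpoly_eval p" "vars_in S q" "y = mpoly_eval q" by auto
  then show ?case by (intro exI[of _ "p + q"]) (auto simp: mpoly_eval_add[OF assms(1)] vars_in_add)
next
  case (ring_gen_mult x y)
  then obtain p q where "vars_in S p" "x = mpoly_eval p" "vars_in S q" "y = mpoly_eval q" by auto
  then show ?case by (intro exI[of _ "p * q"]) (auto simp: mpoly_eval_mult[OF assms(1)] vars_in_mult)
next
  case (ring_gen_minus x)
  then obtain p where p: "vars_in S p" "x = mpoly_eval p" by auto
  have "mpoly_eval p + mpoly_eval (- p) = (0::'a)"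
    using mpoly_eval_add[OF assms(1), of p "- p"] by (simp add: mpoly_eval_mon)
  then have "- x = mpoly_eval (- p)" using p by (simp add: neg_eq_iff_add_eq_0)
  moreover have "vars_in S (- p)" using p by (auto simp: vars_in_def in_keys_iff)
  ultimately show ?case by blast
qed

text \<open>Rational coefficients may lie outside the generated ring, but the closure contains them
  because it is closed under division.\<close>

lemma mpoly_eval_in_alg_cl:
  assumes "vars_in S p"
  shows "mpoly_eval p \<in> alg_cl S"
  unfolding mpoly_eval_mon mon_eval_def rat_in_def
  using assms alg_cl_extensive[of S]
  by (intro subring_set_sum subring_setD(4)[OF alg_cl_subring] subring_set_prod subring_set_power alg_cl_subring)
     (auto simp: vars_in_def alg_cl_divide subring_set_of_int[OF alg_cl_subring] split: prod.split)

text \<open>Multiplying polynomials free of \<open>x\<close> by different powers of \<open>x\<close>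
  moves their monomials to disjoint places, so in a sum of such products each coefficient can be
  read off separately.\<close>

lemma lookup_mult_single_power:
  assumes "x \<notin> ks m0" "\<And>m. m \<in> ks q \<Longrightarrow> x \<notin> ks m"
  shows "lu (q * sg (sg x (i::nat)) 1) (m0 + sg x k) = (if i = k then lu q m0 else (0::rat))"
proof -
  have "q * sg (sg x i) 1 = (\<Sum>m\<in>ks q. sg m (lu q m)) * sg (sg x i) 1"
    using mpoly_expansion[of q] by simp
  also have "\<dots> = (\<Sum>m\<in>ks q. sg (m + sg x i) (lu q m))"
    by (simp add: sum_distrib_right mult_single)
  finally have "lu (q * sg (sg x i) 1) (m0 + sg x k) = (\<Sum>m\<in>ks q. lu q m when m + sg x i = m0 + sg x k)"
    by (simp add: lookup_sum lookup_single)
  also have "\<dots> = (\<Sum>m\<in>ks q. if m = m0 then (if i = k then lu q m0 else 0) else 0)"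
  proof (intro sum.cong refl)
    fix m assume m: "m \<in> ks q"
    have "m + sg x i = m0 + sg x k \<longleftrightarrow> m = m0 \<and> i = k"
    proof
      assume e: "m + sg x i = m0 + sg x k"
      then have "lu (m + sg x i) x = lu (m0 + sg x k) x" by simp
      then have "i = k" using assms m by (auto simp: lookup_add in_keys_iff)
      then show "m = m0 \<and> i = k" using e by simp
    qed simp
    then show "(lu q m when m + sg x i = m0 + sg x k) = (if m = m0 then (if i = k then lu q m0 else 0) else 0)"
      by (auto simp: when_def)
  qed
  also have "\<dots> = (if i = k then lu q m0 else 0)" by (auto simp: in_keys_iff)
  finally show ?thesis .
qed

text \<open>A relation for \<open>x\<close> over the other elements lifts to a polynomial with one
  more variable. It is nonzero because a monomial of the leading coefficient, times the top power of
  \<open>x\<close>, is produced by no other term.\<close>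

lemma alg_independent_over_Q_imp_alg_indep:
  fixes S :: "'a::field set"
  assumes ch: "CHAR('a) = 0" and S: "alg_independent_over_Q S"
  shows "alg_indep S"
  unfolding alg_indep_def
proof (intro ballI notI)
  fix x assume x: "x \<in> S" "x \<in> alg_cl (S - {x})"
  obtain d r where r: "\<And>i. i \<le> d \<Longrightarrow> r i \<in> ring_gen (S - {x})" "d > 0" "r d \<noteq> 0" "(\<Sum>i\<le>d. r i * x ^ i) = 0"
    using alg_over_relation x(2) unfolding alg_cl_def by blast
  have "\<forall>i. \<exists>p. i \<le> d \<longrightarrow> vars_in (S - {x}) p \<and> r i = mpoly_eval p"
    using ring_gen_mpoly_eval[OF ch r(1)] by meson
  then obtain q where q: "\<And>i. i \<le> d \<Longrightarrow> vars_in (S - {x}) (q i) \<and> r i = mpoly_eval (q i)" by metis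
  define p where "p = (\<Sum>i\<le>d. q i * sg (sg x i) 1)"
  have "mpoly_eval p = (\<Sum>i\<le>d. r i * x ^ i)"
    by (simp add: p_def mpoly_eval_sum[OF ch] mpoly_eval_mult[OF ch] mpoly_eval_single mon_eval_single q)
  then have p0: "mpoly_eval p = 0" using r by simp
  have "vars_in S (q i * sg (sg x i) 1)" if "i \<le> d" for i
    by (rule vars_in_mult) (use q[OF that] x in \<open>auto simp: vars_in_def\<close>)
  then have "vars_in S p" unfolding p_def by (intro vars_in_sum) auto
  moreover have "p \<noteq> 0"
  proof -
    have "q d \<noteq> 0" using q[of d] r(3) by (auto simp: mpoly_eval_mon)
    then obtain m0 where m0: "m0 \<in> ks (q d)" by fastforce
    have nx: "x \<notin> ks m" if "m \<in> ks (q i)" "i \<le> d" for m i using q that by (auto simp: vars_in_def)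
    have "lu p (m0 + sg x d) = (\<Sum>i\<le>d. if i = d then lu (q i) m0 else 0)"
      unfolding p_def lookup_sum
      by (intro sum.cong refl lookup_mult_single_power) (use nx m0 in auto)
    also have "\<dots> = lu (q d) m0" by simp
    finally show ?thesis using m0 by (auto simp: in_keys_iff)
  qed
  ultimately show False using S p0 by (auto simp: alg_independent_over_Q_def vars_in_def)
qed

definition mon_remove :: "'a \<Rightarrow> ('a \<Rightarrow>\<^sub>0 nat) \<Rightarrow> ('a \<Rightarrow>\<^sub>0 nat)" where
  "mon_remove x m = Poly_Mapping.update x 0 m"

lemma mon_remove_add: "mon_remove x m + sg x (lu m x) = m"
  by (rule poly_mapping_eqI) (auto simp: mon_remove_def lookup_add lookup_update lookup_single)

lemma keys_mon_remove: "ks (mon_remove x m) = ks m - {x}"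
  by (auto simp: mon_remove_def keys_update)

text \<open>Induction on the variables: sorted by powers of the new variable \<open>x\<close>, the
  polynomial has coefficients in the remaining variables, one of which has nonzero value by
  induction. A zero value of the whole would make \<open>x\<close> algebraic over the remaining
  variables.\<close>

lemma alg_indep_finite_imp_nonvanishing:
  fixes V :: "'a::field set"
  assumes ch: "CHAR('a) = 0" and "finite V" "alg_indep V" "vars_in V p" "p \<noteq> 0"
  shows "mpoly_eval p \<noteq> 0"
  using assms(2-)
proof (induction V arbitrary: p rule: finite_induct)
  case empty
  have k: "ks p = {0}" using empty keys_eq_empty[of p] unfolding vars_in_def by (metis (no_types) empty_iff equals0I insertI1 keys_eq_empty singleton_iff subset_empty subset_singletonD subsetI)
  then have "lu p 0 \<noteq> 0" by (metis insertI1 in_keys_iff)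
  then show ?case using k by (simp add: mpoly_eval_mon mon_eval_def rat_in_hom[OF ch])
next
  case (insert x V)
  have V: "alg_indep V" using insert.prems(1) by (rule alg_indep_subset) auto
  have x: "x \<notin> alg_cl V"
    using insert.prems(1) insert.hyps(2) by (auto simp: alg_indep_def)
  define M where "M i = {m \<in> ks p. lu m x = i}" for i
  define q where "q i = (\<Sum>m\<in>M i. sg (mon_remove x m) (lu p m))" for i
  define N where "N = (\<Sum>m\<in>ks p. lu m x)"
  have N: "lu m x \<le> N" if "m \<in> ks p" for m unfolding N_def using that by (intro member_le_sum) auto
  have fM: "finite (M i)" for i by (simp add: M_def)
  have qV: "vars_in V (q i)" for i
    unfolding q_def using insert.prems(2)
    by (intro vars_in_sum) (auto simp: vars_in_def M_def keys_mon_remove)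
  \<comment> \<open>Distinct monomials with the same exponent of \<open>x\<close> stay distinct when
    \<open>x\<close> is removed, so no coefficients merge.\<close>
  have lq: "lu (q i) (mon_remove x m) = lu p m" if "m \<in> M i" for i m
  proof -
    have "lu (q i) (mon_remove x m) = (\<Sum>m'\<in>M i. if m' = m then lu p m else 0)"
      unfolding q_def lookup_sum
    proof (intro sum.cong refl)
      fix m' assume "m' \<in> M i"
      then have "mon_remove x m' = mon_remove x m \<longleftrightarrow> m' = m"
        using that mon_remove_add[of x m] mon_remove_add[of x m'] by (auto simp: M_def)
      then show "lu (sg (mon_remove x m') (lu p m')) (mon_remove x m) = (if m' = m then lu p m else 0)"
        by (auto simp: lookup_single when_def)
    qed
    then show ?thesis using that fM by simp
  qed
  have "mpoly_eval p = (\<Sum>m\<in>ks p. rat_in (lu p m) * mon_eval (mon_remove x m) * x ^ lu m x)"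
    unfolding mpoly_eval_mon
    by (intro sum.cong refl, subst mon_remove_add[of x, symmetric], subst mon_eval_add) (simp add: mon_eval_single mon_remove_add)
  also have "\<dots> = (\<Sum>i\<le>N. \<Sum>m\<in>M i. rat_in (lu p m) * mon_eval (mon_remove x m) * x ^ lu m x)"
    unfolding M_def using N by (subst sum.group) auto
  also have "\<dots> = (\<Sum>i\<le>N. mpoly_eval (q i) * x ^ i)"
    by (intro sum.cong refl) (auto simp: q_def mpoly_eval_sum[OF ch] mpoly_eval_single sum_distrib_right M_def)
  finally have e: "mpoly_eval p = (\<Sum>i\<le>N. mpoly_eval (q i) * x ^ i)" .
  obtain m where m: "m \<in> ks p" using insert.prems(3) by fastforce
  let ?k = "lu m x"
  have "m \<in> M ?k" using m by (simp add: M_def)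
  then have "q ?k \<noteq> 0" using lq[of m ?k] m by (auto simp: in_keys_iff)
  then have nz: "mpoly_eval (q ?k) \<noteq> 0" using insert.IH V qV by blast
  show ?case
  proof
    assume "mpoly_eval p = 0"
    then have "x \<in> alg_over (alg_cl V)"
      using e nz N[OF m] mpoly_eval_in_alg_cl[OF qV] subring_setD(1)[OF alg_cl_subring]
      by (intro alg_over_coeffsI[of N "\<lambda>i. mpoly_eval (q i)" _ ?k]) auto
    then show False using x by (simp add: alg_over_alg_cl)
  qed
qed

lemma alg_independent_over_Q_iff:
  fixes S :: "'a::field set"
  assumes ch: "CHAR('a) = 0"
  shows "alg_independent_over_Q S \<longleftrightarrow> alg_indep S"
proof
  assume S: "alg_indep S"
  show "alg_independent_over_Q S"
    unfolding alg_independent_over_Q_def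
  proof (intro allI impI)
    fix p :: "('a \<Rightarrow>\<^sub>0 nat) \<Rightarrow>\<^sub>0 rat" assume p: "p \<noteq> 0" "\<forall>m\<in>ks p. ks m \<subseteq> S"
    let ?V = "\<Union>m\<in>ks p. ks m"
    have "alg_indep ?V" by (rule alg_indep_subset[OF S]) (use p in auto)
    then show "mpoly_eval p \<noteq> 0"
      using p by (intro alg_indep_finite_imp_nonvanishing[OF ch, of ?V]) (auto simp: vars_in_def)
  qed
qed (rule alg_independent_over_Q_imp_alg_indep[OF ch])

lemma finite_trdeg_over_Q_iff:
  assumes ch: "CHAR('a::field) = 0"
  shows "finite_trdeg_over_Q TYPE('a) \<longleftrightarrow> (\<exists>B::'a set. finite B \<and> alg_indep B \<and> alg_cl B = UNIV)"
proof -
  have "transcendence_basis_over_Q B \<longleftrightarrow> alg_indep B \<and> alg_cl B = UNIV" for B :: "'a set"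
  proof -
    have "(\<forall>x. x \<notin> B \<longrightarrow> \<not> alg_indep (insert x B)) \<longleftrightarrow> alg_cl B = UNIV" if B: "alg_indep B"
    proof
      assume "\<forall>x. x \<notin> B \<longrightarrow> \<not> alg_indep (insert x B)"
      then show "alg_cl B = UNIV" using alg_indep_insert[OF B] alg_cl_extensive[of B] by blast
    next
      assume u: "alg_cl B = UNIV"
      show "\<forall>x. x \<notin> B \<longrightarrow> \<not> alg_indep (insert x B)"
      proof (intro allI impI notI)
        fix x assume x: "x \<notin> B" "alg_indep (insert x B)"
        then have "x \<notin> alg_cl (insert x B - {x})" unfolding alg_indep_def by blast
        then show False using x u by simp
      qed
    qed
    then show ?thesis by (auto simp: transcendence_basis_over_Q_def alg_independent_over_Q_iff[OF ch])
  qed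
  then show ?thesis by (auto simp: finite_trdeg_over_Q_def)
qed

section \<open>Extending a bijection of transcendence bases to an automorphism\<close>

text \<open>A partial injective ring homomorphism, encoded as its graph so that unions of chains are unions of sets.\<close>

definition ring_graph :: "('a::field \<times> 'a) set \<Rightarrow> bool" where
  "ring_graph H \<longleftrightarrow> (0, 0) \<in> H \<and> (1, 1) \<in> H \<and>
     (\<forall>a b c d. (a, b) \<in> H \<longrightarrow> (c, d) \<in> H \<longrightarrow> (a + c, b + d) \<in> H \<and> (a * c, b * d) \<in> H) \<and>
     (\<forall>a b. (a, b) \<in> H \<longrightarrow> (- a, - b) \<in> H \<and> (a = 0 \<longleftrightarrow> b = 0))"

lemma ring_graphD:
  assumes "ring_graph H"
  shows "(0, 0) \<in> H" "(1, 1) \<in> H" "(a, b) \<in> H \<Longrightarrow> (c, d) \<in> H \<Longrightarrow> (a + c, b + d) \<in> H"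
    "(a, b) \<in> H \<Longrightarrow> (c, d) \<in> H \<Longrightarrow> (a * c, b * d) \<in> H" "(a, b) \<in> H \<Longrightarrow> (- a, - b) \<in> H"
    "(a, b) \<in> H \<Longrightarrow> a = 0 \<longleftrightarrow> b = 0"
  using assms unfolding ring_graph_def by blast+

lemma ring_graph_converse: "ring_graph H \<Longrightarrow> ring_graph (H\<inverse>)"
  unfolding ring_graph_def by auto

lemma ring_graph_sum:
  "ring_graph H \<Longrightarrow> (\<And>i. i \<in> I \<Longrightarrow> (f i, g i) \<in> H) \<Longrightarrow> (sum f I, sum g I) \<in> H"
  by (induction I rule: infinite_finite_induct) (auto simp: ring_graphD)

lemma ring_graph_single_valued:
  assumes "ring_graph H" "(a, b) \<in> H" "(a, c) \<in> H"
  shows "b = c"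
proof -
  have "(a + - a, b + - c) \<in> H" using assms by (intro ring_graphD) auto
  then have "b + - c = 0" using ring_graphD(6)[OF assms(1)] by fastforce
  then show ?thesis by simp
qed

lemma subring_Domain: "ring_graph H \<Longrightarrow> subring_set (Domain H)"
  unfolding ring_graph_def subring_set_def by (auto simp: Domain.simps) metis+

lemma subring_Range: "ring_graph H \<Longrightarrow> subring_set (Range H)"
  using subring_Domain[OF ring_graph_converse] by simp

section \<open>Polynomials with corresponding coefficients\<close>

definition poly_rel :: "('a::field \<times> 'a) set \<Rightarrow> 'a poly \<Rightarrow> 'a poly \<Rightarrow> bool" where
  "poly_rel H p q \<longleftrightarrow> (\<forall>i. (coeff p i, coeff q i) \<in> H)"

lemma poly_rel_ops:
  assumes "ring_graph H" "poly_rel H p q" "poly_rel H r s"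
  shows "poly_rel H (p + r) (q + s)" "poly_rel H (p * r) (q * s)" "poly_rel H (- p) (- q)"
    "poly_rel H (p - r) (q - s)"
proof -
  note D = ring_graphD[OF assms(1)]
  show "poly_rel H (p + r) (q + s)" "poly_rel H (- p) (- q)" "poly_rel H (p * r) (q * s)"
    using assms D by (auto simp: poly_rel_def coeff_mult intro!: ring_graph_sum)
  have "(a - c, b - d) \<in> H" if "(a, b) \<in> H" "(c, d) \<in> H" for a b c d
    using D(3)[OF that(1) D(5)[OF that(2)]] by simp
  then show "poly_rel H (p - r) (q - s)" using assms by (auto simp: poly_rel_def)
qed

lemma poly_rel_monom: "ring_graph H \<Longrightarrow> (a, b) \<in> H \<Longrightarrow> poly_rel H (monom a n) (monom b n)"
  by (auto simp: poly_rel_def ring_graphD)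

lemma poly_rel_const: "ring_graph H \<Longrightarrow> (a, b) \<in> H \<Longrightarrow> poly_rel H [:a:] [:b:]"
  using poly_rel_monom[of H a b 0] by (simp add: monom_0)

lemma poly_rel_0: "ring_graph H \<Longrightarrow> poly_rel H 0 0"
  by (auto simp: poly_rel_def ring_graphD)

lemma poly_rel_eq_0: "ring_graph H \<Longrightarrow> poly_rel H p q \<Longrightarrow> p = 0 \<longleftrightarrow> q = 0"
  unfolding poly_rel_def poly_eq_iff using ring_graphD(6) by (metis coeff_0)

lemma poly_rel_degree: "ring_graph H \<Longrightarrow> poly_rel H p q \<Longrightarrow> degree p = degree q"
  unfolding poly_rel_def by (intro order.antisym degree_le allI impI) (metis coeff_eq_0 ring_graphD(6))+

lemma poly_rel_mono: "poly_rel H p q \<Longrightarrow> H \<subseteq> K \<Longrightarrow> poly_rel K p q"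
  by (auto simp: poly_rel_def)

lemma poly_rel_exists:
  assumes "ring_graph H" "poly_over (Domain H) p"
  shows "\<exists>q. poly_rel H p q"
proof -
  have "\<forall>i. \<exists>b. (coeff p i, b) \<in> H" using assms by (auto simp: poly_over_def)
  then obtain b where b: "\<And>i. (coeff p i, b i) \<in> H" by metis
  have "coeff (\<Sum>i\<le>degree p. monom (b i) i) j = b j" for j
  proof (cases "j \<le> degree p")
    case True then show ?thesis by (simp add: coeff_sum)
  next
    case False
    then have "b j = 0" using b[of j] ring_graphD(6)[OF assms(1)] by (metis coeff_eq_0 not_le)
    then show ?thesis using False by (simp add: coeff_sum)
  qed
  then show ?thesis using b by (intro exI[of _ "\<Sum>i\<le>degree p. monom (b i) i"]) (simp add: poly_rel_def)
qed

definition graph_adjoin :: "('a::field \<times> 'a) set \<Rightarrow> 'a \<Rightarrow> 'a \<Rightarrow> ('a \<times> 'a) set" where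
  "graph_adjoin H x y = {(poly p x, poly q y) | p q. poly_rel H p q}"

lemma graph_adjoinI: "poly_rel H p q \<Longrightarrow> a = poly p x \<Longrightarrow> b = poly q y \<Longrightarrow> (a, b) \<in> graph_adjoin H x y"
  by (auto simp: graph_adjoin_def)

text \<open>The second hypothesis says that evaluation at \<open>x\<close> and at \<open>y\<close>
  have corresponding kernels; this makes the extended graph both single valued and
  injective.\<close>

lemma graph_adjoin:
  assumes H: "ring_graph H" and xy: "\<And>p q. poly_rel H p q \<Longrightarrow> poly p x = 0 \<longleftrightarrow> poly q y = 0"
  shows "ring_graph (graph_adjoin H x y)" "H \<subseteq> graph_adjoin H x y" "(x, y) \<in> graph_adjoin H x y"
proof -
  note D = ring_graphD[OF H]
  show "H \<subseteq> graph_adjoin H x y"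
    using poly_rel_const[OF H] by (auto intro!: graph_adjoinI)
  show "(x, y) \<in> graph_adjoin H x y"
    using poly_rel_monom[OF H D(2), of 1] by (auto intro!: graph_adjoinI simp: poly_monom)
  have "(0, 0) \<in> graph_adjoin H x y" "(1, 1) \<in> graph_adjoin H x y"
    using \<open>H \<subseteq> graph_adjoin H x y\<close> D by auto
  moreover have "(a + c, b + d) \<in> graph_adjoin H x y \<and> (a * c, b * d) \<in> graph_adjoin H x y"
    if ab: "(a, b) \<in> graph_adjoin H x y" "(c, d) \<in> graph_adjoin H x y" for a b c d
  proof -
    obtain p q r s where "poly_rel H p q" "a = poly p x" "b = poly q y" "poly_rel H r s" "c = poly r x" "d = poly s y"
      using ab by (auto simp: graph_adjoin_def)
    then show ?thesis
      using graph_adjoinI[OF poly_rel_ops(1)[OF H], of p q r s] graph_adjoinI[OF poly_rel_ops(2)[OF H], of p q r s]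
      by simp
  qed
  moreover have "(- a, - b) \<in> graph_adjoin H x y \<and> (a = 0 \<longleftrightarrow> b = 0)" if ab: "(a, b) \<in> graph_adjoin H x y" for a b
  proof -
    obtain p q where "poly_rel H p q" "a = poly p x" "b = poly q y"
      using ab by (auto simp: graph_adjoin_def)
    then show ?thesis using graph_adjoinI[OF poly_rel_ops(3)[OF H, of p q p q]] xy by simp
  qed
  ultimately show "ring_graph (graph_adjoin H x y)" unfolding ring_graph_def by blast
qed

lemma graph_adjoin_Domain:
  assumes "subring_set R" "Domain H \<subseteq> R" "x \<in> R"
  shows "Domain (graph_adjoin H x y) \<subseteq> R"
proof -
  have "poly p x \<in> R" if "poly_rel H p q" for p q
    unfolding poly_altdef using that assms
    by (intro subring_set_sum subring_setD(4) subring_set_power) (auto simp: poly_rel_def)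
  then show ?thesis by (auto simp: graph_adjoin_def)
qed

lemma graph_adjoin_Range:
  assumes "subring_set R" "Range H \<subseteq> R" "y \<in> R"
  shows "Range (graph_adjoin H x y) \<subseteq> R"
proof -
  have "poly q y \<in> R" if "poly_rel H p q" for p q
    unfolding poly_altdef using that assms
    by (intro subring_set_sum subring_setD(4) subring_set_power) (auto simp: poly_rel_def)
  then show ?thesis by (auto simp: graph_adjoin_def)
qed

text \<open>Division with remainder divides by leading coefficients, so the correspondence is
  extended to fractions before minimal polynomials are considered.\<close>

definition graph_frac :: "('a::field \<times> 'a) set \<Rightarrow> ('a \<times> 'a) set" where
  "graph_frac H = {(a / b, c / d) | a b c d. (a, c) \<in> H \<and> (b, d) \<in> H \<and> b \<noteq> 0}"

lemma graph_fracI: "(a, c) \<in> H \<Longrightarrow> (b, d) \<in> H \<Longrightarrow> b \<noteq> 0 \<Longrightarrow> u = a / b \<Longrightarrow> v = c / d \<Longrightarrow> (u, v) \<in> graph_frac H"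
  by (auto simp: graph_frac_def)

lemma graph_frac:
  assumes H: "ring_graph H"
  shows "ring_graph (graph_frac H)" "H \<subseteq> graph_frac H"
    "(a, b) \<in> graph_frac H \<Longrightarrow> (c, d) \<in> graph_frac H \<Longrightarrow> (a / c, b / d) \<in> graph_frac H"
proof -
  note D = ring_graphD[OF H]
  show sub: "H \<subseteq> graph_frac H" using D by (auto intro: graph_fracI[of _ _ _ 1 1])
  have nz: "(x, y) \<in> H \<Longrightarrow> x \<noteq> 0 \<Longrightarrow> y \<noteq> 0" for x y using D(6) by blast
  have *: "(a + c, b + d) \<in> graph_frac H \<and> (a * c, b * d) \<in> graph_frac H \<and> (a / c, b / d) \<in> graph_frac H"
    if ab: "(a, b) \<in> graph_frac H" "(c, d) \<in> graph_frac H" for a b c d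
  proof -
    obtain a1 a2 b1 b2 c1 c2 d1 d2 where e: "a = a1 / a2" "b = b1 / b2" "c = c1 / c2" "d = d1 / d2"
      and i: "(a1, b1) \<in> H" "(a2, b2) \<in> H" "a2 \<noteq> 0" "(c1, d1) \<in> H" "(c2, d2) \<in> H" "c2 \<noteq> 0"
      using ab unfolding graph_frac_def by blast
    have n: "b2 \<noteq> 0" "d2 \<noteq> 0" using i nz by auto
    have "(a + c, b + d) \<in> graph_frac H"
      by (rule graph_fracI[OF D(3)[OF D(4)[OF i(1,5)] D(4)[OF i(4,2)]] D(4)[OF i(2,5)]])
        (use i n in \<open>simp_all add: e add_frac_eq\<close>)
    moreover have "(a * c, b * d) \<in> graph_frac H"
      by (rule graph_fracI[OF D(4)[OF i(1,4)] D(4)[OF i(2,5)]]) (use i in \<open>simp_all add: e\<close>)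
    moreover have "(a / c, b / d) \<in> graph_frac H"
    proof (cases "c1 = 0")
      \<comment> \<open>Here \<open>c\<close> and \<open>d\<close> both vanish, and by the
        convention for division by zero both quotients are \<open>0\<close>.\<close>
      case True
      then have "d1 = 0" using i D(6) by blast
      then show ?thesis using True sub D(1) e by auto
    next
      case False
      show ?thesis
        by (rule graph_fracI[OF D(4)[OF i(1,5)] D(4)[OF i(2,4)]]) (use False i in \<open>auto simp: e\<close>)
    qed
    ultimately show ?thesis by blast
  qed
  then show "(a, b) \<in> graph_frac H \<Longrightarrow> (c, d) \<in> graph_frac H \<Longrightarrow> (a / c, b / d) \<in> graph_frac H" by blast
  have "(- a, - b) \<in> graph_frac H \<and> (a = 0 \<longleftrightarrow> b = 0)" if ab: "(a, b) \<in> graph_frac H" for a b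
  proof -
    obtain a1 a2 b1 b2 where e: "a = a1 / a2" "b = b1 / b2" and i: "(a1, b1) \<in> H" "(a2, b2) \<in> H" "a2 \<noteq> 0"
      using ab unfolding graph_frac_def by blast
    have "b2 \<noteq> 0" using i nz by auto
    moreover have "(- a, - b) \<in> graph_frac H"
      by (rule graph_fracI[OF D(5)[OF i(1)] i(2,3)]) (simp_all add: e)
    ultimately show ?thesis using i D(6)[OF i(1)] by (simp add: e)
  qed
  then show "ring_graph (graph_frac H)" unfolding ring_graph_def using * sub D(1,2) by blast
qed

lemma graph_frac_Domain: "ring_graph H \<Longrightarrow> Domain (graph_frac H) \<subseteq> alg_over (Domain H)"
proof
  fix x assume H: "ring_graph H" and x: "x \<in> Domain (graph_frac H)"
  note S = subring_Domain[OF H]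
  obtain a b where "x = a / b" "a \<in> Domain H" "b \<in> Domain H" using x by (auto simp: graph_frac_def)
  then show "x \<in> alg_over (Domain H)"
    using subset_alg_over[OF S] alg_over_inverse[OF S, of b] subring_setD(4)[OF subring_alg_over[OF S], of a "inverse b"]
    by (auto simp: divide_inverse)
qed

lemma graph_frac_converse: "ring_graph H \<Longrightarrow> (graph_frac H)\<inverse> = graph_frac (H\<inverse>)"
  unfolding graph_frac_def set_eq_iff using ring_graphD(6)[of H] by (simp add: converse_unfold) metis

lemma graph_frac_Range: "ring_graph H \<Longrightarrow> Range (graph_frac H) \<subseteq> alg_over (Range H)"
  using graph_frac_Domain[OF ring_graph_converse] graph_frac_converse by (metis Domain_converse)

text \<open>Division with remainder on both sides of the correspondence at once: each step uses
  corresponding leading coefficients, so quotients and remainders correspond again.\<close>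

lemma poly_rel_division:
  assumes K: "ring_graph K" and div: "\<And>a b c d. (a, b) \<in> K \<Longrightarrow> (c, d) \<in> K \<Longrightarrow> (a / c, b / d) \<in> K"
    and pq: "poly_rel K p q" "p \<noteq> 0"
  shows "poly_rel K p' q' \<Longrightarrow> \<exists>s s' r r'. poly_rel K s s' \<and> poly_rel K r r' \<and> p' = p * s + r \<and> q' = q * s' + r' \<and>
    (r = 0 \<or> degree r < degree p)"
proof (induction "if p' = 0 then 0 else Suc (degree p')" arbitrary: p' q' rule: less_induct)
  case less
  show ?case
  proof (cases "p' = 0 \<or> degree p' < degree p")
    case True
    then show ?thesis using less.prems poly_rel_0[OF K]
      by (intro exI[of _ 0] exI[of _ p'] exI[of _ q']) auto
  next
    case False
    have dq: "degree q = degree p" "degree q' = degree p'" using poly_rel_degree[OF K] pq less.prems by metis+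
    define c where "c = coeff p' (degree p') / coeff p (degree p)"
    define c' where "c' = coeff q' (degree q') / coeff q (degree q)"
    define k where "k = degree p' - degree p"
    have "(c, c') \<in> K" unfolding c_def c'_def dq using pq less.prems by (intro div) (auto simp: poly_rel_def)
    then have m: "poly_rel K (monom c k) (monom c' k)" by (rule poly_rel_monom[OF K])
    define p2 where "p2 = p' - p * monom c k"
    define q2 where "q2 = q' - q * monom c' k"
    have 2: "poly_rel K p2 q2" unfolding p2_def q2_def by (intro poly_rel_ops(2,4)[OF K] pq less.prems m)
    have lc: "coeff p (degree p) \<noteq> 0" using pq by simp
    have "coeff p2 i = 0" if "i \<ge> degree p'" for i
    proof -
      have ki: "k \<le> i" using that by (simp add: k_def)
      show ?thesis
      proof (cases "i = degree p'")
        case True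
        then have "i - k = degree p" using False by (simp add: k_def)
        then show ?thesis using True lc ki by (simp add: p2_def mult.commute[of p] coeff_monom_mult c_def)
      next
        case F: False
        then have "i - k > degree p" "i > degree p'" using False that by (auto simp: k_def)
        then show ?thesis using ki by (simp add: p2_def mult.commute[of p] coeff_monom_mult coeff_eq_0)
      qed
    qed
    then have "p2 = 0 \<or> degree p2 < degree p'" by (metis leading_coeff_0_iff not_le)
    \<comment> \<open>The measure puts the zero polynomial strictly below the nonzero constants,
      which \<open>degree\<close> alone does not.\<close>
    then have lt: "(if p2 = 0 then 0 else Suc (degree p2)) < (if p' = 0 then 0 else Suc (degree p'))"
      using False by auto
    obtain s s' r r' where *: "poly_rel K s s'" "poly_rel K r r'" "p2 = p * s + r" "q2 = q * s' + r'"
       "r = 0 \<or> degree r < degree p"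
      using less.hyps[OF lt 2] by blast
    have "p' = p * (s + monom c k) + r" "q' = q * (s' + monom c' k) + r'"
      using *(3,4) by (simp_all add: p2_def q2_def algebra_simps)
    then show ?thesis using *(2,5) poly_rel_ops(1)[OF K *(1) m] by blast
  qed
qed

lemma least_degree_pair:
  assumes "P p q"
  obtains p0 q0 where "P p0 q0" "\<And>p' q'. P p' q' \<Longrightarrow> degree p0 \<le> degree p'"
proof -
  obtain z where "P (fst z) (snd z)" "\<forall>y. P (fst y) (snd y) \<longrightarrow> degree (fst z) \<le> degree (fst y)"
    using ex_has_least_nat[of "\<lambda>z. P (fst z) (snd z)" "(p, q)" "\<lambda>z. degree (fst z)"] assms by auto
  then show ?thesis using that[of "fst z" "snd z"] by (metis fst_conv snd_conv)
qed

text \<open>Let \<open>p\<close> have least degree among polynomials over the fraction field that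
  vanish at \<open>x\<close>, and let \<open>y\<close> be a root of the corresponding
  \<open>q\<close>. Once \<open>q\<close> is known to have least degree for \<open>y\<close>,
  vanishing at \<open>x\<close> and vanishing at \<open>y\<close> both mean that the remainder is
  zero, a property preserved by the correspondence.\<close>

lemma graph_extend_algebraic:
  fixes H :: "('a::alg_closed_field \<times> 'a) set"
  assumes H: "ring_graph H" and x: "x \<in> alg_over (Domain H)"
  shows "\<exists>H'. ring_graph H' \<and> H \<subseteq> H' \<and> x \<in> Domain H' \<and> Domain H' \<subseteq> alg_over (Domain H)
    \<and> Range H' \<subseteq> alg_over (Range H)"
proof -
  define K where "K = graph_frac H"
  have K: "ring_graph K" and HK: "H \<subseteq> K" and div: "\<And>a b c d. (a, b) \<in> K \<Longrightarrow> (c, d) \<in> K \<Longrightarrow> (a / c, b / d) \<in> K"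
    unfolding K_def using graph_frac[OF H] by auto
  have "\<exists>p q. poly_rel K p q \<and> p \<noteq> 0 \<and> poly p x = 0"
  proof -
    obtain p where p: "p \<noteq> 0" "poly_over (Domain H) p" "poly p x = 0" using x by (auto simp: alg_over_def)
    then obtain q where "poly_rel H p q" using poly_rel_exists[OF H] by blast
    then show ?thesis using p poly_rel_mono[OF _ HK] by blast
  qed
  then obtain p q where pq: "poly_rel K p q" "p \<noteq> 0" "poly p x = 0"
    and min: "\<And>p' q'. poly_rel K p' q' \<Longrightarrow> p' \<noteq> 0 \<Longrightarrow> poly p' x = 0 \<Longrightarrow> degree p \<le> degree p'"
    by (metis (mono_tags, lifting) least_degree_pair[of "\<lambda>p q. poly_rel K p q \<and> p \<noteq> 0 \<and> poly p x = 0"])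
  have q0: "q \<noteq> 0" using poly_rel_eq_0[OF K pq(1)] pq by simp
  have dq: "degree q = degree p" using poly_rel_degree[OF K pq(1)] by simp
  have "degree p > 0" using pq by (auto elim!: degree_eq_zeroE intro!: Nat.gr0I)
  then obtain y where y: "poly q y = 0" using alg_closed_imp_poly_has_root[of q] dq by auto
  obtain p2 q2 where pq2: "poly_rel K p2 q2" "p2 \<noteq> 0" "poly q2 y = 0"
    and min2: "\<And>p' q'. poly_rel K p' q' \<Longrightarrow> p' \<noteq> 0 \<Longrightarrow> poly q' y = 0 \<Longrightarrow> degree p2 \<le> degree p'"
    using pq y by (metis (mono_tags, lifting) least_degree_pair[of "\<lambda>p q. poly_rel K p q \<and> p \<noteq> 0 \<and> poly q y = 0"])
  have q20: "q2 \<noteq> 0" "degree q2 = degree p2" using poly_rel_eq_0[OF K pq2(1)] poly_rel_degree[OF K pq2(1)] pq2 by simp_all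
  \<comment> \<open>Irreducibility in disguise: \<open>p2\<close> divides \<open>p\<close>, so
    \<open>x\<close> is a root of \<open>p2\<close> or of the cofactor \<open>s\<close>, and in the
    second case \<open>s\<close> would have too small a degree.\<close>
  have "degree p \<le> degree p2"
  proof -
    obtain s s' r r' where *: "poly_rel K s s'" "poly_rel K r r'" "p = p2 * s + r" "q = q2 * s' + r'"
       "r = 0 \<or> degree r < degree p2"
      using poly_rel_division[OF K div pq2(1,2) pq(1)] by blast
    have "poly r' y = 0" using y *(4) pq2(3) by simp
    then have r: "r = 0" using min2[OF *(2)] *(5) by fastforce
    then have ps: "p = p2 * s" using * by simp
    have "degree q2 > 0" using q20 pq2(3) by (auto elim!: degree_eq_zeroE intro!: Nat.gr0I)
    then have d2: "degree p2 > 0" using q20 by simp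
    have s0: "s \<noteq> 0" using ps pq by auto
    have "poly p2 x = 0 \<or> poly s x = 0" using ps pq by simp
    then show ?thesis
    proof
      assume "poly p2 x = 0" then show ?thesis using min pq2 by blast
    next
      assume "poly s x = 0"
      then have "degree p \<le> degree s" using min *(1) s0 by blast
      then show ?thesis using ps s0 pq2(2) d2 by (simp add: degree_mult_eq)
    qed
  qed
  have xy: "poly p' x = 0 \<longleftrightarrow> poly q' y = 0" if pq': "poly_rel K p' q'" for p' q'
  proof -
    obtain s s' r r' where *: "poly_rel K s s'" "poly_rel K r r'" "p' = p * s + r" "q' = q * s' + r'"
       "r = 0 \<or> degree r < degree p"
      using poly_rel_division[OF K div pq(1,2) pq'] by blast
    have "poly p' x = 0 \<longleftrightarrow> poly r x = 0" "poly q' y = 0 \<longleftrightarrow> poly r' y = 0" using * pq y by simp_all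
    moreover have "poly r x = 0 \<longleftrightarrow> r = 0" using min[OF *(2)] *(5) by fastforce
    moreover have "poly r' y = 0 \<longleftrightarrow> r' = 0"
      using min2[OF *(2)] *(5) poly_rel_eq_0[OF K *(2)] \<open>degree p \<le> degree p2\<close> by fastforce
    ultimately show ?thesis using poly_rel_eq_0[OF K *(2)] by simp
  qed
  let ?H = "graph_adjoin K x y"
  have KD: "Domain K \<subseteq> alg_over (Domain H)" unfolding K_def by (rule graph_frac_Domain[OF H])
  have KR: "Range K \<subseteq> alg_over (Range H)" unfolding K_def by (rule graph_frac_Range[OF H])
  have "poly_over (Range K) q" using pq by (auto simp: poly_rel_def poly_over_def)
  then have "y \<in> alg_over (Range K)" using y q0 by (auto simp: alg_over_def)
  then have "y \<in> alg_over (Range H)"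
    using alg_over_mono[OF KR] alg_over_idem[OF subring_Range[OF H]] by auto
  then have "Range ?H \<subseteq> alg_over (Range H)"
    using KR by (intro graph_adjoin_Range subring_alg_over subring_Range H)
  moreover have "Domain ?H \<subseteq> alg_over (Domain H)"
    using KD x by (intro graph_adjoin_Domain subring_alg_over subring_Domain H)
  ultimately show ?thesis using graph_adjoin[OF K xy] HK by (intro exI[of _ ?H]) auto
qed

lemma ring_graph_Union:
  assumes C: "subset.chain {H. ring_graph H} C" and "C \<noteq> {}"
  shows "ring_graph (\<Union>C)"
proof -
  have r: "ring_graph H" if "H \<in> C" for H using C that by (auto simp: subset.chain_def)
  obtain H0 where "H0 \<in> C" using assms by auto
  then have "(0,0) \<in> \<Union>C" "(1,1) \<in> \<Union>C" using r ring_graphD(1,2) by blast+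
  moreover have "(a + c, b + d) \<in> \<Union>C \<and> (a * c, b * d) \<in> \<Union>C" if ab: "(a, b) \<in> \<Union>C" "(c, d) \<in> \<Union>C" for a b c d
  proof -
    obtain H1 H2 where H: "H1 \<in> C" "H2 \<in> C" "(a, b) \<in> H1" "(c, d) \<in> H2" using ab by auto
    then have "H1 \<subseteq> H2 \<or> H2 \<subseteq> H1" using C by (auto simp: subset.chain_def)
    then obtain H3 where "H3 \<in> C" "(a, b) \<in> H3" "(c, d) \<in> H3" using H by blast
    then show ?thesis using r ring_graphD(3,4) by blast
  qed
  moreover have "(- a, - b) \<in> \<Union>C \<and> (a = 0 \<longleftrightarrow> b = 0)" if "(a, b) \<in> \<Union>C" for a b
    using that r ring_graphD(5,6) by blast
  ultimately show ?thesis unfolding ring_graph_def by blast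
qed

definition field_aut :: "('a::field \<Rightarrow> 'a) \<Rightarrow> bool" where
  "field_aut f \<longleftrightarrow> bij f \<and> f 1 = 1 \<and> (\<forall>x y. f (x + y) = f x + f y \<and> f (x * y) = f x * f y)"

text \<open>A maximal graph is sought among those whose domain is algebraic over the basis elements
  that already have their prescribed images. This bound keeps every other basis element
  transcendental over the domain, and its prescribed image transcendental over the range, so that
  the pair can still be adjoined.\<close>

theorem field_aut_extending:
  fixes \<sigma> :: "'a::alg_closed_field \<Rightarrow> 'a"
  assumes B: "alg_indep B" "alg_cl B = UNIV"
    and s: "inj_on \<sigma> B" "alg_indep (\<sigma> ` B)" "alg_cl (\<sigma> ` B) = UNIV"
  shows "\<exists>f. field_aut f \<and> (\<forall>b\<in>B. f b = \<sigma> b)"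
proof -
  define B0 where "B0 H = {b\<in>B. (b, \<sigma> b) \<in> H}" for H
  define \<H> where "\<H> = {H. ring_graph H \<and> Domain H \<subseteq> alg_cl (B0 H) \<and> Range H \<subseteq> alg_cl (\<sigma> ` B0 H)}"
  have B0_mono: "B0 H \<subseteq> B0 H'" if "H \<subseteq> H'" for H H' using that by (auto simp: B0_def)
  \<comment> \<open>The starting graph is the identity on the image of the integers.\<close>
  let ?Z = "range (\<lambda>n::int. (of_int n, of_int n)) :: ('a \<times> 'a) set"
  have Z: "?Z \<in> \<H>"
  proof -
    have "(0, 0) \<in> ?Z" "(1, 1) \<in> ?Z" by (auto intro: image_eqI[of _ _ 0] image_eqI[of _ _ 1])
    moreover have "(a + c, b + d) \<in> ?Z \<and> (a * c, b * d) \<in> ?Z" if "(a, b) \<in> ?Z" "(c, d) \<in> ?Z" for a b c d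
      using that by (auto simp flip: of_int_add of_int_mult)
    moreover have "(- a, - b) \<in> ?Z \<and> (a = 0 \<longleftrightarrow> b = 0)" if "(a, b) \<in> ?Z" for a b
      using that by (auto simp flip: of_int_minus)
    ultimately have "ring_graph ?Z" unfolding ring_graph_def by blast
    then show ?thesis unfolding \<H>_def using subring_set_of_int[OF alg_cl_subring] by auto
  qed
  have "\<exists>M\<in>\<H>. \<forall>X\<in>\<H>. M \<subseteq> X \<longrightarrow> X = M"
  proof (rule subset_Zorn_nonempty)
    show "\<H> \<noteq> {}" using Z by auto
    fix C assume C: "C \<noteq> {}" "subset.chain \<H> C"
    then have "subset.chain {H. ring_graph H} C" by (auto simp: subset.chain_def \<H>_def)
    then have "ring_graph (\<Union>C)" using ring_graph_Union C by blast
    moreover have "Domain (\<Union>C) \<subseteq> alg_cl (B0 (\<Union>C))" "Range (\<Union>C) \<subseteq> alg_cl (\<sigma> ` B0 (\<Union>C))"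
    proof -
      have "Domain H \<subseteq> alg_cl (B0 (\<Union>C)) \<and> Range H \<subseteq> alg_cl (\<sigma> ` B0 (\<Union>C))" if "H \<in> C" for H
      proof -
        have "H \<in> \<H>" using that C by (auto simp: subset.chain_def)
        moreover have "B0 H \<subseteq> B0 (\<Union>C)" using that by (intro B0_mono) auto
        ultimately show ?thesis unfolding \<H>_def
          using alg_cl_mono[of "B0 H" "B0 (\<Union>C)"] alg_cl_mono[OF image_mono, of "B0 H" "B0 (\<Union>C)" \<sigma>] by blast
      qed
      then show "Domain (\<Union>C) \<subseteq> alg_cl (B0 (\<Union>C))" "Range (\<Union>C) \<subseteq> alg_cl (\<sigma> ` B0 (\<Union>C))" by blast+
    qed
    ultimately show "\<Union>C \<in> \<H>" by (simp add: \<H>_def)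
  qed
  then obtain H where H: "H \<in> \<H>" and max: "\<And>X. X \<in> \<H> \<Longrightarrow> H \<subseteq> X \<Longrightarrow> X = H" by auto
  have rg: "ring_graph H" and DH: "Domain H \<subseteq> alg_cl (B0 H)" and RH: "Range H \<subseteq> alg_cl (\<sigma> ` B0 H)"
    using H by (auto simp: \<H>_def)
  have alg_max: "H' = H" if "ring_graph H'" "H \<subseteq> H'" "Domain H' \<subseteq> alg_over (Domain H)" "Range H' \<subseteq> alg_over (Range H)" for H'
  proof (rule max[OF _ that(2)])
    have "alg_over (Domain H) \<subseteq> alg_cl (B0 H)" "alg_over (Range H) \<subseteq> alg_cl (\<sigma> ` B0 H)"
      using alg_over_mono[OF DH] alg_over_mono[OF RH] by (simp_all add: alg_over_alg_cl)
    moreover have "alg_cl (B0 H) \<subseteq> alg_cl (B0 H')" "alg_cl (\<sigma> ` B0 H) \<subseteq> alg_cl (\<sigma> ` B0 H')"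
      using B0_mono[OF that(2)] by (simp_all add: alg_cl_mono image_mono)
    ultimately show "H' \<in> \<H>" unfolding \<H>_def using that by blast
  qed
  have dom_closed: "alg_over (Domain H) \<subseteq> Domain H"
    using graph_extend_algebraic[OF rg] alg_max by blast
  \<comment> \<open>Extending the converse graph closes the range as well, from which surjectivity
    follows.\<close>
  have ran_closed: "alg_over (Range H) \<subseteq> Range H"
  proof
    fix y assume y: "y \<in> alg_over (Range H)"
    then obtain G where G: "ring_graph G" "H\<inverse> \<subseteq> G" "y \<in> Domain G" "Domain G \<subseteq> alg_over (Range H)" "Range G \<subseteq> alg_over (Domain H)"
      using graph_extend_algebraic[OF ring_graph_converse[OF rg], of y] by auto
    then have "G\<inverse> = H" using ring_graph_converse[OF G(1)] by (intro alg_max) auto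
    then show "y \<in> Range H" using G(3) by auto
  qed
  have BH: "(b, \<sigma> b) \<in> H" if b: "b \<in> B" for b
  proof (rule ccontr)
    assume n: "(b, \<sigma> b) \<notin> H"
    have "B0 H \<subseteq> B - {b}" using n by (auto simp: B0_def)
    then have b1: "b \<notin> alg_cl (B0 H)" using B(1) b alg_cl_mono[of "B0 H" "B - {b}"] by (auto simp: alg_indep_def)
    have "\<sigma> ` B0 H \<subseteq> \<sigma> ` B - {\<sigma> b}" using n b s(1) by (auto simp: B0_def inj_on_def)
    then have b2: "\<sigma> b \<notin> alg_cl (\<sigma> ` B0 H)"
      using s(2) b alg_cl_mono[of "\<sigma> ` B0 H" "\<sigma> ` B - {\<sigma> b}"] unfolding alg_indep_def by auto
    \<comment> \<open>Both \<open>b\<close> and its image are transcendental over their sides, so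
      the two polynomials vanish there only if they are zero.\<close>
    have xy: "poly p b = 0 \<longleftrightarrow> poly q (\<sigma> b) = 0" if pq: "poly_rel H p q" for p q
    proof -
      have "poly_over (alg_cl (B0 H)) p" "poly_over (alg_cl (\<sigma> ` B0 H)) q"
        using pq DH RH by (auto simp: poly_rel_def poly_over_def)
      then have "poly p b = 0 \<longleftrightarrow> p = 0" "poly q (\<sigma> b) = 0 \<longleftrightarrow> q = 0"
        using b1 b2 alg_over_alg_cl[of "B0 H"] alg_over_alg_cl[of "\<sigma> ` B0 H"] by (auto simp: alg_over_def)
      then show ?thesis using poly_rel_eq_0[OF rg pq] by simp
    qed
    let ?H = "graph_adjoin H b (\<sigma> b)"
    note ad = graph_adjoin[OF rg xy]
    have in0: "b \<in> B0 ?H" using ad b by (auto simp: B0_def)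
    have "Domain ?H \<subseteq> alg_cl (B0 ?H)"
      using DH alg_cl_mono[OF B0_mono[OF ad(2)]] in0 alg_cl_extensive[of "B0 ?H"]
      by (intro graph_adjoin_Domain alg_cl_subring) auto
    moreover have "Range ?H \<subseteq> alg_cl (\<sigma> ` B0 ?H)"
      using RH alg_cl_mono[OF image_mono[OF B0_mono[OF ad(2)]]] in0 alg_cl_extensive[of "\<sigma> ` B0 ?H"]
      by (intro graph_adjoin_Range alg_cl_subring) auto
    ultimately have "?H \<in> \<H>" using ad by (simp add: \<H>_def)
    then show False using max ad n by blast
  qed
  have "B \<subseteq> Domain H" "\<sigma> ` B \<subseteq> Range H" using BH by auto
  then have D: "Domain H = UNIV" and R: "Range H = UNIV"
    using B(2) s(3) alg_over_mono[OF ring_gen_least[OF subring_Domain[OF rg]], of B]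
      alg_over_mono[OF ring_gen_least[OF subring_Range[OF rg]], of "\<sigma> ` B"] dom_closed ran_closed
    unfolding alg_cl_def by auto
  have "\<forall>x. \<exists>y. (x, y) \<in> H" using D by auto
  then obtain f where f: "\<And>x. (x, f x) \<in> H" by metis
  have fI: "f x = y" if "(x, y) \<in> H" for x y using ring_graph_single_valued[OF rg f that] .
  have "inj f"
  proof (rule injI)
    fix x y assume "f x = f y"
    then have "(f x, x) \<in> H\<inverse>" "(f x, y) \<in> H\<inverse>" using f[of x] f[of y] by auto
    then show "x = y" using ring_graph_single_valued[OF ring_graph_converse[OF rg]] by blast
  qed
  moreover have "surj f" using R fI unfolding surj_def by (metis RangeE UNIV_I)
  ultimately have "bij f" by (simp add: bij_def)
  moreover have "f 1 = 1" "f (x + y) = f x + f y" "f (x * y) = f x * f y" for x y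
    by (rule fI[OF ring_graphD(2)[OF rg]], rule fI[OF ring_graphD(3)[OF rg f f]], rule fI[OF ring_graphD(4)[OF rg f f]])
  ultimately have "field_aut f" unfolding field_aut_def by blast
  moreover have "\<forall>b\<in>B. f b = \<sigma> b" using BH fI by blast
  ultimately show ?thesis by blast
qed

section \<open>A generic automorphism satisfying the conclusion of Lang's theorem\<close>

unbundle cardinal_syntax


section \<open>The cardinality of a field with an infinite basis\<close>

primrec ring_level :: "'a::field set \<Rightarrow> nat \<Rightarrow> 'a set" where
  "ring_level B 0 = B \<union> {0, 1}"
| "ring_level B (Suc k) = ring_level B k \<union> (\<lambda>(x, y). x + y) ` (ring_level B k \<times> ring_level B k)
     \<union> (\<lambda>(x, y). x * y) ` (ring_level B k \<times> ring_level B k) \<union> uminus ` ring_level B k"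

lemma ring_level_mono: "k \<le> l \<Longrightarrow> ring_level B k \<subseteq> ring_level B l"
  by (rule lift_Suc_mono_le[of "ring_level B"]) auto

lemma ring_gen_levels: "ring_gen B \<subseteq> (\<Union>k. ring_level B k)"
proof
  fix x assume "x \<in> ring_gen B"
  then show "x \<in> (\<Union>k. ring_level B k)"
  proof (induction rule: ring_gen.induct)
    case (ring_gen_add x y)
    then obtain k l where "x \<in> ring_level B k" "y \<in> ring_level B l" by auto
    then have "x \<in> ring_level B (max k l)" "y \<in> ring_level B (max k l)"
      using ring_level_mono[of k "max k l" B] ring_level_mono[of l "max k l" B] by auto
    then have "x + y \<in> ring_level B (Suc (max k l))" by force
    then show ?case by blast
  next
    case (ring_gen_mult x y)
    then obtain k l where "x \<in> ring_level B k" "y \<in> ring_level B l" by auto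
    then have "x \<in> ring_level B (max k l)" "y \<in> ring_level B (max k l)"
      using ring_level_mono[of k "max k l" B] ring_level_mono[of l "max k l" B] by auto
    then have "x * y \<in> ring_level B (Suc (max k l))" by force
    then show ?case by blast
  next
    case (ring_gen_minus x)
    then obtain k where "x \<in> ring_level B k" by auto
    then have "- x \<in> ring_level B (Suc k)" by simp
    then show ?case by blast
  qed (auto intro: exI[of _ 0])
qed

lemma card_of_image_trans: "|A| \<le>o |B| \<Longrightarrow> |f ` A| \<le>o |B|"
  using card_of_image ordLeq_transitive by blast

lemma card_of_Times_bound: "infinite B \<Longrightarrow> |A| \<le>o |B| \<Longrightarrow> |C| \<le>o |B| \<Longrightarrow> |A \<times> C| \<le>o |B|"
  by (rule card_of_Times_ordLeq_infinite_Field) (simp_all add: card_of_card_order_on Field_card_of)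

lemma card_of_Un_bound: "infinite B \<Longrightarrow> |A| \<le>o |B| \<Longrightarrow> |C| \<le>o |B| \<Longrightarrow> |A \<union> C| \<le>o |B|"
  by (rule card_of_Un_ordLeq_infinite_Field) (simp_all add: card_of_card_order_on Field_card_of)

lemma card_of_finite_bound: "infinite B \<Longrightarrow> finite A \<Longrightarrow> |A| \<le>o |B|"
  by (meson card_of_Well_order card_of_ordLeq_finite ordLeq_total)

lemma card_of_nat_bound: "infinite B \<Longrightarrow> |UNIV :: nat set| \<le>o |B|"
  using infinite_iff_card_of_nat by blast

lemma card_of_ring_gen:
  assumes "infinite B"
  shows "|ring_gen B| \<le>o |B|"
proof -
  have "|ring_level B k| \<le>o |B|" for k
  proof (induction k)
    case 0
    have "|B \<union> {0, 1}| \<le>o |B|"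
      by (intro card_of_Un_bound assms card_of_finite_bound card_of_mono1) auto
    then show ?case by simp
  next
    case (Suc k)
    then show ?case unfolding ring_level.simps
      by (intro card_of_Un_bound assms card_of_image_trans card_of_Times_bound)
  qed
  then have "|\<Union>k. ring_level B k| \<le>o |B|"
    using card_of_UNION_ordLeq_infinite[OF assms card_of_nat_bound[OF assms]] by blast
  then show ?thesis using card_of_mono1[OF ring_gen_levels] ordLeq_transitive by blast
qed

primrec poly_level :: "'a::field set \<Rightarrow> nat \<Rightarrow> 'a poly set" where
  "poly_level R 0 = {0}"
| "poly_level R (Suc d) = (\<lambda>(a, p). pCons a p) ` (R \<times> poly_level R d)"

lemma poly_over_level: "poly_over R p \<Longrightarrow> p \<in> (\<Union>d. poly_level R d)"
proof (induction p rule: pCons_induct)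
  case 0 then show ?case by (auto intro: exI[of _ 0])
next
  case (pCons a p)
  have "coeff (pCons a p) 0 \<in> R" "\<And>i. coeff (pCons a p) (Suc i) \<in> R"
    using pCons.prems unfolding poly_over_def by blast+
  then have "a \<in> R" "poly_over R p" by (auto simp: poly_over_def)
  then obtain d where "p \<in> poly_level R d" using pCons.IH by auto
  then have "pCons a p \<in> poly_level R (Suc d)" using \<open>a \<in> R\<close> by force
  then show ?case by blast
qed

text \<open>Every element is a root of a nonzero polynomial over the generated ring. There are at
  most as many such polynomials as elements of \<open>B\<close>, and each has finitely many
  roots.\<close>

lemma card_of_UNIV_le_basis:
  fixes B :: "'a::field set"
  assumes "infinite B" "alg_cl B = UNIV"
  shows "|UNIV :: 'a set| \<le>o |B|"
proof -
  have "|poly_level (ring_gen B) d| \<le>o |B|" for d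
  proof (induction d)
    case 0 show ?case using card_of_finite_bound[OF assms(1), of "{0}"] by simp
  next
    case (Suc d)
    then show ?case unfolding poly_level.simps
      by (intro card_of_image_trans card_of_Times_bound assms card_of_ring_gen)
  qed
  then have "|\<Union>d. poly_level (ring_gen B) d| \<le>o |B|"
    using card_of_UNION_ordLeq_infinite[OF assms(1) card_of_nat_bound[OF assms(1)]] by blast
  then have P: "|(\<Union>d. poly_level (ring_gen B) d) - {0}| \<le>o |B|"
    using card_of_mono1[OF Diff_subset] ordLeq_transitive by blast
  have "|\<Union>p\<in>(\<Union>d. poly_level (ring_gen B) d) - {0}. {x. poly p x = 0}| \<le>o |B|"
    using card_of_finite_bound[OF assms(1) poly_roots_finite]
    by (intro card_of_UNION_ordLeq_infinite[OF assms(1) P]) blast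
  moreover have "(UNIV :: 'a set) \<subseteq> (\<Union>p\<in>(\<Union>d. poly_level (ring_gen B) d) - {0}. {x. poly p x = 0})"
  proof
    fix x :: 'a
    have "x \<in> alg_over (ring_gen B)" using assms(2) by (auto simp: alg_cl_def)
    then obtain p where "p \<noteq> 0" "poly_over (ring_gen B) p" "poly p x = 0" by (auto simp: alg_over_def)
    then show "x \<in> (\<Union>p\<in>(\<Union>d. poly_level (ring_gen B) d) - {0}. {x. poly p x = 0})"
      using poly_over_level[of "ring_gen B" p] by blast
  qed
  ultimately show ?thesis using card_of_mono1 ordLeq_transitive by blast
qed

text \<open>The default value \<open>c\<close> outside \<open>A\<close> allows induction on
  \<open>A\<close>; taking the whole index type for \<open>A\<close> then bounds the
  matrices.\<close>

lemma card_of_finite_functions: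
  fixes c :: 'a
  assumes "infinite B" "|UNIV :: 'a set| \<le>o |B|" "finite A"
  shows "|{f :: 'i \<Rightarrow> 'a. \<forall>x. x \<notin> A \<longrightarrow> f x = c}| \<le>o |B|"
  using assms(3)
proof (induction A rule: finite_induct)
  case empty
  have "{f :: 'i \<Rightarrow> 'a. \<forall>x. x \<notin> {} \<longrightarrow> f x = c} = {\<lambda>_. c}" by auto
  then show ?case using card_of_finite_bound[OF assms(1), of "{\<lambda>_. c}"] by simp
next
  case (insert x A)
  let ?F = "\<lambda>A. {f :: 'i \<Rightarrow> 'a. \<forall>x. x \<notin> A \<longrightarrow> f x = c}"
  have "?F (insert x A) \<subseteq> (\<lambda>(f, a). f(x := a)) ` (?F A \<times> UNIV)"
  proof
    fix f assume "f \<in> ?F (insert x A)"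
    then have "f = (\<lambda>(f, a). f(x := a)) (f(x := c), f x)" "f(x := c) \<in> ?F A" by auto
    then show "f \<in> (\<lambda>(f, a). f(x := a)) ` (?F A \<times> UNIV)" by (metis (no_types, lifting) SigmaI UNIV_I imageI)
  qed
  moreover have "|(\<lambda>(f, a). f(x := a)) ` (?F A \<times> UNIV)| \<le>o |B|"
    by (intro card_of_image_trans card_of_Times_bound assms insert)
  ultimately show ?case using card_of_mono1 ordLeq_transitive by blast
qed

lemma card_of_matrices:
  assumes "infinite B" "|UNIV :: 'a set| \<le>o |B|"
  shows "|UNIV :: ('a^'n^'m) set| \<le>o |B|"
proof -
  have "|{f :: 'm \<times> 'n \<Rightarrow> 'a. \<forall>x. x \<notin> UNIV \<longrightarrow> f x = undefined}| \<le>o |B|"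
    by (rule card_of_finite_functions[OF assms]) simp
  then have "|UNIV :: ('m \<times> 'n \<Rightarrow> 'a) set| \<le>o |B|" by simp
  then have "|(\<lambda>f. \<chi> i j. f (i, j)) ` (UNIV :: ('m \<times> 'n \<Rightarrow> 'a) set)| \<le>o |B|" by (rule card_of_image_trans)
  moreover have "(\<lambda>f. \<chi> i j. f (i, j)) ` (UNIV :: ('m \<times> 'n \<Rightarrow> 'a) set) = (UNIV :: ('a^'n^'m) set)"
  proof (intro equalityI subsetI)
    fix M :: "'a^'n^'m"
    show "M \<in> (\<lambda>f. \<chi> i j. f (i, j)) ` (UNIV :: ('m \<times> 'n \<Rightarrow> 'a) set)"
      by (rule image_eqI[of _ _ "\<lambda>(i, j). M $ i $ j"]) (simp_all add: vec_eq_iff)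
  qed simp
  ultimately show ?thesis by simp
qed

section \<open>Matrix equations with entries in a subfield\<close>

lemma det_in_subring:
  assumes "subring_set K" "\<And>i j. (A::'a::field^'n^'n) $ i $ j \<in> K"
  shows "det A \<in> K"
  unfolding det_def using assms
  by (intro subring_set_sum subring_setD(4) subring_set_of_int subring_set_prod) auto

text \<open>Cramer's rule for each column. This is how a block of basis elements is recovered from
  its prescribed image.\<close>

lemma matrix_solution_in_subfield:
  fixes A z :: "'a::field^'n^'n"
  assumes K: "subring_set K" "\<And>x y. x \<in> K \<Longrightarrow> y \<in> K \<Longrightarrow> x / y \<in> K"
    and A: "det A \<noteq> 0" "\<And>i j. A $ i $ j \<in> K" and Az: "\<And>i j. (A ** z) $ i $ j \<in> K"
  shows "z $ i $ j \<in> K"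
proof -
  have "A *v column j z = column j (A ** z)"
    by (simp add: vec_eq_iff matrix_vector_mult_def matrix_matrix_mult_def column_def)
  then have "column j z = (\<chi> k. det (\<chi> i l. if l = k then column j (A ** z) $ i else A $ i $ l) / det A)"
    using cramer[OF A(1)] by blast
  then have "z $ i $ j = det (\<chi> k l. if l = i then column j (A ** z) $ k else A $ k $ l) / det A"
    by (metis (lifting) column_def vec_lambda_beta)
  also have "\<dots> \<in> K"
    using A Az by (intro K(2) det_in_subring K(1)) (auto simp: column_def)
  finally show ?thesis .
qed

text \<open>If the determinant vanished, one row would be a combination of the others, and the
  \<open>n\<^sup>2\<close> entries would be algebraic over \<open>n(n-1) + (n-1)\<close> elements.\<close>

lemma det_nonzero_of_alg_indep:
  fixes z :: "'a::field^'n^'n"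
  assumes inj: "inj (\<lambda>(i, j). z $ i $ j)" and ind: "alg_indep (range (\<lambda>(i, j). z $ i $ j))"
  shows "det z \<noteq> 0"
proof
  assume "det z = 0"
  then have "\<not> (\<exists>B. z ** B = mat 1)" using invertible_det_nz[of z] invertible_right_inverse[of z] by simp
  then obtain c where c: "(\<Sum>i\<in>UNIV. c i *s row i z) = 0" "\<exists>i. c i \<noteq> 0"
    using matrix_right_invertible_independent_rows[of z] by blast
  then obtain k where k: "c k \<noteq> 0" by blast
  define J where "J = (\<lambda>(i, j). z $ i $ j) ` ((UNIV - {k}) \<times> UNIV) \<union> (\<lambda>i. c i / c k) ` (UNIV - {k})"
  note J = alg_cl_extensive[of J]
  have "z $ i $ j \<in> alg_cl J" for i j
  proof (cases "i = k")
    case False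
    then have "z $ i $ j \<in> J" by (auto simp: J_def)
    then show ?thesis using J by blast
  next
    case True
    have "(\<Sum>i\<in>UNIV. c i * z $ i $ j) = (\<Sum>i\<in>UNIV. c i *s row i z) $ j" by (simp add: row_def)
    then have "0 = (\<Sum>i\<in>UNIV. c i * z $ i $ j)" using c by simp
    also have "\<dots> = c k * z $ k $ j + (\<Sum>i\<in>UNIV-{k}. c i * z $ i $ j)" by (simp add: sum.remove)
    finally have "z $ k $ j = - (\<Sum>i\<in>UNIV-{k}. c i / c k * z $ i $ j)"
      using k by (simp add: field_simps sum_divide_distrib[symmetric] eq_neg_iff_add_eq_0)
    also have "\<dots> \<in> alg_cl J"
      using J by (intro subring_setD(5)[OF alg_cl_subring] subring_set_sum[OF alg_cl_subring] subring_setD(4)[OF alg_cl_subring])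
        (auto simp: J_def)
    finally show ?thesis using True by simp
  qed
  then have "range (\<lambda>(i, j). z $ i $ j) \<subseteq> alg_cl J" by auto
  then have "card (range (\<lambda>(i, j). z $ i $ j)) \<le> card J"
    using ind by (intro alg_indep_card_le) (auto simp: J_def)
  moreover have "card (range (\<lambda>(i, j). z $ i $ j)) = CARD('n) * CARD('n)"
    using card_image[OF inj] by simp
  moreover have "card J \<le> (CARD('n) - 1) * CARD('n) + (CARD('n) - 1)"
  proof -
    have "card ((\<lambda>(i, j). z $ i $ j) ` ((UNIV - {k}) \<times> UNIV)) \<le> (CARD('n) - 1) * CARD('n)"
      using card_image_le[of "(UNIV - {k}) \<times> (UNIV::'n set)" "\<lambda>(i, j). z $ i $ j"] by (simp add: card_cartesian_product)
    moreover have "card ((\<lambda>i. c i / c k) ` (UNIV - {k})) \<le> CARD('n) - 1"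
      using card_image_le[of "UNIV - {k}" "\<lambda>i. c i / c k"] by simp
    ultimately show ?thesis unfolding J_def using card_Un_le order_trans add_mono by meson
  qed
  ultimately have "CARD('n) * CARD('n) \<le> (CARD('n) - 1) * CARD('n) + (CARD('n) - 1)" by simp
  moreover have "CARD('n) > 0" by simp
  ultimately show False by (cases "CARD('n)") auto
qed

text \<open>The second argument only fixes the size of the matrices.\<close>

definition lang_property :: "('a::field \<Rightarrow> 'a) \<Rightarrow> 'n::finite itself \<Rightarrow> bool" where
  "lang_property f _ \<longleftrightarrow> (\<forall>A :: 'a^'n^'n. det A \<noteq> 0 \<longrightarrow>
     (\<exists>z :: 'a^'n^'n. det z \<noteq> 0 \<and> (\<chi> i j. f (z $ i $ j)) = A ** z))"

text \<open>Blocks are indexed by a level and a matrix. A block is moved only if the entries of its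
  matrix are algebraic over basis elements of smaller level; since finitely many basis elements
  suffice for a matrix, this happens at some level for every invertible matrix.\<close>

theorem generic_lang_automorphism:
  fixes B :: "'a::alg_closed_field set"
  assumes B: "infinite B" "alg_indep B" "alg_cl B = UNIV"
  shows "\<exists>f :: 'a \<Rightarrow> 'a. field_aut f \<and> lang_property f TYPE('n::finite)"
proof -
  have U: "|UNIV :: 'a set| \<le>o |B|" by (rule card_of_UNIV_le_basis[OF B(1,3)])
  have "|(UNIV :: nat set) \<times> (UNIV :: ('a^'n^'n) set) \<times> (UNIV :: 'n set) \<times> (UNIV :: 'n set)| \<le>o |B|"
    by (intro card_of_Times_bound B card_of_nat_bound card_of_matrices U card_of_finite_bound) auto
  then have "|UNIV :: (nat \<times> ('a^'n^'n) \<times> 'n \<times> 'n) set| \<le>o |B|" by simp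
  then obtain \<iota> :: "nat \<times> ('a^'n^'n) \<times> 'n \<times> 'n \<Rightarrow> 'a" where \<iota>: "inj \<iota>" "range \<iota> \<subseteq> B"
    unfolding card_of_ordLeq[symmetric] by auto
  \<comment> \<open>The basis elements of level below \<open>m\<close>; those outside the range of
    \<open>\<iota>\<close> belong to every \<open>L m\<close>.\<close>
  define L where "L m = B - \<iota> ` {(k, A, i, j) | k A i j. k \<ge> m}" for m
  define z where "z m A = (\<chi> i j. \<iota> (m, A, i, j))" for m A
  define good where "good m A \<longleftrightarrow> det A \<noteq> 0 \<and> (\<forall>i j. A $ i $ j \<in> alg_cl (L m))" for m and A :: "'a^'n^'n"
  define \<sigma> where "\<sigma> b = (if b \<in> range \<iota> then (case inv_into UNIV \<iota> b of (m, A, i, j) \<Rightarrow>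
      if good m A then (A ** z m A) $ i $ j else b) else b)" for b
  have \<sigma>1: "\<sigma> (\<iota> (m, A, i, j)) = (if good m A then (A ** z m A) $ i $ j else \<iota> (m, A, i, j))" for m A i j
    using \<iota>(1) by (simp add: \<sigma>_def)
  have \<sigma>2: "\<sigma> b = b" if "b \<notin> range \<iota>" for b using that by (simp add: \<sigma>_def)
  \<comment> \<open>On such a finite set a rank count shows that \<open>\<sigma>\<close> is injective with independent image.\<close>
  define gs where "gs G \<longleftrightarrow> finite G \<and> G \<subseteq> B \<and> G \<subseteq> alg_cl (\<sigma> ` G)" for G
  have gs_UN: "gs (\<Union>i\<in>I. G i)" if "finite I" "\<And>i. i \<in> I \<Longrightarrow> gs (G i)" for I :: "'a set" and G
  proof -
    have "G i \<subseteq> alg_cl (\<sigma> ` (\<Union>i\<in>I. G i))" if "i \<in> I" for i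
      using \<open>\<And>i. i \<in> I \<Longrightarrow> gs (G i)\<close>[OF that] alg_cl_mono[of "\<sigma> ` G i" "\<sigma> ` (\<Union>i\<in>I. G i)"] that
      unfolding gs_def by blast
    then show ?thesis using that unfolding gs_def by blast
  qed
  have L_Suc: "b \<in> L m \<or> (\<exists>A i j. b = \<iota> (m, A, i, j))" if bL: "b \<in> L (Suc m)" for b m
  proof (cases "b \<in> L m")
    case False
    then obtain k A i j where k: "b = \<iota> (k, A, i, j)" "k \<ge> m" using bL by (auto simp: L_def)
    moreover have "\<not> k \<ge> Suc m" using bL k by (auto simp: L_def)
    ultimately show ?thesis by (metis le_antisym not_less_eq_eq)
  qed simp
  \<comment> \<open>Induction on the level: a whole block of level \<open>m\<close>, joined with
    such sets for the finitely many lower elements on which the entries of \<open>A\<close> depend,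
    is again such a set.\<close>
  have in_gs: "\<exists>G. gs G \<and> b \<in> G" if "b \<in> L m" for b m
    using that
  proof (induction m arbitrary: b)
    case 0
    then have "b \<in> B" "b \<notin> range \<iota>" by (auto simp: L_def)
    then have "gs {b}" unfolding gs_def using \<sigma>2[of b] alg_cl_extensive[of "{b}"] by simp
    then show ?case by blast
  next
    case (Suc m)
    show ?case
    proof (cases "b \<in> L m")
      case True then show ?thesis by (rule Suc.IH)
    next
      case False
      then obtain A i j where b: "b = \<iota> (m, A, i, j)" using L_Suc Suc.prems by blast
      then have bB: "b \<in> B" using \<iota>(2) by auto
      show ?thesis
      proof (cases "good m A")
        case False
        then have "gs {b}" unfolding gs_def using \<sigma>1[of m A i j] b bB alg_cl_extensive[of "{b}"] by simp
        then show ?thesis by blast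
      next
        case True
        then have "\<forall>kl. \<exists>D. finite D \<and> D \<subseteq> L m \<and> A $ fst kl $ snd kl \<in> alg_cl D"
          using alg_cl_finitary unfolding good_def by metis
        then obtain D where D: "\<And>kl. finite (D kl) \<and> D kl \<subseteq> L m \<and> A $ fst kl $ snd kl \<in> alg_cl (D kl)" by metis
        define D' where "D' = (\<Union>kl. D kl)"
        have D': "finite D'" "D' \<subseteq> L m" unfolding D'_def using D by auto
        have AD: "A $ k $ l \<in> alg_cl D'" for k l
          using D[of "(k, l)"] alg_cl_mono[of "D (k, l)" D'] by (auto simp: D'_def)
        have "\<forall>d. \<exists>G. d \<in> D' \<longrightarrow> gs G \<and> d \<in> G" using Suc.IH D' by blast
        then obtain G where G: "\<And>d. d \<in> D' \<Longrightarrow> gs (G d) \<and> d \<in> G d" by metis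
        define G' where "G' = (\<Union>d\<in>D'. G d)"
        have G': "gs G'" unfolding G'_def using G D' by (intro gs_UN) auto
        define C where "C = G' \<union> range (\<lambda>(k, l). \<iota> (m, A, k, l))"
        have sub: "alg_cl (\<sigma> ` G') \<subseteq> alg_cl (\<sigma> ` C)" by (intro alg_cl_mono) (auto simp: C_def)
        have GC: "G' \<subseteq> alg_cl (\<sigma> ` C)" using G' sub by (auto simp: gs_def)
        have "D' \<subseteq> G'" using G by (auto simp: G'_def)
        then have "alg_cl D' \<subseteq> alg_cl (\<sigma> ` C)" using GC by (intro alg_cl_least) blast
        then have AC: "A $ k $ l \<in> alg_cl (\<sigma> ` C)" for k l using AD by blast
        have "(A ** z m A) $ k $ l \<in> \<sigma> ` C" for k l
          using \<sigma>1[of m A k l] True by (auto simp: C_def intro!: image_eqI[of _ _ "\<iota> (m, A, k, l)"])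
        then have AzC: "(A ** z m A) $ k $ l \<in> alg_cl (\<sigma> ` C)" for k l using alg_cl_extensive[of "\<sigma> ` C"] by blast
        \<comment> \<open>The images of \<open>C\<close> generate the entries of \<open>A\<close>
          and of \<open>A ** z m A\<close>, hence also the block itself.\<close>
        have "z m A $ k $ l \<in> alg_cl (\<sigma> ` C)" for k l
          by (rule matrix_solution_in_subfield[OF alg_cl_subring alg_cl_divide _ AC AzC]) (use True in \<open>auto simp: good_def\<close>)
        then have "C \<subseteq> alg_cl (\<sigma> ` C)" using GC by (auto simp: C_def z_def)
        moreover have "finite C" "C \<subseteq> B" using G' \<iota>(2) by (auto simp: C_def gs_def)
        ultimately have "gs C" by (simp add: gs_def)
        moreover have "b \<in> C" using b by (auto simp: C_def)
        ultimately show ?thesis by blast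
      qed
    qed
  qed
  have L_mono: "L k \<subseteq> L l" if "k \<le> l" for k l
    unfolding L_def using that by (auto dest: order_trans)
  have B_L: "\<exists>m. b \<in> L m" if "b \<in> B" for b
  proof (cases "b \<in> range \<iota>")
    case False then show ?thesis using that by (auto simp: L_def)
  next
    case True
    then obtain m A i j where "b = \<iota> (m, A, i, j)" by auto
    then have "b \<in> L (Suc m)" using that \<iota>(1) by (auto simp: L_def dest!: injD)
    then show ?thesis by blast
  qed
  have gs_ex: "\<exists>G. gs G \<and> T \<subseteq> G" if T: "finite T" "T \<subseteq> B" for T
  proof -
    have "\<forall>b. \<exists>G. b \<in> T \<longrightarrow> gs G \<and> b \<in> G" using in_gs B_L T by blast
    then obtain G where G: "\<And>b. b \<in> T \<Longrightarrow> gs (G b) \<and> b \<in> G b" by metis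
    then have "gs (\<Union>b\<in>T. G b)" using T by (intro gs_UN) auto
    then show ?thesis using G by blast
  qed
  have gs_props: "inj_on \<sigma> G \<and> alg_indep (\<sigma> ` G)" if G: "gs G" for G
  proof -
    have ind: "alg_indep G" "finite G" "G \<subseteq> alg_cl (\<sigma> ` G)" using G alg_indep_subset[OF B(2)] by (auto simp: gs_def)
    then have "card G \<le> card (\<sigma> ` G)" by (intro alg_indep_card_le) auto
    then have "card (\<sigma> ` G) = card G" using card_image_le[OF ind(2), of \<sigma>] by simp
    then show ?thesis using eq_card_imp_inj_on[OF ind(2)] alg_indep_of_card[OF ind(2) _ ind(1) ind(3)] ind(2) by simp
  qed
  have inj: "inj_on \<sigma> B"
  proof (rule inj_onI)
    fix x y assume xy: "x \<in> B" "y \<in> B" "\<sigma> x = \<sigma> y"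
    then obtain G where "gs G" "{x, y} \<subseteq> G" using gs_ex[of "{x, y}"] by auto
    then show "x = y" using gs_props[of G] xy by (auto dest: inj_onD)
  qed
  have ind: "alg_indep (\<sigma> ` B)"
  proof (rule alg_indep_finitary)
    fix T assume "finite T" "T \<subseteq> \<sigma> ` B"
    then obtain T' where T': "finite T'" "T' \<subseteq> B" "T = \<sigma> ` T'" using finite_subset_image by metis
    then obtain G where "gs G" "T' \<subseteq> G" using gs_ex by blast
    then show "alg_indep T" using gs_props[of G] T' alg_indep_subset[of "\<sigma> ` G" T] by blast
  qed
  have "B \<subseteq> alg_cl (\<sigma> ` B)"
  proof
    fix b assume "b \<in> B"
    then obtain G where "gs G" "b \<in> G" using gs_ex[of "{b}"] by auto
    then show "b \<in> alg_cl (\<sigma> ` B)" using alg_cl_mono[of "\<sigma> ` G" "\<sigma> ` B"] by (auto simp: gs_def)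
  qed
  then have "alg_cl (\<sigma> ` B) = UNIV" using alg_cl_least[of B "\<sigma> ` B"] B(3) by auto
  then obtain f where f: "field_aut f" "\<And>b. b \<in> B \<Longrightarrow> f b = \<sigma> b"
    using field_aut_extending[OF B(2,3) inj ind] by blast
  have "\<exists>y :: 'a^'n^'n. det y \<noteq> 0 \<and> (\<chi> i j. f (y $ i $ j)) = A ** y" if A: "det A \<noteq> 0" for A :: "'a^'n^'n"
  proof -
    have "\<forall>kl. \<exists>D. finite D \<and> D \<subseteq> B \<and> A $ fst kl $ snd kl \<in> alg_cl D"
      using alg_cl_finitary[of _ B] B(3) by auto
    then obtain D where D: "\<And>kl. finite (D kl) \<and> D kl \<subseteq> B \<and> A $ fst kl $ snd kl \<in> alg_cl (D kl)" by metis
    define D' where "D' = (\<Union>kl. D kl)"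
    have D': "finite D'" "D' \<subseteq> B" unfolding D'_def using D by auto
    have "\<forall>b. \<exists>m. b \<in> D' \<longrightarrow> b \<in> L m" using B_L D' by blast
    then obtain lev where lev: "\<And>b. b \<in> D' \<Longrightarrow> b \<in> L (lev b)" by metis
    \<comment> \<open>The sum of the levels serves as an upper bound for all of them.\<close>
    define m where "m = (\<Sum>b\<in>D'. lev b)"
    have "D' \<subseteq> L m"
    proof
      fix b assume b: "b \<in> D'"
      then have "lev b \<le> m" unfolding m_def using D' by (intro member_le_sum) auto
      then show "b \<in> L m" using lev[OF b] L_mono by blast
    qed
    then have "A $ k $ l \<in> alg_cl (L m)" for k l
      using D[of "(k, l)"] alg_cl_mono[of "D (k, l)" "L m"] by (auto simp: D'_def)
    then have g: "good m A" using A by (simp add: good_def)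
    have "f (z m A $ i $ j) = (A ** z m A) $ i $ j" for i j
      using f(2)[of "\<iota> (m, A, i, j)"] \<iota>(2) \<sigma>1[of m A i j] g by (auto simp: z_def)
    then have e: "(\<chi> i j. f (z m A $ i $ j)) = A ** z m A" by (simp add: vec_eq_iff)
    have "det (z m A) \<noteq> 0"
    proof (rule det_nonzero_of_alg_indep)
      show "inj (\<lambda>(i, j). z m A $ i $ j)" using \<iota>(1) by (auto simp: z_def inj_def)
      show "alg_indep (range (\<lambda>(i, j). z m A $ i $ j))"
        by (rule alg_indep_subset[OF B(2)]) (use \<iota>(2) in \<open>auto simp: z_def\<close>)
    qed
    then show ?thesis using e by blast
  qed
  then show ?thesis using f(1) unfolding lang_property_def by blast
qed

section \<open>Lang's theorem for the Frobenius automorphism\<close>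

text \<open>Used twice: for the vectors fixed by a Frobenius-semilinear map and for simultaneous
  eigenvectors.\<close>

lemma spanning_set_matrix:
  fixes S :: "('a::field^'n) set"
  assumes "vec.span S = UNIV"
  obtains z :: "'a^'n^'n" where "det z \<noteq> 0" "\<And>j. column j z \<in> S"
proof -
  obtain B where B: "B \<subseteq> S" "vec.independent B" "S \<subseteq> vec.span B" by (rule vec.maximal_independent_subset)
  have sB: "vec.span B = UNIV" using assms B(3) vec.span_mono[OF B(3)] by (simp add: vec.span_span top.extremum_unique)
  have "card B = CARD('n)" using vec.dim_eq_card[of B UNIV] B sB by (metis vec.span_UNIV vec_dim_card)
  moreover have "finite B" using B(2) by (rule vec.finiteI_independent)
  ultimately obtain g where g: "bij_betw g (UNIV :: 'n set) B"
    by (metis finite_class.finite_UNIV finite_same_card_bij)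
  define z where "z = (\<chi> i j. g j $ i)"
  have col: "column j z = g j" for j by (simp add: z_def column_def vec_eq_iff)
  have "columns z = B" using g col by (auto simp: columns_def bij_betw_def)
  then have "\<exists>C. z ** C = mat 1" using matrix_right_invertible_span_columns[of z] sB by simp
  then have "det z \<noteq> 0" using invertible_det_nz[of z] invertible_right_inverse[of z] by simp
  moreover have "column j z \<in> S" for j using col g B(1) by (auto simp: bij_betw_def)
  ultimately show ?thesis using that by blast
qed

lemma span_image_Un:
  fixes F :: "nat \<Rightarrow> 'a::field^'n"
  shows "x \<in> vec.span (F ` {..<k} \<union> W) \<Longrightarrow> \<exists>a u. u \<in> vec.span W \<and> x = (\<Sum>i<k. a i *s F i) + u"
proof (induction k arbitrary: x)
  case 0 then show ?case by auto
next
  case (Suc k)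
  have "F ` {..<Suc k} \<union> W = insert (F k) (F ` {..<k} \<union> W)" by (auto simp: less_Suc_eq)
  then obtain c where "x - c *s F k \<in> vec.span (F ` {..<k} \<union> W)"
    using Suc.prems vec.span_breakdown_eq by metis
  then obtain a u where u: "u \<in> vec.span W" "x - c *s F k = (\<Sum>i<k. a i *s F i) + u" using Suc.IH by blast
  have "x = (\<Sum>i<Suc k. (a(k := c)) i *s F i) + u"
    using u(2) by (simp add: algebra_simps)
  then show ?case using u(1) by blast
qed

text \<open>If \<open>f\<^sup>k v = \<Sum> a\<^sub>i f\<^sup>i v\<close>, a vector \<open>\<Sum> b\<^sub>i f\<^sup>i v\<close> is fixed by \<open>f\<close> exactly when \<open>b\<^sub>i\<close> is the value of the
  \<open>i\<close>-th polynomial below at the last coefficient \<open>b\<close>, and the last of these values is \<open>b\<close> itself.\<close>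

primrec lang_poly :: "nat \<Rightarrow> (nat \<Rightarrow> 'a::field) \<Rightarrow> nat \<Rightarrow> 'a poly" where
  "lang_poly p a 0 = monom (a 0) p"
| "lang_poly p a (Suc i) = lang_poly p a i ^ p + monom (a (Suc i)) p"

lemma monom_power_1: "monom (1::'a::field) n ^ k = monom 1 (n * k)"
  by (simp add: monom_altdef flip: power_mult)

lemma lang_poly_dvd:
  assumes "p \<ge> 1" shows "monom 1 p dvd lang_poly p a i"
proof (induction i)
  case 0
  have "monom (a 0) p = monom 1 p * [:a 0:]" by (simp add: monom_altdef)
  then show ?case by (metis dvd_triv_left lang_poly.simps(1))
next
  case (Suc i)
  have "monom (a (Suc i)) p = monom 1 p * [:a (Suc i):]" by (simp add: monom_altdef)
  moreover have "monom 1 p dvd lang_poly p a i ^ p" using assms by (intro dvd_trans[OF Suc dvd_power]) auto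
  ultimately show ?case by (metis dvd_add dvd_triv_left lang_poly.simps(2))
qed

text \<open>\<open>lang_poly p a i\<close> is divisible by X^p, so its p-th power contributes
  nothing in degree p; there only the coefficient \<open>a (Suc i)\<close> is visible, and it must
  vanish.\<close>

lemma lang_poly_eq_0:
  assumes "p \<ge> 2" shows "lang_poly p a i = 0 \<Longrightarrow> j \<le> i \<Longrightarrow> a j = 0"
proof (induction i arbitrary: j)
  case 0 then show ?case by simp
next
  case (Suc i)
  obtain S where S: "lang_poly p a i = monom 1 p * S" using lang_poly_dvd[of p a i] assms by (auto elim: dvdE)
  have "coeff (lang_poly p a i ^ p) p = 0"
    using assms by (simp add: S power_mult_distrib monom_power_1 coeff_monom_mult)
  then have a: "a (Suc i) = 0" using Suc.prems(1) by (metis (no_types) add_0 coeff_0 coeff_add coeff_monom lang_poly.simps(2))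
  then have "lang_poly p a i = 0" using Suc.prems(1) assms by simp
  then show ?case using Suc.IH a Suc.prems(2) le_Suc_eq by metis
qed

text \<open>With the polynomial written as X^p S, a nonzero fixed point is a root of X^(p-1) S - 1,
  which is not constant because S \<noteq> 0 and p \<ge> 2.\<close>

lemma lang_poly_fixed_point:
  fixes a :: "nat \<Rightarrow> 'a::alg_closed_field"
  assumes "p \<ge> 2" "j \<le> i" "a j \<noteq> 0"
  obtains b where "b \<noteq> 0" "poly (lang_poly p a i) b = b"
proof -
  obtain S where S: "lang_poly p a i = monom 1 p * S" using lang_poly_dvd[of p a i] assms by (auto elim: dvdE)
  have "S \<noteq> 0" using lang_poly_eq_0[OF assms(1), of a i j] assms S by auto
  define Q where "Q = monom 1 (p - 1) * S - 1"
  have d: "degree (monom 1 (p - 1) * S) = (p - 1) + degree S"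
    using \<open>S \<noteq> 0\<close> by (simp add: degree_mult_eq degree_monom_eq)
  have "degree Q > 0"
  proof (rule ccontr)
    assume "\<not> degree Q > 0"
    then have "degree (Q + 1) \<le> 0" by (intro degree_add_le) auto
    then show False using d assms(1) by (simp add: Q_def)
  qed
  then obtain b where b: "poly Q b = 0" using alg_closed_imp_poly_has_root by blast
  then have e: "b ^ (p - 1) * poly S b = 1" by (simp add: Q_def poly_monom)
  then have "b \<noteq> 0" using assms(1) by (auto simp: power_0_left)
  moreover have "poly (lang_poly p a i) b = b * (b ^ (p - 1) * poly S b)"
    using assms(1) power_Suc[of b "p - 1"] by (simp add: S poly_monom)
  ultimately show ?thesis using that e by simp
qed

text \<open>A root of the Artin-Schreier polynomial X^p - X + c. It serves to correct an error lying
  in the span of the fixed vectors.\<close>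

lemma artin_schreier_solvable:
  fixes c :: "'a::alg_closed_field"
  assumes "p \<ge> 2"
  obtains d where "d ^ p = d - c"
proof -
  define Q where "Q = monom 1 p + [:c, -1:]"
  have "degree Q = p" unfolding Q_def using assms
    by (subst degree_add_eq_left) (auto simp: degree_monom_eq)
  then obtain d where "poly Q d = 0" using alg_closed_imp_poly_has_root[of Q] assms by auto
  then have "d ^ p + (c - d) = 0" by (simp add: Q_def poly_monom)
  then have "d ^ p = d - c" by (simp add: eq_neg_iff_add_eq_0[symmetric])
  then show ?thesis using that by blast
qed

lemma additive_sum:
  fixes f :: "'b::comm_monoid_add \<Rightarrow> 'c::comm_monoid_add"
  assumes "f 0 = 0" "\<And>u v. f (u + v) = f u + f v"
  shows "f (sum g I) = (\<Sum>i\<in>I. f (g i))"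
  by (induction I rule: infinite_finite_induct) (auto simp: assms)

text \<open>For a vector outside the span \<open>W\<close> of the fixed vectors, consider the first
  linear relation modulo \<open>W\<close> among its iterates. It yields a combination
  \<open>w\<close> that is fixed up to an error in \<open>W\<close>. The error can be removed inside
  \<open>W\<close>, so \<open>w\<close> lies in \<open>W\<close>, and this is an earlier
  relation.\<close>

lemma frobenius_semilinear_fixed_span:
  fixes f :: "'a::alg_closed_field^'n \<Rightarrow> 'a^'n"
  assumes p: "p \<ge> 2" and add: "\<And>u v. f (u + v) = f u + f v" and scale: "\<And>c v. f (c *s v) = c ^ p *s f v"
    and ker: "\<And>v. f v = 0 \<Longrightarrow> v = 0"
  shows "vec.span {w. f w = w} = UNIV"
proof (rule ccontr)
  define Fix where "Fix = {w. f w = w}"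
  define W where "W = vec.span Fix"
  assume "vec.span {w. f w = w} \<noteq> UNIV"
  then obtain v where v: "v \<notin> W" by (auto simp: W_def Fix_def)
  have f0: "f 0 = 0" using scale[of 0 0] p by (simp add: power_0_left)
  note fsum = additive_sum[of f, OF f0 add]
  have inj: "u = w" if "f u = f w" for u w
  proof -
    have "f (u - w) + f w = f u" using add[of "u - w" w] by simp
    then show ?thesis using ker[of "u - w"] that by simp
  qed
  have W_rep: "\<exists>S c. finite S \<and> S \<subseteq> Fix \<and> u = (\<Sum>x\<in>S. c x *s x)" if "u \<in> W" for u
    using that unfolding W_def vec.span_explicit by blast
  have in_W: "(\<Sum>x\<in>S. c x *s x) \<in> W" if "S \<subseteq> Fix" for S and c :: "_ \<Rightarrow> 'a"
    unfolding W_def using that by (intro vec.span_sum vec.span_scale vec.span_base) auto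
  have f_rep: "f (\<Sum>x\<in>S. c x *s x) = (\<Sum>x\<in>S. c x ^ p *s x)" if "S \<subseteq> Fix" for S c
    unfolding fsum scale using that by (intro sum.cong) (auto simp: Fix_def)
  \<comment> \<open>Taking p-th roots of coefficients gives a preimage in \<open>W\<close>, and
    \<open>f\<close> is injective. Hence no iterate of \<open>v\<close> ever enters
    \<open>W\<close>.\<close>
  have fW: "u \<in> W" if fu: "f u \<in> W" for u
  proof -
    obtain S c where S: "finite S" "S \<subseteq> Fix" "f u = (\<Sum>x\<in>S. c x *s x)" using W_rep[OF fu] by blast
    have "\<forall>x. \<exists>d. d ^ p = c x" using nth_root_exists[of p] p by auto
    then obtain d where d: "\<And>x. d x ^ p = c x" by metis
    have "f u = f (\<Sum>x\<in>S. d x *s x)" using f_rep[OF S(2), of d] S(3) d by simp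
    then show ?thesis using inj in_W[OF S(2)] by metis
  qed
  define F where "F i = (f ^^ i) v" for i
  have F_Suc: "F (Suc i) = f (F i)" for i by (simp add: F_def)
  have F_notW: "F i \<notin> W" for i by (induction i) (use v fW in \<open>auto simp: F_def\<close>)
  have "\<exists>k. F k \<in> vec.span (F ` {..<k} \<union> Fix)"
  proof (rule ccontr)
    assume n: "\<nexists>k. F k \<in> vec.span (F ` {..<k} \<union> Fix)"
    have ns: "F k \<notin> vec.span (F ` {..<k})" for k
      using n vec.span_mono[of "F ` {..<k}" "F ` {..<k} \<union> Fix"] by blast
    have "vec.independent (F ` {..<k}) \<and> card (F ` {..<k}) = k" for k
    proof (induction k)
      case 0 then show ?case by (simp add: vec.independent_empty)
    next
      case (Suc k)
      have "F k \<notin> F ` {..<k}" using ns[of k] vec.span_base[of "F k" "F ` {..<k}"] by metis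
      then show ?case using Suc vec.independent_insertI[OF ns, of k] by (simp add: lessThan_Suc)
    qed
    then have "vec.independent (F ` {..<Suc CARD('n)})" "card (F ` {..<Suc CARD('n)}) = Suc CARD('n)" by blast+
    then show False using vec.independent_card_le_dim[of "F ` {..<Suc CARD('n)}" UNIV]
      by (metis Suc_n_not_le_n subset_UNIV vec_dim_card)
  qed
  then obtain k where k: "F k \<in> vec.span (F ` {..<k} \<union> Fix)"
    and least: "\<And>l. l < k \<Longrightarrow> F l \<notin> vec.span (F ` {..<l} \<union> Fix)"
    using exists_least_iff[of "\<lambda>k. F k \<in> vec.span (F ` {..<k} \<union> Fix)"] by blast
  have "k \<noteq> 0" using k F_notW[of 0] by (cases k) (auto simp: W_def)
  then obtain k' where k': "k = Suc k'" by (cases k) auto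
  obtain a u0 where u0: "u0 \<in> W" and Fk: "F k = (\<Sum>i<k. a i *s F i) + u0"
    using span_image_Un[OF k] unfolding W_def by blast
  \<comment> \<open>Otherwise the iterate \<open>F k\<close> itself would lie in
    \<open>W\<close>.\<close>
  have "\<exists>j\<le>k'. a j \<noteq> 0"
  proof (rule ccontr)
    assume "\<not> (\<exists>j\<le>k'. a j \<noteq> 0)"
    then have "(\<Sum>i<k. a i *s F i) = 0" by (intro sum.neutral) (auto simp: k')
    then show False using Fk u0 F_notW[of k] by simp
  qed
  then obtain b where b: "b \<noteq> 0" "poly (lang_poly p a k') b = b" using lang_poly_fixed_point[OF p] by metis
  define \<beta> where "\<beta> i = poly (lang_poly p a i) b" for i
  have \<beta>0: "\<beta> 0 = b ^ p * a 0" by (simp add: \<beta>_def poly_monom mult.commute)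
  have \<beta>S: "\<beta> (Suc i) = \<beta> i ^ p + b ^ p * a (Suc i)" for i by (simp add: \<beta>_def poly_monom mult.commute)
  define w where "w = (\<Sum>i<k. \<beta> i *s F i)"
  \<comment> \<open>Since the relation for \<open>F k\<close> holds only modulo \<open>W\<close>,
    the vector \<open>w\<close> is fixed only up to the term \<open>b ^ p *s u0\<close>.\<close>
  have "f w = (\<Sum>i<k'. \<beta> i ^ p *s F (Suc i)) + b ^ p *s F k"
    using b(2) by (simp add: w_def fsum scale add F_Suc k' \<beta>_def)
  also have "b ^ p *s F k = (\<Sum>i<k. (b ^ p * a i) *s F i) + b ^ p *s u0"
    by (simp add: Fk vec.scale_right_distrib vec.scale_sum_right)
  also have "(\<Sum>i<k. (b ^ p * a i) *s F i) = (b ^ p * a 0) *s F 0 + (\<Sum>i<k'. (b ^ p * a (Suc i)) *s F (Suc i))"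
    unfolding k' by (rule sum.lessThan_Suc_shift)
  finally have "f w = (\<beta> 0 *s F 0 + (\<Sum>i<k'. \<beta> (Suc i) *s F (Suc i))) + b ^ p *s u0"
    by (simp add: \<beta>0 \<beta>S vec.scale_left_distrib sum.distrib algebra_simps)
  also have "\<beta> 0 *s F 0 + (\<Sum>i<k'. \<beta> (Suc i) *s F (Suc i)) = w"
    unfolding w_def k' by (rule sum.lessThan_Suc_shift[symmetric])
  finally have fw: "f w = w + b ^ p *s u0" .
  have "b ^ p *s u0 \<in> W" using u0 unfolding W_def by (rule vec.span_scale)
  then obtain S c where S: "finite S" "S \<subseteq> Fix" "b ^ p *s u0 = (\<Sum>x\<in>S. c x *s x)" using W_rep by blast
  have "\<forall>x. \<exists>d. d ^ p = d - c x" using artin_schreier_solvable[OF p] by metis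
  then obtain d where d: "\<And>x. d x ^ p = d x - c x" by metis
  define u where "u = (\<Sum>x\<in>S. d x *s x)"
  have "f u = u - b ^ p *s u0"
    using f_rep[OF S(2), of d] S(3) d by (simp add: u_def vec.scale_left_diff_distrib sum_subtractf)
  then have "f (w + u) = w + u" using fw add by simp
  then have "w + u \<in> W" unfolding W_def by (intro vec.span_base) (simp add: Fix_def)
  moreover have "u \<in> W" unfolding u_def by (rule in_W[OF S(2)])
  ultimately have "w + u - u \<in> W" unfolding W_def by (rule vec.span_diff)
  then have wW: "w \<in> W" by simp
  \<comment> \<open>The last coefficient of \<open>w\<close> is \<open>b\<close>, which is nonzero,
    so \<open>F k'\<close> can be isolated.\<close>
  have "b *s F k' = w - (\<Sum>i<k'. \<beta> i *s F i)" using b(2) by (simp add: w_def k' \<beta>_def)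
  also have "\<dots> \<in> vec.span (F ` {..<k'} \<union> Fix)"
  proof (rule vec.span_diff)
    show "w \<in> vec.span (F ` {..<k'} \<union> Fix)"
      using wW vec.span_mono[of Fix "F ` {..<k'} \<union> Fix"] unfolding W_def by blast
    show "(\<Sum>i<k'. \<beta> i *s F i) \<in> vec.span (F ` {..<k'} \<union> Fix)"
      by (intro vec.span_sum vec.span_scale vec.span_base) auto
  qed
  finally have "inverse b *s (b *s F k') \<in> vec.span (F ` {..<k'} \<union> Fix)" by (rule vec.span_scale)
  then have "F k' \<in> vec.span (F ` {..<k'} \<union> Fix)" using b(1) by simp
  then show False using least[of k'] k' by simp
qed

text \<open>Apply the entrywise p-th power followed by the inverse of A. The fixed vectors of this
  map are the solutions of the equation for a single column; as they span the space, some of them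
  form an invertible matrix.\<close>

theorem frobenius_lang:
  assumes ch: "CHAR('a::alg_closed_field) > 0"
  shows "field_aut (\<lambda>x::'a. x ^ CHAR('a))" "lang_property (\<lambda>x::'a. x ^ CHAR('a)) TYPE('n::finite)"
proof -
  define p where "p = CHAR('a)"
  have pr: "prime CHAR('a)" using ch by (intro prime_CHAR_semidom) auto
  have p: "p \<ge> 2" using pr prime_ge_2_nat by (simp add: p_def)
  have fadd: "(x + y) ^ p = x ^ p + y ^ p" for x y :: 'a using freshmans_dream[OF pr p_def] .
  have "inj (\<lambda>x::'a. x ^ p)"
  proof (rule injI)
    fix x y :: 'a assume e: "x ^ p = y ^ p"
    have "x ^ p = (x - y) ^ p + y ^ p" using fadd[of "x - y" y] by simp
    then have "(x - y) ^ p = 0" using e by simp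
    then show "x = y" using p by simp
  qed
  moreover have "surj (\<lambda>x::'a. x ^ p)" unfolding surj_def using nth_root_exists[of p] p by (metis not_numeral_le_zero gr0I)
  ultimately show "field_aut (\<lambda>x::'a. x ^ CHAR('a))"
    using fadd by (simp add: field_aut_def bij_def p_def power_mult_distrib)
  have "\<exists>z :: 'a^'n^'n. det z \<noteq> 0 \<and> (\<chi> i j. (z $ i $ j) ^ p) = A ** z" if A: "det A \<noteq> 0" for A :: "'a^'n^'n"
  proof -
    obtain B where AB: "A ** B = mat 1" and BA: "B ** A = mat 1"
      using A invertible_det_nz[of A] by (auto simp: invertible_def)
    define f :: "'a^'n \<Rightarrow> 'a^'n" where "f v = B *v (\<chi> i. (v $ i) ^ p)" for v
    have Af: "A *v f v = (\<chi> i. (v $ i) ^ p)" for v by (simp add: f_def matrix_vector_mul_assoc AB)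
    have "vec.span {w. f w = w} = UNIV"
    proof (rule frobenius_semilinear_fixed_span[OF p])
      fix u v :: "'a^'n" and c :: 'a
      have "(\<chi> i. ((u + v) $ i) ^ p) = (\<chi> i. (u $ i) ^ p) + (\<chi> i. (v $ i) ^ p)" by (simp add: vec_eq_iff fadd)
      then show "f (u + v) = f u + f v" by (simp add: f_def matrix_vector_right_distrib)
      have "(\<chi> i. ((c *s v) $ i) ^ p) = c ^ p *s (\<chi> i. (v $ i) ^ p)" by (simp add: vec_eq_iff power_mult_distrib)
      then show "f (c *s v) = c ^ p *s f v" by (simp add: f_def vector_scalar_commute)
      show "v = 0" if "f v = 0"
      proof -
        have "(\<chi> i. (v $ i) ^ p) = 0" using Af[of v] that by simp
        then show ?thesis using p by (simp add: vec_eq_iff)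
      qed
    qed
    then obtain z :: "'a^'n^'n" where z: "det z \<noteq> 0" "\<And>j. column j z \<in> {w. f w = w}"
      using spanning_set_matrix by blast
    have "(z $ i $ j) ^ p = (A ** z) $ i $ j" for i j
    proof -
      have "A *v column j z = (\<chi> i. (column j z $ i) ^ p)" using Af[of "column j z"] z(2)[of j] by simp
      then have "(A *v column j z) $ i = (z $ i $ j) ^ p" by (simp add: column_def)
      then show ?thesis by (simp add: matrix_vector_mult_def matrix_matrix_mult_def column_def)
    qed
    then show ?thesis using z(1) by (intro exI[of _ z]) (simp add: vec_eq_iff)
  qed
  then show "lang_property (\<lambda>x::'a. x ^ CHAR('a)) TYPE('n)" unfolding lang_property_def p_def by blast
qed

section \<open>Elementary matrices and diagonalization\<close>

definition elem_mat :: "'n \<Rightarrow> 'n \<Rightarrow> 'a \<Rightarrow> 'a::field^'n^'n" where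
  "elem_mat i j a = (\<chi> k l. (if k = l then 1 else 0) + (if k = i \<and> l = j then a else 0))"

definition diag_mat :: "('n \<Rightarrow> 'a) \<Rightarrow> 'a::field^'n^'n" where
  "diag_mat t = (\<chi> k l. if k = l then t k else 0)"

definition diagonal_mat :: "'a::field^'n^'n \<Rightarrow> bool" where
  "diagonal_mat A \<longleftrightarrow> (\<forall>i j. i \<noteq> j \<longrightarrow> A $ i $ j = 0)"

lemma diag_mat_mult_left: "(diag_mat t ** A) $ k $ l = t k * A $ k $ l"
  by (simp add: matrix_matrix_mult_def diag_mat_def if_distrib[of "\<lambda>x. x * _"] cong: if_cong)

lemma diag_mat_mult_right: "(A ** diag_mat t) $ k $ l = A $ k $ l * t l"
  by (simp add: matrix_matrix_mult_def diag_mat_def if_distrib[of "\<lambda>x. _ * x"] cong: if_cong)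

lemma diagonal_diag_mat [simp]: "diagonal_mat (diag_mat t)"
  by (simp add: diagonal_mat_def diag_mat_def)

lemma diag_mat_nth: "diag_mat t $ i $ j = (if i = j then t i else 0)"
  by (simp add: diag_mat_def)

lemma diagonal_matD: "diagonal_mat A \<Longrightarrow> A = diag_mat (\<lambda>i. A $ i $ i)"
  by (auto simp: diagonal_mat_def diag_mat_def vec_eq_iff)

lemma det_diag_mat: "det (diag_mat t) = (\<Prod>i\<in>UNIV. t i)"
  by (subst det_diagonal) (auto simp: diag_mat_def)

lemma elem_mat_mult_left: "(elem_mat i j a ** A) $ k $ l = A $ k $ l + (if k = i then a * A $ j $ l else 0)"
proof -
  have "(elem_mat i j a ** A) $ k $ l = (\<Sum>m\<in>UNIV. (if m = k then A $ m $ l else 0) + (if m = j then (if k = i then a * A $ m $ l else 0) else 0))"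
    unfolding matrix_matrix_mult_def elem_mat_def by (auto intro!: sum.cong simp: distrib_right)
  then show ?thesis by (simp add: sum.distrib)
qed

lemma elem_mat_mult_right: "(A ** elem_mat i j a) $ k $ l = A $ k $ l + (if l = j then A $ k $ i * a else 0)"
proof -
  have "(A ** elem_mat i j a) $ k $ l = (\<Sum>m\<in>UNIV. (if m = l then A $ k $ m else 0) + (if m = i then (if l = j then A $ k $ m * a else 0) else 0))"
    unfolding matrix_matrix_mult_def elem_mat_def by (auto intro!: sum.cong simp: distrib_left)
  then show ?thesis by (simp add: sum.distrib)
qed

lemma elem_mat_nth: "elem_mat i j a $ k $ l = (if k = l then 1 else 0) + (if k = i \<and> l = j then a else 0)"
  by (simp add: elem_mat_def)

lemma mat_1_nth: "mat 1 $ k $ l = (if k = l then 1 else 0)"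
  by (simp add: mat_def)

lemma elem_mat_0 [simp]: "elem_mat i j 0 = mat 1"
  by (simp add: elem_mat_def mat_def vec_eq_iff)

lemma elem_mat_add: "i \<noteq> j \<Longrightarrow> elem_mat i j a ** elem_mat i j b = elem_mat i j (a + b)"
  by (auto simp: vec_eq_iff elem_mat_mult_left elem_mat_nth)

lemma elem_mat_inverse: "i \<noteq> j \<Longrightarrow> elem_mat i j a ** elem_mat i j (- a) = mat 1"
  by (simp add: elem_mat_add)

lemma det_elem_mat: "i \<noteq> j \<Longrightarrow> det (elem_mat i j a) = 1"
proof -
  assume ij: "i \<noteq> j"
  have "elem_mat i j a = (\<chi> k. if k = i then row i (mat 1) + a *s row j (mat 1) else row k (mat 1))"
    using ij by (auto simp: vec_eq_iff elem_mat_nth row_def mat_1_nth)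
  then show ?thesis using det_row_operation[OF ij, of "mat 1" a] by (simp add: det_I)
qed

lemma elem_mat_eq_iff:
  assumes "i \<noteq> j" "k \<noteq> l" "a \<noteq> 0" "elem_mat i j a = elem_mat k l b"
  shows "k = i \<and> l = j \<and> b = a"
proof -
  show ?thesis using arg_cong[OF assms(4), of "\<lambda>M. M $ i $ j"] assms(1-3)
    by (auto simp: elem_mat_nth split: if_splits)
qed

lemma elem_mat_comm:
  assumes "i \<noteq> j" "k \<noteq> l" "j \<noteq> k" "i \<noteq> l"
  shows "elem_mat i j a ** elem_mat k l b = elem_mat k l b ** elem_mat i j a"
  using assms by (auto simp: vec_eq_iff elem_mat_mult_left elem_mat_nth)

lemma elem_mat_commutator:
  assumes "i \<noteq> j" "j \<noteq> k" "i \<noteq> k"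
  shows "elem_mat i j a ** elem_mat j k b = elem_mat j k b ** elem_mat i j a ** elem_mat i k (a * b)"
  using assms by (auto simp: vec_eq_iff elem_mat_mult_left elem_mat_mult_right elem_mat_nth)

lemma transpose_elem_mat: "transpose (elem_mat i j a) = elem_mat j i a"
  by (auto simp: transpose_def elem_mat_def vec_eq_iff)

lemma matrix_inv_det:
  fixes A :: "'a::field^'n^'n"
  assumes "det A \<noteq> 0"
  shows "A ** matrix_inv A = mat 1" "matrix_inv A ** A = mat 1"
proof -
  have "\<exists>B. A ** B = mat 1 \<and> B ** A = mat 1" using assms invertible_det_nz[of A] by (simp add: invertible_def)
  then have "A ** matrix_inv A = mat 1 \<and> matrix_inv A ** A = mat 1"
    unfolding matrix_inv_def by (rule someI_ex)
  then show "A ** matrix_inv A = mat 1" "matrix_inv A ** A = mat 1" by auto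
qed

lemma matrix_left_cancel:
  fixes A :: "'a::field^'n^'n"
  assumes "det A \<noteq> 0" "A ** B = A ** C"
  shows "B = C"
proof -
  have "matrix_inv A ** (A ** B) = matrix_inv A ** (A ** C)" using assms by simp
  then show ?thesis by (simp add: matrix_mul_assoc matrix_inv_det[OF assms(1)])
qed

lemma matrix_right_cancel:
  fixes A :: "'a::field^'n^'n"
  assumes "det A \<noteq> 0" "B ** A = C ** A"
  shows "B = C"
proof -
  have "(B ** A) ** matrix_inv A = (C ** A) ** matrix_inv A" using assms by simp
  then show ?thesis by (simp add: matrix_mul_assoc[symmetric] matrix_inv_det[OF assms(1)])
qed

lemma matrix_inverse_comm: "(A::'a::field^'n^'n) ** B = mat 1 \<Longrightarrow> B ** A = mat 1"
  by (simp add: matrix_left_right_inverse)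

section \<open>Generation of SL by elementary matrices\<close>

inductive_set elem_gen :: "('a::field^'n^'n) set" where
  elem_gen_1: "mat 1 \<in> elem_gen"
| elem_gen_step: "A \<in> elem_gen \<Longrightarrow> i \<noteq> j \<Longrightarrow> elem_mat i j a ** A \<in> elem_gen"

lemma elem_gen_mult: "A \<in> elem_gen \<Longrightarrow> B \<in> elem_gen \<Longrightarrow> A ** B \<in> elem_gen"
  by (induction rule: elem_gen.induct) (auto simp: matrix_mul_assoc[symmetric] intro: elem_gen_step)

lemma elem_gen_elem: "i \<noteq> j \<Longrightarrow> elem_mat i j a \<in> elem_gen"
  using elem_gen_step[OF elem_gen_1, of i j a] by simp

lemma elem_gen_det: "A \<in> elem_gen \<Longrightarrow> det A = 1"
  by (induction rule: elem_gen.induct) (auto simp: det_mul det_elem_mat det_I)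

lemma elem_gen_inverse: "A \<in> elem_gen \<Longrightarrow> \<exists>B\<in>elem_gen. B ** A = mat 1"
proof (induction rule: elem_gen.induct)
  case elem_gen_1 show ?case using elem_gen.elem_gen_1 by force
next
  case (elem_gen_step A i j a)
  then obtain B where B: "B \<in> elem_gen" "B ** A = mat 1" by auto
  have "elem_mat i j (- a) ** elem_mat i j a = mat 1" using elem_mat_inverse[OF elem_gen_step(2), of "- a"] by simp
  then have "B ** elem_mat i j (- a) ** (elem_mat i j a ** A) = mat 1"
    using B(2) by (metis matrix_mul_assoc matrix_mul_lid)
  then show ?case using elem_gen_mult[OF B(1) elem_gen_elem[OF elem_gen_step(2), of "- a"]] by blast
qed

lemma elem_gen_transpose: "A \<in> elem_gen \<Longrightarrow> transpose A \<in> elem_gen"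
proof (induction rule: elem_gen.induct)
  case elem_gen_1 show ?case by (simp add: transpose_mat elem_gen.elem_gen_1)
next
  case (elem_gen_step A i j a)
  then show ?case by (auto simp: matrix_transpose_mul transpose_elem_mat intro!: elem_gen_mult elem_gen_elem)
qed

text \<open>Multiplication by it clears a whole column at once, and by its transpose a row. The set
  \<open>T\<close> serves the induction that factors it into elementary matrices.\<close>

definition col_mat :: "'n set \<Rightarrow> 'n \<Rightarrow> ('n \<Rightarrow> 'a) \<Rightarrow> 'a::field^'n^'n" where
  "col_mat T k c = (\<chi> r s. (if r = s then 1 else 0) + (if s = k \<and> r \<in> T \<and> r \<noteq> k then c r else 0))"

lemma col_mat_elem_gen: "finite T \<Longrightarrow> col_mat T k c \<in> elem_gen"
proof (induction T rule: finite_induct)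
  case empty
  have "col_mat {} k c = mat 1" by (simp add: col_mat_def mat_def vec_eq_iff)
  then show ?case by (simp add: elem_gen_1)
next
  case (insert x T)
  show ?case
  proof (cases "x = k")
    case True
    then have "col_mat (insert x T) k c = col_mat T k c" by (auto simp: col_mat_def vec_eq_iff)
    then show ?thesis using insert by simp
  next
    case False
    then have "col_mat (insert x T) k c = elem_mat x k (c x) ** col_mat T k c"
      using insert(2) by (auto simp: vec_eq_iff elem_mat_mult_left col_mat_def)
    then show ?thesis using elem_gen_step[OF insert(3) False] by simp
  qed
qed

lemma col_mat_mult: "(col_mat UNIV k c ** A) $ r $ s = A $ r $ s + (if r \<noteq> k then c r * A $ k $ s else 0)"
proof -
  have "(col_mat UNIV k c ** A) $ r $ s = (\<Sum>m\<in>UNIV. (if m = r then A $ m $ s else 0) + (if m = k then (if r \<noteq> k then c r * A $ m $ s else 0) else 0))"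
    unfolding matrix_matrix_mult_def col_mat_def by (auto intro!: sum.cong simp: distrib_right)
  then show ?thesis by (simp add: sum.distrib)
qed

definition cleared :: "'n set \<Rightarrow> 'a::field^'n^'n \<Rightarrow> bool" where
  "cleared K A \<longleftrightarrow> (\<forall>k\<in>K. A $ k $ k = 1 \<and> (\<forall>l. l \<noteq> k \<longrightarrow> A $ k $ l = 0 \<and> A $ l $ k = 0))"

lemma cleared_elem_mat:
  "cleared (- S) A \<Longrightarrow> k \<in> S \<Longrightarrow> l \<in> S \<Longrightarrow> cleared (- S) (elem_mat k l c ** A)"
proof -
  assume A: "cleared (- S) A" "k \<in> S" "l \<in> S"
  have "A $ l $ r = 0" "r \<noteq> k" if "r \<in> - S" for r
  proof -
    have "l \<noteq> r" "r \<noteq> k" using that A by auto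
    then show "A $ l $ r = 0" "r \<noteq> k" using A(1) that unfolding cleared_def by metis+
  qed
  then show ?thesis using A(1) unfolding cleared_def by (simp add: elem_mat_mult_left)
qed

text \<open>The pivot is adjusted by a multiple of another row with nonzero entry in column
  \<open>k\<close>. If row \<open>k\<close> alone has such an entry, it is first added to row
  \<open>m\<close>.\<close>

lemma cleared_pivot:
  fixes A :: "'a::field^'n^'n"
  assumes A: "det A \<noteq> 0" "cleared (- S) A" and km: "k \<in> S" "m \<in> S" "k \<noteq> m"
  shows "\<exists>E\<in>elem_gen. cleared (- S) (E ** A) \<and> (E ** A) $ k $ k = 1"
proof -
  \<comment> \<open>Adding \<open>(1 - A $ k $ k) / A $ l $ k\<close> times row \<open>l\<close> to
    row \<open>k\<close> turns the pivot into \<open>1\<close>.\<close>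
  have *: "\<exists>E\<in>elem_gen. cleared (- S) (E ** A) \<and> (E ** A) $ k $ k = 1"
    if "cleared (- S) A" "l \<in> S" "l \<noteq> k" "A $ l $ k \<noteq> 0" for l and A :: "'a^'n^'n"
    using that km cleared_elem_mat[OF that(1) km(1) that(2)]
    by (intro bexI[of _ "elem_mat k l ((1 - A $ k $ k) / A $ l $ k)"])
      (auto simp: elem_mat_mult_left intro!: elem_gen_elem)
  show ?thesis
  proof (cases "\<exists>l\<in>S. l \<noteq> k \<and> A $ l $ k \<noteq> 0")
    case True then show ?thesis using *[OF A(2)] by blast
  next
    case False
    have "column k A \<noteq> 0" using A(1) det_zero_column by metis
    then obtain l where "A $ l $ k \<noteq> 0" by (auto simp: column_def vec_eq_iff)
    moreover have "A $ l $ k = 0" if "l \<noteq> k" for l using False A(2) that by (cases "l \<in> S") (auto simp: cleared_def)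
    ultimately have kk: "A $ k $ k \<noteq> 0" by metis
    let ?A = "elem_mat m k 1 ** A"
    have "A $ m $ k = 0" using False km by auto
    then have "?A $ m $ k \<noteq> 0" using kk by (simp add: elem_mat_mult_left)
    then obtain E where E: "E \<in> elem_gen" "cleared (- S) (E ** ?A)" "(E ** ?A) $ k $ k = 1"
      using *[OF cleared_elem_mat[OF A(2) km(2,1)] km(2)] km(3) by blast
    have "E ** elem_mat m k 1 \<in> elem_gen" using E(1) km(3) by (intro elem_gen_mult elem_gen_elem) auto
    then show ?thesis using E by (metis matrix_mul_assoc)
  qed
qed

lemma elem_gen_reduction:
  fixes A :: "'a::field^'n^'n"
  assumes "finite S" "det A = 1" "cleared (- S) A"
  shows "\<exists>E\<in>elem_gen. \<exists>E'\<in>elem_gen. E ** A ** E' = mat 1"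
  using assms
proof (induction S arbitrary: A rule: finite_induct)
  case empty
  then have "A = mat 1" by (auto simp: cleared_def vec_eq_iff mat_1_nth)
  then show ?case using elem_gen_1 by (intro bexI[of _ "mat 1"]) auto
next
  case (insert k S)
  show ?case
  proof (cases "S = {}")
    \<comment> \<open>At the last index no other row is left to work with, but the determinant
      already forces the remaining entry to be \<open>1\<close>.\<close>
    case True
    then have c: "\<And>r s. r \<noteq> s \<Longrightarrow> A $ r $ s = 0" "\<And>r. r \<noteq> k \<Longrightarrow> A $ r $ r = 1"
      using insert.prems(2) unfolding cleared_def by (metis ComplI insertE empty_iff)+
    have "det A = (\<Prod>i\<in>UNIV. A $ i $ i)" using c by (intro det_diagonal) auto
    also have "\<dots> = A $ k $ k * (\<Prod>i\<in>UNIV-{k}. A $ i $ i)" by (simp add: prod.remove)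
    also have "(\<Prod>i\<in>UNIV-{k}. A $ i $ i) = 1" using c by (intro prod.neutral) auto
    finally have "A $ k $ k = 1" using insert.prems by simp
    then have "A = mat 1" using c by (auto simp: vec_eq_iff mat_1_nth) metis
    then show ?thesis using elem_gen_1 by (intro bexI[of _ "mat 1"]) auto
  next
    case False
    then obtain m where m: "m \<in> S" by auto
    obtain E where E: "E \<in> elem_gen" "cleared (- insert k S) (E ** A)" "(E ** A) $ k $ k = 1"
      using cleared_pivot[of A "insert k S" k m] insert m by auto
    define B where "B = E ** A"
    note B = E(2,3)[folded B_def]
    define C where "C = col_mat UNIV k (\<lambda>r. - B $ r $ k)"
    define R where "R = transpose (col_mat UNIV k (\<lambda>s. - B $ k $ s))"
    have CR: "C \<in> elem_gen" "R \<in> elem_gen"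
      unfolding C_def R_def by (simp_all add: col_mat_elem_gen elem_gen_transpose)
    have C1: "(C ** B) $ r $ s = B $ r $ s - (if r \<noteq> k then B $ r $ k * B $ k $ s else 0)" for r s
      by (simp add: C_def col_mat_mult)
    have R1: "(X ** R) $ r $ s = X $ r $ s - (if s \<noteq> k then B $ k $ s * X $ r $ k else 0)" for X r s
    proof -
      have "X ** R = transpose (col_mat UNIV k (\<lambda>s. - B $ k $ s) ** transpose X)"
        by (simp add: R_def matrix_transpose_mul)
      then show ?thesis by (simp add: transpose_def col_mat_mult)
    qed
    have "cleared (- S) (C ** B ** R)"
      unfolding cleared_def
    proof (intro ballI conjI allI impI)
      fix r assume r: "r \<in> - S"
      have z: "r \<noteq> k \<Longrightarrow> r \<noteq> l \<Longrightarrow> B $ r $ l = 0 \<and> B $ l $ r = 0" for l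
        using B(1) r unfolding cleared_def by auto
      have d: "B $ r $ r = 1" using B r unfolding cleared_def by (cases "r = k") auto
      show "(C ** B ** R) $ r $ r = 1" using B(2) z d by (simp add: R1 C1)
      fix l assume "l \<noteq> r"
      then show "(C ** B ** R) $ r $ l = 0" "(C ** B ** R) $ l $ r = 0"
        using B(2) z d by (auto simp: R1 C1)
    qed
    moreover have "det (C ** B ** R) = 1"
      using insert.prems(1) CR E(1) by (simp add: det_mul B_def elem_gen_det)
    ultimately obtain F F' where F: "F \<in> elem_gen" "F' \<in> elem_gen" "F ** (C ** B ** R) ** F' = mat 1"
      using insert.IH by blast
    have "(F ** C ** E) ** A ** (R ** F') = mat 1" using F(3) by (simp add: B_def matrix_mul_assoc)
    then show ?thesis using F CR E(1) elem_gen_mult by metis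
  qed
qed

theorem SL_elem_gen:
  fixes A :: "'a::field^'n^'n"
  assumes "det A = 1"
  shows "A \<in> elem_gen"
proof -
  obtain E E' where E: "E \<in> elem_gen" "E' \<in> elem_gen" "E ** A ** E' = mat 1"
    using elem_gen_reduction[of UNIV A] assms by (auto simp: cleared_def)
  obtain F F' where F: "F \<in> elem_gen" "F ** E = mat 1" "F' \<in> elem_gen" "F' ** E' = mat 1"
    using elem_gen_inverse E by metis
  have "E' ** F' = mat 1" using F(4) by (rule matrix_inverse_comm)
  then have "F ** (E ** A ** E') ** F' = A"
    using F(2) by (metis matrix_mul_assoc matrix_mul_lid matrix_mul_rid)
  then have "A = F ** F'" using E(3) by simp
  then show ?thesis using F elem_gen_mult by simp
qed

section \<open>Simultaneous diagonalization of matrices with cube one\<close>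

lemma cube_root_of_unity:
  obtains \<zeta> :: "'a::alg_closed_field" where "\<zeta> * \<zeta> = - 1 - \<zeta>"
proof -
  obtain z :: 'a where "poly [:1, 1, 1:] z = 0" using alg_closed_imp_poly_has_root[of "[:1,1,1:]"] by auto
  then have "z * z = - 1 - z" by (simp add: algebra_simps) (simp add: eq_neg_iff_add_eq_0 algebra_simps)
  then show ?thesis using that by blast
qed

text \<open>Up to the factor three, the vectors \<open>w\<close> below are the components of
  \<open>v\<close> for the eigenvalues 1, \<zeta> and \<zeta>^2 = - 1 - \<zeta> of the newly added
  matrix. They remain eigenvectors of the matrices treated before because these commute with the new
  one.\<close>

lemma simultaneous_eigenvectors_span:
  fixes \<M> :: "('a::alg_closed_field^'n^'n) set"
  assumes "(3::'a) \<noteq> 0" "finite \<M>"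
    and "\<And>A B. A \<in> \<M> \<Longrightarrow> B \<in> \<M> \<Longrightarrow> A ** B = B ** A" "\<And>A. A \<in> \<M> \<Longrightarrow> A ** A ** A = mat 1"
  shows "vec.span {v. \<forall>A\<in>\<M>. \<exists>c. A *v v = c *s v} = UNIV"
  using assms(2-)
proof (induction \<M> rule: finite_induct)
  case empty then show ?case by simp
next
  case (insert A \<M>)
  let ?E = "\<lambda>\<M>. {v. \<forall>A\<in>\<M>. \<exists>c. A *v v = c *s v}"
  obtain \<zeta> :: 'a where z: "\<zeta> * \<zeta> = - 1 - \<zeta>" by (rule cube_root_of_unity)
  have "?E \<M> \<subseteq> vec.span (?E (insert A \<M>))"
  proof
    fix v assume v: "v \<in> ?E \<M>"
    define w where "w a b = v + a *s (A *v v) + b *s (A *v (A *v v))" for a b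
    have A3: "A *v (A *v (A *v v)) = v"
      using insert.prems(2)[of A] by (simp add: matrix_vector_mul_assoc matrix_mul_assoc)
    have zz: "\<zeta> * (\<zeta> * x) = - x - \<zeta> * x" for x
      using z by (metis left_diff_distrib minus_diff_eq mult.assoc mult_minus1 mult_1 minus_mult_left)
    have Aw: "A *v w a b = A *v v + a *s (A *v (A *v v)) + b *s v" for a b
      by (simp add: w_def matrix_vector_right_distrib vector_scalar_commute A3)
    have e: "A *v w 1 1 = 1 *s w 1 1" "A *v w (- 1 - \<zeta>) \<zeta> = \<zeta> *s w (- 1 - \<zeta>) \<zeta>"
      "A *v w \<zeta> (- 1 - \<zeta>) = (- 1 - \<zeta>) *s w \<zeta> (- 1 - \<zeta>)"
      by (simp_all only: Aw) (auto simp: w_def vec_eq_iff algebra_simps z zz)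
    have BA: "B *v (A *v v) = c *s (A *v v)" if "B \<in> \<M>" "B *v v = c *s v" for B c
      using insert.prems(1)[of A B] that by (metis insertCI matrix_vector_mul_assoc vector_scalar_commute)
    have Bw: "\<exists>c. B *v w a b = c *s w a b" if B: "B \<in> \<M>" for a b B
    proof -
      obtain c where c: "B *v v = c *s v" using v B by auto
      have 1: "B *v (A *v v) = c *s (A *v v)" by (rule BA[OF that c])
      have 2: "B *v (A *v (A *v v)) = c *s (A *v (A *v v))"
        using insert.prems(1)[of A B] that 1 by (metis insertCI matrix_vector_mul_assoc vector_scalar_commute)
      show ?thesis
        by (rule exI[of _ c]) (simp add: w_def matrix_vector_right_distrib vector_scalar_commute c 1 2 vec_eq_iff algebra_simps)
    qed
    have wE: "w 1 1 \<in> ?E (insert A \<M>)" "w (- 1 - \<zeta>) \<zeta> \<in> ?E (insert A \<M>)" "w \<zeta> (- 1 - \<zeta>) \<in> ?E (insert A \<M>)"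
      using e Bw by blast+
    \<comment> \<open>The coefficients of \<open>A *v v\<close> add up to zero, and so do those of
      \<open>A *v (A *v v)\<close>; only three copies of \<open>v\<close> remain.\<close>
    have "inverse 3 *s (w 1 1 + w (- 1 - \<zeta>) \<zeta> + w \<zeta> (- 1 - \<zeta>)) = v"
      using assms(1) by (simp add: w_def vec_eq_iff field_simps)
    moreover have "inverse 3 *s (w 1 1 + w (- 1 - \<zeta>) \<zeta> + w \<zeta> (- 1 - \<zeta>)) \<in> vec.span (?E (insert A \<M>))"
      by (intro vec.span_scale vec.span_add vec.span_base wE)
    ultimately show "v \<in> vec.span (?E (insert A \<M>))" by simp
  qed
  then have "vec.span (?E \<M>) \<subseteq> vec.span (?E (insert A \<M>))" by (rule vec.span_minimal) (rule vec.subspace_span)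
  then show ?case using insert by auto
qed

lemma simultaneous_diagonalization:
  fixes \<M> :: "('a::alg_closed_field^'n^'n) set"
  assumes "(3::'a) \<noteq> 0" "finite \<M>"
    and "\<And>A B. A \<in> \<M> \<Longrightarrow> B \<in> \<M> \<Longrightarrow> A ** B = B ** A" "\<And>A. A \<in> \<M> \<Longrightarrow> A ** A ** A = mat 1"
  obtains P where "det P \<noteq> 0" "\<And>A. A \<in> \<M> \<Longrightarrow> diagonal_mat (matrix_inv P ** A ** P)"
proof -
  obtain P :: "'a^'n^'n" where P: "det P \<noteq> 0" "\<And>j. column j P \<in> {v. \<forall>A\<in>\<M>. \<exists>c. A *v v = c *s v}"
    using spanning_set_matrix[OF simultaneous_eigenvectors_span[OF assms]] by blast
  have "diagonal_mat (matrix_inv P ** A ** P)" if "A \<in> \<M>" for A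
  proof -
    have "\<forall>j. \<exists>c. A *v column j P = c *s column j P" using P(2) that by blast
    then obtain c where c: "\<And>j. A *v column j P = c j *s column j P" by metis
    have "A ** P = P ** diag_mat c"
    proof -
      have "(A ** P) $ i $ j = (A *v column j P) $ i" for i j
        by (simp add: matrix_vector_mult_def matrix_matrix_mult_def column_def)
      then show ?thesis using c by (simp add: vec_eq_iff diag_mat_mult_right column_def mult.commute)
    qed
    then have "matrix_inv P ** A ** P = diag_mat c"
      using matrix_inv_det[OF P(1)] by (metis matrix_mul_assoc matrix_mul_lid)
    then show ?thesis by simp
  qed
  then show ?thesis using that P by blast
qed

section \<open>Automorphisms of SL: diagonal and root subgroups\<close>

lemma numeral_neq_0_char_0: "CHAR('a::field) = 0 \<Longrightarrow> (numeral n :: 'a) \<noteq> 0"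
  using of_nat_eq_0_iff_char_dvd[where 'a='a, of "numeral n"] by simp

definition SL :: "('a::field^'n^'n) set" where
  "SL = {A. det A = 1}"

lemma SL_closed: "A \<in> SL \<Longrightarrow> B \<in> SL \<Longrightarrow> A ** B \<in> SL" "mat 1 \<in> SL"
  by (simp_all add: SL_def det_mul det_I)

lemma SL_cancel:
  "A \<in> SL \<Longrightarrow> A ** B = A ** C \<Longrightarrow> B = C" "A \<in> SL \<Longrightarrow> B ** A = C ** A \<Longrightarrow> B = C"
  using matrix_left_cancel[of A B C] matrix_right_cancel[of A B C] by (auto simp: SL_def)

lemma elem_mat_SL: "i \<noteq> j \<Longrightarrow> elem_mat i j a \<in> SL"
  by (simp add: SL_def det_elem_mat)

lemma matrix_inv_SL: "A \<in> SL \<Longrightarrow> matrix_inv A \<in> SL"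
  using matrix_inv_det[of A] det_mul[of A "matrix_inv A"] by (simp add: SL_def det_I)

locale sl_automorphism =
  fixes g :: "'a::alg_closed_field^'n^'n \<Rightarrow> 'a^'n^'n"
  assumes char0: "CHAR('a) = 0" and card2: "CARD('n) \<ge> 2"
    and bij: "bij_betw g SL SL" and hom: "\<And>A B. A \<in> SL \<Longrightarrow> B \<in> SL \<Longrightarrow> g (A ** B) = g A ** g B"
begin

lemma g_SL: "A \<in> SL \<Longrightarrow> g A \<in> SL"
  using bij by (auto simp: bij_betw_def)

lemma g_inj: "A \<in> SL \<Longrightarrow> B \<in> SL \<Longrightarrow> g A = g B \<Longrightarrow> A = B"
  using bij by (auto simp: bij_betw_def inj_on_def)

lemma g_surj: "B \<in> SL \<Longrightarrow> \<exists>A\<in>SL. g A = B"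
  using bij unfolding bij_betw_def by (metis imageE)

lemma g_one: "g (mat 1) = mat 1"
proof -
  have "g (mat 1) ** g (mat 1) = g (mat 1) ** mat 1" using hom[OF SL_closed(2) SL_closed(2)] by simp
  then show ?thesis using SL_cancel(1)[OF g_SL[OF SL_closed(2)]] by blast
qed

lemma g_comm: "A \<in> SL \<Longrightarrow> B \<in> SL \<Longrightarrow> A ** B = B ** A \<longleftrightarrow> g A ** g B = g B ** g A"
  using g_inj[of "A ** B" "B ** A"] hom SL_closed by metis

lemma ex_other: "\<exists>j. j \<noteq> (i::'n)"
proof (rule ccontr)
  assume "\<nexists>j. j \<noteq> i"
  then have "(UNIV :: 'n set) = {i}" by auto
  then have "CARD('n) = 1" by (metis card_1_singleton_iff One_nat_def)
  then show False using card2 by simp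
qed

lemma conjugate:
  assumes "det P \<noteq> 0"
  shows "sl_automorphism (\<lambda>A. matrix_inv P ** g A ** P)"
proof -
  note I = matrix_inv_det[OF assms]
  have d: "det (matrix_inv P) * det P = 1" using I(2) by (metis det_I det_mul)
  then have SLiff: "matrix_inv P ** B ** P \<in> SL \<longleftrightarrow> B \<in> SL" for B
    by (simp add: SL_def det_mul mult.commute mult.left_commute)
  have bwd: "P ** (matrix_inv P ** B ** P) ** matrix_inv P = B" for B
    using I by (metis matrix_mul_assoc matrix_mul_lid matrix_mul_rid)
  have fwd: "matrix_inv P ** (P ** B ** matrix_inv P) ** P = B" for B
    using I by (metis matrix_mul_assoc matrix_mul_lid matrix_mul_rid)
  show ?thesis
  proof
    show "bij_betw (\<lambda>A. matrix_inv P ** g A ** P) SL SL"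
      unfolding bij_betw_def
    proof (intro conjI inj_onI equalityI subsetI)
      fix A B assume "A \<in> SL" "B \<in> SL" "matrix_inv P ** g A ** P = matrix_inv P ** g B ** P"
      then show "A = B" using bwd g_inj by metis
    next
      fix B assume "B \<in> (\<lambda>A. matrix_inv P ** g A ** P) ` SL"
      then show "B \<in> SL" using SLiff g_SL by auto
    next
      fix B :: "'a^'n^'n" assume B: "B \<in> SL"
      then have "P ** B ** matrix_inv P \<in> SL" using SLiff[of "P ** B ** matrix_inv P"] fwd by simp
      then obtain A where "A \<in> SL" "g A = P ** B ** matrix_inv P" using g_surj by blast
      then show "B \<in> (\<lambda>A. matrix_inv P ** g A ** P) ` SL" using fwd[of B] by (metis imageI)
    qed
    fix A B :: "'a^'n^'n" assume "A \<in> SL" "B \<in> SL"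
    then show "matrix_inv P ** g (A ** B) ** P = matrix_inv P ** g A ** P ** (matrix_inv P ** g B ** P)"
      using I hom by (metis matrix_mul_assoc matrix_mul_lid)
  qed (rule char0 card2)+
qed

text \<open>Composition with inverse transpose exchanges the roles of rows and columns, which
  reduces the second type of automorphism to the first.\<close>

lemma contragredient: "sl_automorphism (\<lambda>A. transpose (matrix_inv (g A)))"
proof -
  have inv: "g A ** matrix_inv (g A) = mat 1" "matrix_inv (g A) ** g A = mat 1" if "A \<in> SL" for A
    using matrix_inv_det[of "g A"] g_SL[OF that] by (auto simp: SL_def)
  have tSL: "transpose B \<in> SL \<longleftrightarrow> B \<in> SL" for B :: "'a^'n^'n" by (simp add: SL_def det_transpose)
  show ?thesis
  proof
    show "bij_betw (\<lambda>A. transpose (matrix_inv (g A))) SL SL"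
      unfolding bij_betw_def
    proof (intro conjI inj_onI equalityI subsetI)
      fix A B assume AB: "A \<in> SL" "B \<in> SL" "transpose (matrix_inv (g A)) = transpose (matrix_inv (g B))"
      then have "matrix_inv (g A) = matrix_inv (g B)" by (metis transpose_transpose)
      then have "g A = g B"
        using inv(2) AB SL_cancel(1)[OF matrix_inv_SL[OF g_SL[OF AB(1)]]] by metis
      then show "A = B" using g_inj AB by blast
    next
      fix B assume "B \<in> (\<lambda>A. transpose (matrix_inv (g A))) ` SL"
      then show "B \<in> SL" using g_SL matrix_inv_SL tSL by auto
    next
      fix B :: "'a^'n^'n" assume B: "B \<in> SL"
      then obtain A where A: "A \<in> SL" "g A = matrix_inv (transpose B)" using g_surj matrix_inv_SL tSL by metis
      have "matrix_inv (transpose B) ** transpose B = mat 1"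
        using B tSL[of B] matrix_inv_det(2)[of "transpose B"] by (auto simp: SL_def)
      then have "matrix_inv (g A) = transpose B"
        using inv(1)[OF A(1)] A(2) SL_cancel(1)[OF g_SL[OF A(1)]] by metis
      then show "B \<in> (\<lambda>A. transpose (matrix_inv (g A))) ` SL"
        using A(1) by (intro image_eqI[of _ _ A]) simp_all
    qed
    fix A B :: "'a^'n^'n" assume AB: "A \<in> SL" "B \<in> SL"
    have "g (A ** B) ** (matrix_inv (g B) ** matrix_inv (g A)) = g A ** (g B ** matrix_inv (g B)) ** matrix_inv (g A)"
      using hom[OF AB] by (simp add: matrix_mul_assoc)
    also have "\<dots> = g (A ** B) ** matrix_inv (g (A ** B))" using inv(1) AB SL_closed(1)[OF AB] by simp
    finally have "matrix_inv (g (A ** B)) = matrix_inv (g B) ** matrix_inv (g A)"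
      using SL_cancel(1)[OF g_SL[OF SL_closed(1)[OF AB]]] by metis
    then show "transpose (matrix_inv (g (A ** B))) = transpose (matrix_inv (g A)) ** transpose (matrix_inv (g B))"
      by (simp add: matrix_transpose_mul)
  qed (rule char0 card2)+
qed

end

lemma commute_diag_iff:
  assumes "diagonal_mat D"
  shows "D ** A = A ** D \<longleftrightarrow> (\<forall>k l. A $ k $ l \<noteq> 0 \<longrightarrow> D $ k $ k = D $ l $ l)"
proof -
  have D: "D = diag_mat (\<lambda>i. D $ i $ i)" by (rule diagonal_matD[OF assms])
  have "(D ** A) $ k $ l = D $ k $ k * A $ k $ l" "(A ** D) $ k $ l = A $ k $ l * D $ l $ l" for k l
    by (subst D, rule diag_mat_mult_left, subst D, rule diag_mat_mult_right)
  then show ?thesis by (simp add: vec_eq_iff) (metis mult.commute mult_left_cancel mult_zero_left mult_zero_right)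
qed

lemma diagonal_commute: "diagonal_mat D \<Longrightarrow> diagonal_mat A \<Longrightarrow> D ** A = A ** D"
  by (subst commute_diag_iff) (auto simp: diagonal_mat_def, metis)

lemma commute_diag_elem_iff:
  assumes "diagonal_mat D" "i \<noteq> j" "a \<noteq> 0"
  shows "D ** elem_mat i j a = elem_mat i j a ** D \<longleftrightarrow> D $ i $ i = D $ j $ j"
  using assms by (auto simp: commute_diag_iff elem_mat_nth)

definition diag2 :: "'n \<Rightarrow> 'n \<Rightarrow> 'a \<Rightarrow> 'a::field^'n^'n" where
  "diag2 i j s = diag_mat (\<lambda>r. if r = i then s else if r = j then inverse s else 1)"

lemma diag2_SL:
  assumes "i \<noteq> j" "s \<noteq> 0" shows "diag2 i j s \<in> SL"
proof -
  have "(\<Prod>r\<in>UNIV. if r = i then s else if r = j then inverse s else 1)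
    = s * (\<Prod>r\<in>UNIV - {i}. if r = i then s else if r = j then inverse s else 1)"
    by (simp add: prod.remove[of _ i])
  also have "(\<Prod>r\<in>UNIV - {i}. if r = i then s else if r = j then inverse s else 1)
    = (\<Prod>r\<in>UNIV - {i}. if r = j then inverse s else 1)" by (intro prod.cong) auto
  also have "\<dots> = inverse s" using assms by (simp add: prod.delta)
  finally show ?thesis using assms by (simp add: SL_def diag2_def det_diag_mat)
qed

lemma diag2_diagonal [simp]: "diagonal_mat (diag2 i j s)" by (simp add: diag2_def)

lemma diag2_nth: "diag2 i j s $ r $ r = (if r = i then s else if r = j then inverse s else 1)"
  by (simp add: diag2_def diag_mat_nth)

lemma diag_mat_elem_conj:
  assumes "i \<noteq> j" "t j \<noteq> 0"
  shows "diag_mat t ** elem_mat i j a = elem_mat i j (t i / t j * a) ** diag_mat t"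
proof -
  have "t k * elem_mat i j a $ k $ l = elem_mat i j (t i / t j * a) $ k $ l * t l" for k l
    using assms by (auto simp: elem_mat_nth)
  then show ?thesis by (simp add: vec_eq_iff diag_mat_mult_left diag_mat_mult_right)
qed

lemma diagonal_elem_conj:
  assumes "diagonal_mat D" "i \<noteq> j" "D $ j $ j \<noteq> 0"
  shows "D ** elem_mat i j a = elem_mat i j (D $ i $ i / D $ j $ j * a) ** D"
  using diag_mat_elem_conj[of i j "\<lambda>r. D $ r $ r" a] diagonal_matD[OF assms(1)] assms(2,3) by simp

lemma diagonal_SL_nonzero:
  assumes "diagonal_mat A" "A \<in> SL"
  shows "A $ r $ r \<noteq> 0"
proof
  assume "A $ r $ r = 0"
  then have "A $ r $ s = 0" for s using assms(1) unfolding diagonal_mat_def by (cases "s = r") auto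
  then have "row r A = 0" by (simp add: row_def vec_eq_iff)
  then show False using det_zero_row(2)[of r A] assms(2) by (simp add: SL_def)
qed

locale sl_automorphism_diag = sl_automorphism g
  for g :: "'a::alg_closed_field^'n^'n \<Rightarrow> 'a^'n^'n" +
  assumes diag: "\<And>A. A \<in> SL \<Longrightarrow> diagonal_mat (g A) \<longleftrightarrow> diagonal_mat A"
begin

lemma diag_surj: "B \<in> SL \<Longrightarrow> diagonal_mat B \<Longrightarrow> \<exists>A\<in>SL. diagonal_mat A \<and> g A = B"
  using g_surj diag by blast

text \<open>The test matrix has the entry 2 everywhere except at one index of the second pair
  outside the first, where determinant one forces 2^(-(n-1)). Equality of the two values would give
  2^n = 1.\<close>

lemma root_pair_eq:
  fixes i j i' j' :: 'n
  assumes ij: "i \<noteq> j" "i' \<noteq> j'"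
    and imp: "\<And>A::'a^'n^'n. A \<in> SL \<Longrightarrow> diagonal_mat A \<Longrightarrow> A $ i $ i = A $ j $ j \<Longrightarrow> A $ i' $ i' = A $ j' $ j'"
  shows "{i, j} = {i', j'}"
proof (rule ccontr)
  assume "{i, j} \<noteq> {i', j'}"
  then obtain x where x: "x \<in> {i', j'}" "x \<notin> {i, j}" using ij by blast
  define t :: "'n \<Rightarrow> 'a" where "t r = (if r = x then inverse (2 ^ (CARD('n) - 1)) else 2)" for r
  have two: "(2::'a) \<noteq> 0" by (rule numeral_neq_0_char_0[OF char0])
  have "(\<Prod>r\<in>UNIV. t r) = t x * (\<Prod>r\<in>UNIV - {x}. t r)" by (simp add: prod.remove[of _ x])
  also have "(\<Prod>r\<in>UNIV - {x}. t r) = (\<Prod>r\<in>UNIV - {x}. 2)" by (intro prod.cong) (auto simp: t_def)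
  also have "\<dots> = 2 ^ (CARD('n) - 1)" by simp
  finally have "diag_mat t \<in> SL" using two by (simp add: SL_def det_diag_mat t_def)
  moreover have "diag_mat t $ i $ i = diag_mat t $ j $ j" using x by (auto simp: diag_mat_nth t_def)
  ultimately have "t i' = t j'" using imp[of "diag_mat t"] by (simp add: diag_mat_nth)
  then have "inverse (2 ^ (CARD('n) - 1)) = (2::'a)" using x ij by (auto simp: t_def split: if_splits)
  then have "(2::'a) ^ CARD('n) = 1" using two card2 by (simp add: field_simps power_eq_if[of _ "CARD('n)"])
  then have "(of_nat (2 ^ CARD('n) - 1) :: 'a) = 0" by (simp add: of_nat_diff)
  then have "2 ^ CARD('n) - 1 = (0::nat)" using of_nat_eq_0_iff_char_dvd[where 'a='a] char0 by (metis dvd_0_left_iff)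
  moreover have "(2::nat) ^ CARD('n) \<ge> 2 ^ 1" using card2 by (intro power_increasing) auto
  ultimately show False by simp
qed

text \<open>Commutation with diagonal matrices confines the off-diagonal entries of the image
  \<open>h\<close> to one pair {k, l}. Commutation of \<open>h\<close> with its diagonal conjugates
  excludes the entry opposite to (k, l), and being diagonally conjugate to its square gives
  \<open>h\<close> ones on the diagonal.\<close>

lemma elem_image:
  fixes i j :: 'n
  assumes ij: "i \<noteq> j"
  shows "\<exists>k l b. k \<noteq> l \<and> b \<noteq> 0 \<and> g (elem_mat i j 1) = elem_mat k l b"
proof -
  define u where "u = (elem_mat i j 1 :: 'a^'n^'n)"
  define h where "h = g u"
  have uSL: "u \<in> SL" using ij by (simp add: u_def elem_mat_SL)
  have hSL: "h \<in> SL" using g_SL uSL by (simp add: h_def)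
  have "\<not> diagonal_mat u" using ij by (auto simp: u_def diagonal_mat_def elem_mat_nth intro!: exI[of _ i] exI[of _ j])
  then have "\<not> diagonal_mat h" using diag[OF uSL] by (simp add: h_def)
  then obtain k l where kl: "k \<noteq> l" "h $ k $ l \<noteq> 0" by (auto simp: diagonal_mat_def)
  have imp1: "g A $ r $ r = g A $ s $ s" if "A \<in> SL" "diagonal_mat A" "A $ i $ i = A $ j $ j" "h $ r $ s \<noteq> 0" for A r s
  proof -
    have "A ** u = u ** A" using that ij by (simp add: u_def commute_diag_elem_iff)
    then have "g A ** h = h ** g A" using g_comm[OF that(1) uSL] by (simp add: h_def)
    then show ?thesis using commute_diag_iff[of "g A" h] diag that by blast
  qed
  \<comment> \<open>The preimage of an elementary matrix at (k, l) provides the implication in the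
    opposite direction.\<close>
  obtain w where w: "w \<in> SL" "g w = elem_mat k l 1" using g_surj elem_mat_SL[OF kl(1)] by metis
  have "\<not> diagonal_mat (g w)" using kl(1) by (auto simp: w diagonal_mat_def elem_mat_nth intro!: exI[of _ k] exI[of _ l])
  then have "\<not> diagonal_mat w" using diag w by blast
  then obtain i' j' where ij': "i' \<noteq> j'" "w $ i' $ j' \<noteq> 0" by (auto simp: diagonal_mat_def)
  have imp2: "A $ i' $ i' = A $ j' $ j'" if "A \<in> SL" "diagonal_mat A" "g A $ k $ k = g A $ l $ l" for A
  proof -
    have "diagonal_mat (g A)" using that diag by blast
    then have "g A ** g w = g w ** g A" using that kl(1) by (simp add: w commute_diag_elem_iff)
    then have "A ** w = w ** A" using g_comm[OF that(1) w(1)] by simp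
    then show ?thesis using commute_diag_iff[OF that(2)] ij' by blast
  qed
  have "{i, j} = {i', j'}"
    using imp1 imp2 kl by (intro root_pair_eq[OF ij ij'(1)]) blast
  then have imp3: "A $ i $ i = A $ j $ j" if "A \<in> SL" "diagonal_mat A" "g A $ k $ k = g A $ l $ l" for A
    using imp2[OF that] by (auto simp: doubleton_eq_iff)
  have supp: "{k, l} = {r, s}" if rs: "r \<noteq> s" "h $ r $ s \<noteq> 0" for r s
  proof (rule root_pair_eq[OF kl(1) rs(1)])
    fix B :: "'a^'n^'n" assume B: "B \<in> SL" "diagonal_mat B" "B $ k $ k = B $ l $ l"
    then obtain A where "A \<in> SL" "diagonal_mat A" "g A = B" using diag_surj by blast
    then show "B $ r $ r = B $ s $ s" using imp1[OF _ _ imp3] rs B by metis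
  qed
  have conj: "\<exists>x. g x ** g A = g A ** h \<and> (\<exists>a. x = elem_mat i j a)" if A: "A \<in> SL" "diagonal_mat A" for A
  proof -
    have Ajj: "A $ j $ j \<noteq> 0" by (rule diagonal_SL_nonzero[OF A(2,1)])
    define a where "a = A $ i $ i / A $ j $ j"
    have "A ** u = elem_mat i j a ** A"
      using diagonal_elem_conj[OF A(2) ij Ajj, of 1] by (simp add: u_def a_def)
    then have "g A ** h = g (elem_mat i j a) ** g A"
      using hom A(1) uSL elem_mat_SL[OF ij] unfolding h_def by metis
    then show ?thesis by metis
  qed
  have ent: "g x $ r $ s * g A $ s $ s = g A $ r $ r * h $ r $ s"
    if "g x ** g A = g A ** h" "diagonal_mat (g A)" for x A r s
  proof -
    have D: "g A = diag_mat (\<lambda>i. g A $ i $ i)" by (rule diagonal_matD[OF that(2)])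
    have "(g x ** g A) $ r $ s = g x $ r $ s * g A $ s $ s" by (subst D) (rule diag_mat_mult_right)
    moreover have "(g A ** h) $ r $ s = g A $ r $ r * h $ r $ s" by (subst D) (rule diag_mat_mult_left)
    ultimately show ?thesis using that(1) by simp
  qed
  \<comment> \<open>Conjugation by \<open>diag2 k l 2\<close> scales the entry at (k, l) by 4 and
    the one at (l, k) by 1/4. On the other side the conjugate stays in the root subgroup of
    \<open>u\<close>, so its image commutes with \<open>h\<close>; one diagonal entry of this
    equation gives \<open>15 * h $ l $ k = 0\<close>.\<close>
  have hlk: "h $ l $ k = 0"
  proof -
    have two: "(2::'a) \<noteq> 0" by (rule numeral_neq_0_char_0[OF char0])
    obtain A where A: "A \<in> SL" "diagonal_mat A" "g A = diag2 k l 2"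
      using diag_surj[OF diag2_SL[OF kl(1) two]] by auto
    obtain x a where x: "g x ** g A = g A ** h" "x = elem_mat i j a" using conj[OF A(1,2)] by blast
    have e: "g x $ r $ s * g A $ s $ s = g A $ r $ r * h $ r $ s" for r s
      using ent[OF x(1)] A by simp
    have xk: "g x $ k $ k = h $ k $ k" "g x $ k $ l = 4 * h $ k $ l" "g x $ l $ k = h $ l $ k / 4"
      using e[of k k] e[of k l] e[of l k] kl(1) two numeral_neq_0_char_0[OF char0, of "Num.Bit0 (Num.Bit0 Num.One)"]
      by (simp_all add: A(3) diag2_nth field_simps)
    have "x ** u = u ** x" using ij by (simp add: x(2) u_def elem_mat_add add.commute)
    then have c: "g x ** h = h ** g x" using g_comm[OF _ uSL, of x] elem_mat_SL[OF ij] x(2) unfolding h_def by metis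
    have hz: "h $ r $ k = 0" "h $ k $ r = 0" if "r \<noteq> k" "r \<noteq> l" for r
      using supp[of r k] supp[of k r] that by (auto simp: doubleton_eq_iff)
    have 1: "(h ** B) $ k $ k = h $ k $ k * B $ k $ k + h $ k $ l * B $ l $ k" for B :: "'a^'n^'n"
    proof -
      have "(h ** B) $ k $ k = (\<Sum>r\<in>UNIV. h $ k $ r * B $ r $ k)" by (simp add: matrix_matrix_mult_def)
      also have "\<dots> = (\<Sum>r\<in>{k, l}. h $ k $ r * B $ r $ k)"
        using hz by (intro sum.mono_neutral_right) auto
      finally show ?thesis using kl(1) by simp
    qed
    have 2: "(B ** h) $ k $ k = B $ k $ k * h $ k $ k + B $ k $ l * h $ l $ k" for B :: "'a^'n^'n"
    proof -
      have "(B ** h) $ k $ k = (\<Sum>r\<in>UNIV. B $ k $ r * h $ r $ k)" by (simp add: matrix_matrix_mult_def)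
      also have "\<dots> = (\<Sum>r\<in>{k, l}. B $ k $ r * h $ r $ k)"
        using hz by (intro sum.mono_neutral_right) auto
      finally show ?thesis using kl(1) by simp
    qed
    have "h $ k $ l * (h $ l $ k / 4) = h $ k $ l * (4 * h $ l $ k)"
      using 1[of "g x"] 2[of "g x"] c xk by (simp add: mult.commute mult.left_commute)
    then have "h $ l $ k / 4 = 4 * h $ l $ k" using mult_left_cancel[OF kl(2)] by blast
    then have "4 * (h $ l $ k / 4) = 4 * (4 * h $ l $ k)" by (rule arg_cong)
    then have "h $ l $ k = 16 * h $ l $ k"
      using numeral_neq_0_char_0[OF char0, of "Num.Bit0 (Num.Bit0 Num.One)"] by simp
    moreover have "15 * h $ l $ k = 16 * h $ l $ k - h $ l $ k" by simp
    ultimately have "15 * h $ l $ k = 0" by (metis right_minus_eq)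
    then show ?thesis using numeral_neq_0_char_0[OF char0] by simp
  qed
  have off: "h $ r $ s = 0" if "r \<noteq> s" "\<not> (r = k \<and> s = l)" for r s
    using supp[OF that(1)] hlk that by (auto simp: doubleton_eq_iff)
  \<comment> \<open>With \<open>s ^ 2 = 2\<close>, conjugation by \<open>diag2 i j s\<close> squares
    \<open>u\<close>. Its image is diagonal and so leaves diagonal entries unchanged, whence those
    of \<open>h\<close> are idempotent.\<close>
  have dg: "h $ r $ r = 1" for r
  proof -
    have "\<exists>s::'a. s ^ 2 = 2" using nth_root_exists[of 2 "2::'a"] by simp
    then obtain s :: 'a where s: "s ^ 2 = 2" by blast
    then have s0: "s \<noteq> 0" using numeral_neq_0_char_0[OF char0, of "Num.Bit0 Num.One"] by auto
    let ?A = "diag2 i j s :: 'a^'n^'n"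
    have ASL: "?A \<in> SL" by (rule diag2_SL[OF ij s0])
    have "?A ** u = (u ** u) ** ?A"
      using diagonal_elem_conj[of ?A i j 1] ij s s0
      by (simp add: u_def elem_mat_add[OF ij] diag2_nth power2_eq_square divide_inverse)
    then have "g (u ** u) ** g ?A = g ?A ** h" using hom ASL uSL SL_closed unfolding h_def by metis
    moreover have "diagonal_mat (g ?A)" using diag[OF ASL] by simp
    ultimately have "g (u ** u) $ r $ r * g ?A $ r $ r = g ?A $ r $ r * h $ r $ r" by (rule ent)
    moreover have "g ?A $ r $ r \<noteq> 0" by (rule diagonal_SL_nonzero[OF \<open>diagonal_mat (g ?A)\<close> g_SL[OF ASL]])
    ultimately have "(h ** h) $ r $ r = h $ r $ r" using hom[OF uSL uSL] by (simp add: h_def)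
    moreover have "(h ** h) $ r $ r = (\<Sum>s\<in>UNIV. h $ r $ s * h $ s $ r)" by (simp add: matrix_matrix_mult_def)
    moreover have "\<dots> = (\<Sum>s\<in>{r}. h $ r $ s * h $ s $ r)"
    proof (rule sum.mono_neutral_right)
      show "\<forall>s\<in>UNIV - {r}. h $ r $ s * h $ s $ r = 0"
        using off kl(1) by (metis DiffD2 insertI1 mult_eq_0_iff)
    qed auto
    ultimately have "h $ r $ r * h $ r $ r = h $ r $ r" by simp
    \<comment> \<open>The only off-diagonal entry sits in row \<open>k\<close>; so a zero would make
      column \<open>r\<close> vanish if \<open>r = k\<close>, and row \<open>r\<close>
      otherwise.\<close>
    moreover have "h $ r $ r \<noteq> 0"
    proof
      assume 0: "h $ r $ r = 0"
      show False
      proof (cases "r = k")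
        case True
        have "h $ s $ r = 0" for s using off[of s r] 0 True kl(1) by (cases "s = r") auto
        then have "column r h = 0" by (simp add: column_def vec_eq_iff)
        then show False using det_zero_column(2)[of r h] hSL by (simp add: SL_def)
      next
        case False
        have "h $ r $ s = 0" for s using off[of r s] 0 False by (cases "s = r") auto
        then have "row r h = 0" by (simp add: row_def vec_eq_iff)
        then show False using det_zero_row(2)[of r h] hSL by (simp add: SL_def)
      qed
    qed
    ultimately show ?thesis by simp
  qed
  have "h = elem_mat k l (h $ k $ l)"
    using off dg kl(1) by (auto simp: vec_eq_iff elem_mat_nth)
  then show ?thesis using kl unfolding h_def u_def by blast
qed

end

section \<open>Automorphisms of SL: classification\<close>

definition field_hom :: "('a::field \<Rightarrow> 'a) \<Rightarrow> bool" where
  "field_hom f \<longleftrightarrow> f 1 = 1 \<and> (\<forall>x y. f (x + y) = f x + f y \<and> f (x * y) = f x * f y)"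

definition map_mat :: "('a \<Rightarrow> 'a) \<Rightarrow> 'a^'n^'n \<Rightarrow> 'a::field^'n^'n" where
  "map_mat f A = (\<chi> i j. f (A $ i $ j))"

lemma field_homD:
  assumes "field_hom f"
  shows "f 1 = 1" "f (x + y) = f x + f y" "f (x * y) = f x * f y" "f 0 = 0"
proof -
  show *: "f 1 = 1" "f (x + y) = f x + f y" "f (x * y) = f x * f y" using assms by (auto simp: field_hom_def)
  have "f (0 + 0) = f 0 + f 0" using assms unfolding field_hom_def by blast
  then show "f 0 = 0" by (metis add.right_neutral add_left_cancel)
qed

lemma map_mat_mult: "field_hom f \<Longrightarrow> map_mat f (A ** B) = map_mat f A ** map_mat f B"
  by (simp add: map_mat_def matrix_matrix_mult_def vec_eq_iff additive_sum[of f] field_homD)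

lemma map_mat_elem: "field_hom f \<Longrightarrow> map_mat f (elem_mat i j a) = elem_mat i j (f a)"
  by (auto simp: map_mat_def elem_mat_def vec_eq_iff field_homD)

lemma map_mat_1: "field_hom f \<Longrightarrow> map_mat f (mat 1) = mat 1"
  by (auto simp: map_mat_def mat_def vec_eq_iff field_homD)

text \<open>\<open>\<kappa> i j\<close> and \<open>\<mu> i j\<close> are row and column of the root
  subgroup receiving the one at (i, j), and \<open>F i j\<close> is the map of parameters. The value
  at 1 is not normalized; it yields the diagonal part of the conjugating matrix.\<close>

locale sl_root_data = sl_automorphism_diag g
  for g :: "'a::alg_closed_field^'n^'n \<Rightarrow> 'a^'n^'n" +
  fixes \<kappa> \<mu> :: "'n \<Rightarrow> 'n \<Rightarrow> 'n" and F :: "'n \<Rightarrow> 'n \<Rightarrow> 'a \<Rightarrow> 'a"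
  assumes neq: "\<And>i j. i \<noteq> j \<Longrightarrow> \<kappa> i j \<noteq> \<mu> i j" and F1: "\<And>i j. i \<noteq> j \<Longrightarrow> F i j 1 \<noteq> 0"
    and root: "\<And>i j a. i \<noteq> j \<Longrightarrow> g (elem_mat i j a) = elem_mat (\<kappa> i j) (\<mu> i j) (F i j a)"
begin

lemma root_eqD:
  assumes "elem_mat k l a = elem_mat k l b"
  shows "a = b"
  using arg_cong[OF assms, of "\<lambda>M. M $ k $ l"] by (simp add: elem_mat_nth)

lemma F_add:
  assumes "i \<noteq> j" shows "F i j (a + b) = F i j a + F i j b"
proof -
  have "g (elem_mat i j a ** elem_mat i j b) = g (elem_mat i j a) ** g (elem_mat i j b)"
    using assms by (intro hom elem_mat_SL)
  then have "elem_mat (\<kappa> i j) (\<mu> i j) (F i j (a + b)) = elem_mat (\<kappa> i j) (\<mu> i j) (F i j a + F i j b)"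
    using assms neq by (simp add: elem_mat_add root)
  then show ?thesis by (rule root_eqD)
qed

lemma F_0: "i \<noteq> j \<Longrightarrow> F i j 0 = 0"
  using F_add[of i j 0 0] by (metis add.right_neutral add_left_cancel)

lemma F_minus: "i \<noteq> j \<Longrightarrow> F i j (- a) = - F i j a"
  using F_add[of i j a "- a"] F_0[of i j] by (simp add: eq_neg_iff_add_eq_0 add.commute)

lemma F_ratio:
  assumes ij: "i \<noteq> j" and A: "A \<in> SL" "diagonal_mat A"
  shows "g A $ \<kappa> i j $ \<kappa> i j * F i j b = F i j (A $ i $ i / A $ j $ j * b) * g A $ \<mu> i j $ \<mu> i j"
proof -
  have "A ** elem_mat i j b = elem_mat i j (A $ i $ i / A $ j $ j * b) ** A"
    by (rule diagonal_elem_conj[OF A(2) ij diagonal_SL_nonzero[OF A(2,1)]])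
  then have e: "g A ** elem_mat (\<kappa> i j) (\<mu> i j) (F i j b)
      = elem_mat (\<kappa> i j) (\<mu> i j) (F i j (A $ i $ i / A $ j $ j * b)) ** g A"
    using hom A(1) elem_mat_SL[OF ij] root[OF ij] by metis
  have D: "g A = diag_mat (\<lambda>r. g A $ r $ r)" by (rule diagonal_matD) (use A diag in blast)
  have "(g A ** elem_mat (\<kappa> i j) (\<mu> i j) (F i j b)) $ \<kappa> i j $ \<mu> i j = g A $ \<kappa> i j $ \<kappa> i j * F i j b"
    by (subst D) (use neq[OF ij] in \<open>simp add: diag_mat_mult_left elem_mat_nth\<close>)
  moreover have "(elem_mat (\<kappa> i j) (\<mu> i j) c ** g A) $ \<kappa> i j $ \<mu> i j = c * g A $ \<mu> i j $ \<mu> i j" for c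
    by (subst D) (use neq[OF ij] in \<open>simp add: diag_mat_mult_right elem_mat_nth\<close>)
  ultimately show ?thesis using e by metis
qed

lemma ratio_exists:
  fixes i j :: 'n and a :: 'a
  assumes "i \<noteq> j" "a \<noteq> 0"
  obtains A where "A \<in> SL" "diagonal_mat A" "A $ i $ i / A $ j $ j = a"
proof -
  obtain s where s: "s ^ 2 = a" using nth_root_exists[of 2 a] by auto
  then have "s \<noteq> 0" using assms by auto
  then have "diag2 i j s \<in> SL" "(diag2 i j s :: 'a^'n^'n) $ i $ i / diag2 i j s $ j $ j = a"
    using assms s by (auto simp: diag2_SL diag2_nth power2_eq_square divide_inverse)
  then show ?thesis using that diag2_diagonal by blast
qed

text \<open>Every nonzero \<open>a\<close> is a ratio of diagonal entries of a matrix in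
  \<open>SL\<close>, by a square root. Conjugation by it multiplies parameters by \<open>a\<close>
  before \<open>g\<close> is applied and by a fixed factor afterwards.\<close>

lemma F_mult:
  assumes ij: "i \<noteq> j" shows "F i j (a * b) * F i j 1 = F i j a * F i j b"
proof (cases "a = 0")
  case True then show ?thesis using F_0[OF ij] by simp
next
  case False
  obtain A where A: "A \<in> SL" "diagonal_mat A" "A $ i $ i / A $ j $ j = a" using ratio_exists[OF ij False] .
  define x y where "x = g A $ \<kappa> i j $ \<kappa> i j" and "y = g A $ \<mu> i j $ \<mu> i j"
  have 1: "x * F i j c = F i j (a * c) * y" for c using F_ratio[OF ij A(1,2), of c] A(3) by (simp add: x_def y_def)
  have y0: "y \<noteq> 0" unfolding y_def by (rule diagonal_SL_nonzero) (use A diag g_SL in blast)+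
  have "F i j (a * b) * F i j 1 * y = (F i j (a * b) * y) * F i j 1" by simp
  also have "\<dots> = (x * F i j 1) * F i j b" by (simp add: 1[symmetric])
  also have "\<dots> = F i j a * F i j b * y" by (simp add: 1)
  finally show ?thesis using y0 by simp
qed

lemma root_fixed_iff:
  assumes ij: "i \<noteq> j" and A: "A \<in> SL" "diagonal_mat A"
  shows "A $ i $ i = A $ j $ j \<longleftrightarrow> g A $ \<kappa> i j $ \<kappa> i j = g A $ \<mu> i j $ \<mu> i j"
proof -
  have gA: "diagonal_mat (g A)" using A diag by blast
  have "A $ i $ i = A $ j $ j \<longleftrightarrow> A ** elem_mat i j 1 = elem_mat i j 1 ** A"
    by (simp add: commute_diag_elem_iff[OF A(2) ij])
  also have "\<dots> \<longleftrightarrow> g A ** g (elem_mat i j 1) = g (elem_mat i j 1) ** g A"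
    by (rule g_comm[OF A(1) elem_mat_SL[OF ij]])
  also have "\<dots> \<longleftrightarrow> g A $ \<kappa> i j $ \<kappa> i j = g A $ \<mu> i j $ \<mu> i j"
    by (simp add: root[OF ij] commute_diag_elem_iff[OF gA neq[OF ij] F1[OF ij]])
  finally show ?thesis .
qed

lemma root_pair_inj:
  assumes "i \<noteq> j" "i' \<noteq> j'" "{\<kappa> i j, \<mu> i j} = {\<kappa> i' j', \<mu> i' j'}"
  shows "{i, j} = {i', j'}"
proof (rule root_pair_eq[OF assms(1,2)])
  fix A :: "'a^'n^'n" assume A: "A \<in> SL" "diagonal_mat A" "A $ i $ i = A $ j $ j"
  then have "g A $ \<kappa> i j $ \<kappa> i j = g A $ \<mu> i j $ \<mu> i j" using root_fixed_iff[OF assms(1)] by blast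
  then have "g A $ \<kappa> i' j' $ \<kappa> i' j' = g A $ \<mu> i' j' $ \<mu> i' j'" using assms(3) by (auto simp: doubleton_eq_iff)
  then show "A $ i' $ i' = A $ j' $ j'" using root_fixed_iff[OF assms(2)] A by blast
qed

text \<open>The elementary matrices at (i, j) and (j, i) commute with the same diagonal matrices, so
  their images use the same pair of indices; the order must differ because the two do not
  commute.\<close>

lemma root_opposite:
  assumes ij: "i \<noteq> j" shows "\<kappa> j i = \<mu> i j \<and> \<mu> j i = \<kappa> i j"
proof -
  have ji: "j \<noteq> i" using ij by simp
  have "{\<kappa> i j, \<mu> i j} = {\<kappa> j i, \<mu> j i}"
  proof (rule root_pair_eq[OF neq[OF ij] neq[OF ji]])
    fix B :: "'a^'n^'n" assume B: "B \<in> SL" "diagonal_mat B" "B $ \<kappa> i j $ \<kappa> i j = B $ \<mu> i j $ \<mu> i j"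
    then obtain A where A: "A \<in> SL" "diagonal_mat A" "g A = B" using diag_surj by blast
    then have "A $ i $ i = A $ j $ j" using root_fixed_iff[OF ij A(1,2)] B by simp
    then show "B $ \<kappa> j i $ \<kappa> j i = B $ \<mu> j i $ \<mu> j i" using root_fixed_iff[OF ji A(1,2)] A(3) by simp
  qed
  moreover have "\<not> (\<kappa> j i = \<kappa> i j \<and> \<mu> j i = \<mu> i j)"
  proof
    assume e: "\<kappa> j i = \<kappa> i j \<and> \<mu> j i = \<mu> i j"
    have "g (elem_mat i j 1) ** g (elem_mat j i 1) = g (elem_mat j i 1) ** g (elem_mat i j 1)"
      using e neq[OF ij] by (simp add: root ij ji elem_mat_add add.commute)
    then have "elem_mat i j 1 ** elem_mat j i 1 = (elem_mat j i 1 ** elem_mat i j 1 :: 'a^'n^'n)"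
      using g_comm elem_mat_SL[OF ij] elem_mat_SL[OF ji] by blast
    then have "(elem_mat i j 1 ** elem_mat j i 1) $ i $ i = (elem_mat j i 1 ** elem_mat i j 1 :: 'a^'n^'n) $ i $ i" by simp
    moreover have "(1::'a) + 1 \<noteq> 1 + 0" unfolding add_left_cancel by simp
    ultimately show False using ij by (simp add: elem_mat_mult_left elem_mat_nth)
  qed
  ultimately show ?thesis by (auto simp: doubleton_eq_iff)
qed

text \<open>The commutator relation survives \<open>g\<close>. Were the images of its two factors to
  commute, the third root element would have trivial image. So they are composable, either in the
  given order or, as for inverse transpose, in the reversed order.\<close>

lemma root_sum:
  assumes d: "i \<noteq> j" "j \<noteq> k" "i \<noteq> k"
  shows "(\<mu> i j = \<kappa> j k \<and> \<kappa> i k = \<kappa> i j \<and> \<mu> i k = \<mu> j k \<and> (\<forall>a b. F i k (a * b) = F i j a * F j k b))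
     \<or> (\<kappa> i j = \<mu> j k \<and> \<kappa> i k = \<kappa> j k \<and> \<mu> i k = \<mu> i j)"
proof -
  let ?r = "elem_mat (\<kappa> i j) (\<mu> i j) :: 'a \<Rightarrow> 'a^'n^'n"
  let ?s = "elem_mat (\<kappa> j k) (\<mu> j k) :: 'a \<Rightarrow> 'a^'n^'n"
  let ?t = "elem_mat (\<kappa> i k) (\<mu> i k) :: 'a \<Rightarrow> 'a^'n^'n"
  have SLr: "?r a \<in> SL" "?s a \<in> SL" "?t a \<in> SL" for a using neq d by (auto intro: elem_mat_SL)
  have rel: "?r (F i j a) ** ?s (F j k b) = ?s (F j k b) ** ?r (F i j a) ** ?t (F i k (a * b))" for a b
  proof -
    have "g (elem_mat i j a ** elem_mat j k b) = g (elem_mat j k b ** elem_mat i j a ** elem_mat i k (a * b))"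
      by (rule arg_cong[OF elem_mat_commutator[OF d]])
    then show ?thesis using d by (simp add: hom elem_mat_SL SL_closed root)
  qed
  have ne: "\<not> (\<mu> i j = \<kappa> j k \<and> \<kappa> i j = \<mu> j k)"
  proof
    assume "\<mu> i j = \<kappa> j k \<and> \<kappa> i j = \<mu> j k"
    then have "{\<kappa> i j, \<mu> i j} = {\<kappa> j k, \<mu> j k}" by auto
    then have "{i, j} = {j, k}" using root_pair_inj d by blast
    then show False using d by (auto simp: doubleton_eq_iff)
  qed
  consider "\<mu> i j = \<kappa> j k" "\<kappa> i j \<noteq> \<mu> j k" | "\<kappa> i j = \<mu> j k" "\<mu> i j \<noteq> \<kappa> j k" | "\<mu> i j \<noteq> \<kappa> j k" "\<kappa> i j \<noteq> \<mu> j k"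
    using ne by blast
  then show ?thesis
  proof cases
    case 1
    have "?t (F i k (a * b)) = elem_mat (\<kappa> i j) (\<mu> j k) (F i j a * F j k b)" for a b
    proof -
      have "?r (F i j a) ** ?s (F j k b) = ?s (F j k b) ** ?r (F i j a) ** elem_mat (\<kappa> i j) (\<mu> j k) (F i j a * F j k b)"
        using elem_mat_commutator[of "\<kappa> i j" "\<mu> i j" "\<mu> j k"] neq[OF d(1)] neq[OF d(2)] 1 by simp
      then show ?thesis using SL_cancel(1)[OF SL_closed(1)[OF SLr(2,1)]] rel by metis
    qed
    note e = this
    have eq: "\<kappa> i j = \<kappa> i k \<and> \<mu> j k = \<mu> i k"
      using elem_mat_eq_iff[OF neq[OF d(3)] 1(2) _ e[of 1 1]] F1[OF d(3)] by simp
    then have "F i k (a * b) = F i j a * F j k b" for a b using e[of a b] root_eqD by simp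
    then show ?thesis using 1 eq by auto
  next
    case 2
    have "?s (F j k 1) ** ?r (F i j 1) = ?r (F i j 1) ** ?s (F j k 1) ** elem_mat (\<kappa> j k) (\<mu> i j) (F j k 1 * F i j 1)"
      using elem_mat_commutator[of "\<kappa> j k" "\<mu> j k" "\<mu> i j"] neq[OF d(1)] neq[OF d(2)] 2 by simp
    then have "?r (F i j 1) ** ?s (F j k 1) ** mat 1 =
        ?r (F i j 1) ** ?s (F j k 1) ** (elem_mat (\<kappa> j k) (\<mu> i j) (F j k 1 * F i j 1) ** ?t (F i k (1 * 1)))"
      using rel[of 1 1] by (metis matrix_mul_assoc matrix_mul_rid)
    then have "elem_mat (\<kappa> j k) (\<mu> i j) (F j k 1 * F i j 1) ** ?t (F i k (1 * 1)) = mat 1"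
      using SL_cancel(1)[OF SL_closed(1)[OF SLr(1,2)]] by metis
    also have "mat 1 = elem_mat (\<kappa> j k) (\<mu> i j) (F j k 1 * F i j 1) ** elem_mat (\<kappa> j k) (\<mu> i j) (- (F j k 1 * F i j 1))"
      using elem_mat_inverse 2 by metis
    finally have t: "?t (F i k (1 * 1)) = elem_mat (\<kappa> j k) (\<mu> i j) (- (F j k 1 * F i j 1))"
      using SL_cancel(1)[OF elem_mat_SL] 2(2) by metis
    have "\<kappa> j k = \<kappa> i k \<and> \<mu> i j = \<mu> i k"
      using elem_mat_eq_iff[OF neq[OF d(3)] _ _ t] 2 F1[OF d(3)] by (metis mult_1)
    then show ?thesis using 2 by auto
  next
    case 3
    have "?r (F i j 1) ** ?s (F j k 1) = ?s (F j k 1) ** ?r (F i j 1)"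
      by (rule elem_mat_comm) (use neq d 3 in auto)
    then have "?s (F j k 1) ** ?r (F i j 1) ** mat 1 = ?s (F j k 1) ** ?r (F i j 1) ** ?t (F i k (1 * 1))"
      using rel[of 1 1] by (metis matrix_mul_rid)
    then have "?t (F i k (1 * 1)) = ?t 0" using SL_cancel(1)[OF SL_closed(1)[OF SLr(2,1)]] by (metis elem_mat_0)
    then have "F i k (1 * 1) = 0" by (rule root_eqD)
    then show ?thesis using F1[OF d(3)] by simp
  qed
qed

text \<open>Any two roots starting at \<open>o'\<close> have images sharing the row or the column,
  by \<open>root_sum\<close>, and two distinct ones never share both. A mixture among three of them
  is therefore impossible.\<close>

lemma root_type:
  fixes o' :: 'n
  shows "(\<forall>j k. j \<noteq> o' \<longrightarrow> k \<noteq> o' \<longrightarrow> \<kappa> o' j = \<kappa> o' k) \<or> (\<forall>j k. j \<noteq> o' \<longrightarrow> k \<noteq> o' \<longrightarrow> \<mu> o' j = \<mu> o' k)"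
proof -
  have share: "\<kappa> o' j = \<kappa> o' k \<or> \<mu> o' j = \<mu> o' k" if "j \<noteq> o'" "k \<noteq> o'" for j k
  proof (cases "j = k")
    case False
    then show ?thesis using root_sum[of o' k j] that by auto
  qed simp
  have nboth: "\<not> (\<kappa> o' j = \<kappa> o' k \<and> \<mu> o' j = \<mu> o' k)" if "j \<noteq> o'" "k \<noteq> o'" "j \<noteq> k" for j k
    using root_pair_inj[of o' j o' k] that by (auto simp: doubleton_eq_iff)
  show ?thesis using share nboth by metis
qed

text \<open>Indices are permuted by one map \<open>\<sigma>\<close>, and parameters change by one
  field homomorphism \<open>\<delta>\<close> and factors \<open>d i / d j\<close>; hence on
  generators \<open>g\<close> is \<open>\<delta>\<close> followed by conjugation with a monomial
  matrix. For n = 2 there are no commutator relations and only opposite roots can be compared, which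
  is the purpose of \<open>inv1\<close> and \<open>D_swap\<close>.\<close>

lemma first_type_classification:
  fixes o' :: 'n
  assumes first: "\<And>j k. j \<noteq> o' \<Longrightarrow> k \<noteq> o' \<Longrightarrow> \<kappa> o' j = \<kappa> o' k"
  shows "\<exists>M \<delta>. field_hom \<delta> \<and> det M \<noteq> 0 \<and> (\<forall>A\<in>SL. g A ** M = M ** map_mat \<delta> A)"
proof -
  obtain j0 where j0: "j0 \<noteq> o'" using ex_other by blast
  define \<sigma> where "\<sigma> j = (if j = o' then \<kappa> o' j0 else \<mu> o' j)" for j
  have k1: "\<kappa> o' j = \<sigma> o'" "\<mu> o' j = \<sigma> j" "\<kappa> j o' = \<sigma> j" "\<mu> j o' = \<sigma> o'" if "j \<noteq> o'" for j
    using that first[OF that j0] root_opposite[of o' j] by (auto simp: \<sigma>_def)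
  have inj: "\<sigma> i \<noteq> \<sigma> j" if "i \<noteq> j" for i j
  proof (cases "i = o' \<or> j = o'")
    case True then show ?thesis using neq[of o' i] neq[of o' j] k1 that by metis
  next
    case False
    then show ?thesis using root_pair_inj[of o' i o' j] k1 that by (auto simp: doubleton_eq_iff)
  qed
  have rt: "\<kappa> i j = \<sigma> i \<and> \<mu> i j = \<sigma> j" if ij: "i \<noteq> j" for i j
  proof (cases "i = o' \<or> j = o'")
    case True then show ?thesis using k1 ij by metis
  next
    case False
    then have "i \<noteq> o'" "o' \<noteq> j" by auto
    then show ?thesis using root_sum[of i o' j] ij k1[of i] k1[of j] inj[of i j] by auto
  qed
  have Fs: "F i k (a * b) = F i j a * F j k b" if "i \<noteq> j" "j \<noteq> k" "i \<noteq> k" for i j k a b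
    using root_sum[OF that] rt that inj[OF that(3)] by auto
  \<comment> \<open>The Weyl element \<open>w\<close> carries one root element to the opposite one;
    a single entry of the image of this relation forces the two parameters to be inverse to each
    other.\<close>
  have inv1: "F i j 1 * F j i 1 = 1" if ij: "i \<noteq> j" for i j
  proof -
    have ji: "j \<noteq> i" and s: "\<sigma> i \<noteq> \<sigma> j" using ij inj by auto
    let ?w = "elem_mat i j 1 ** elem_mat j i (- 1) ** elem_mat i j 1 :: 'a^'n^'n"
    have "?w ** elem_mat i j 1 = elem_mat j i (- 1) ** ?w"
      using ij by (auto simp: vec_eq_iff elem_mat_mult_right elem_mat_mult_left elem_mat_nth)
    then have "g (?w ** elem_mat i j 1) = g (elem_mat j i (- 1) ** ?w)" by simp
    then have e: "g ?w ** elem_mat (\<sigma> i) (\<sigma> j) (F i j 1) = elem_mat (\<sigma> j) (\<sigma> i) (F j i (- 1)) ** g ?w"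
      using ij ji rt by (simp add: hom elem_mat_SL SL_closed root)
    have "g ?w = elem_mat (\<sigma> i) (\<sigma> j) (F i j 1) ** elem_mat (\<sigma> j) (\<sigma> i) (- F j i 1) ** elem_mat (\<sigma> i) (\<sigma> j) (F i j 1)"
      using ij ji rt by (simp add: hom elem_mat_SL SL_closed root F_minus)
    then have w: "g ?w $ \<sigma> i $ \<sigma> i = 1 - F i j 1 * F j i 1"
      using s by (simp add: elem_mat_mult_right elem_mat_mult_left elem_mat_nth)
    have "(g ?w ** elem_mat (\<sigma> i) (\<sigma> j) (F i j 1)) $ \<sigma> i $ \<sigma> j = (elem_mat (\<sigma> j) (\<sigma> i) (F j i (- 1)) ** g ?w) $ \<sigma> i $ \<sigma> j"
      using e by simp
    then have "g ?w $ \<sigma> i $ \<sigma> i * F i j 1 = 0" using s by (simp only: elem_mat_mult_right elem_mat_mult_left) simp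
    then show ?thesis using w F1[OF ij] by simp
  qed
  define D where "D i j a = F i j a / F i j 1" for i j a
  \<comment> \<open>A diagonal matrix acts on opposite roots through inverse ratios, so both
    normalized parameter maps are given by the same quotient \<open>x / y\<close>.\<close>
  have D_swap: "D i j a = D j i a" if ij: "i \<noteq> j" for i j a
  proof (cases "a = 0")
    case True then show ?thesis using F_0 ij by (simp add: D_def)
  next
    case False
    have ji: "j \<noteq> i" using ij by simp
    obtain A where A: "A \<in> SL" "diagonal_mat A" "A $ i $ i / A $ j $ j = a" using ratio_exists[OF ij False] .
    have a': "A $ j $ j / A $ i $ i = inverse a" using A(3) by (metis inverse_divide)
    define x y where "x = g A $ \<sigma> i $ \<sigma> i" and "y = g A $ \<sigma> j $ \<sigma> j"
    have gd: "diagonal_mat (g A)" "g A \<in> SL" using A diag g_SL by auto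
    have xy: "x \<noteq> 0" "y \<noteq> 0" unfolding x_def y_def by (rule diagonal_SL_nonzero[OF gd])+
    have 1: "x * F i j 1 = F i j a * y" using F_ratio[OF ij A(1,2), of 1] A(3) rt[OF ij] by (simp add: x_def y_def)
    have 2: "y * F j i 1 = F j i (inverse a) * x" using F_ratio[OF ji A(1,2), of 1] a' rt[OF ji] by (simp add: x_def y_def)
    have 3: "F j i a * F j i (inverse a) = F j i 1 * F j i 1" using F_mult[OF ji, of a "inverse a"] False by simp
    have "D i j a = x / y" using 1 xy F1[OF ij] by (simp add: D_def field_simps)
    moreover have "F j i (inverse a) = y * F j i 1 / x" using 2 xy by (simp add: field_simps)
    then have "F j i 1 * (F j i a * (y / x)) = F j i 1 * F j i 1" using 3 by (simp add: mult.commute mult.left_commute)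
    then have "F j i a * (y / x) = F j i 1" using mult_left_cancel[OF F1[OF ji]] by blast
    then have "D j i a = x / y" using xy F1[OF ji] by (simp add: D_def field_simps)
    ultimately show ?thesis by simp
  qed
  have D_snd: "D i j a = D i k a" if "i \<noteq> j" "i \<noteq> k" for i j k a
  proof (cases "j = k")
    case False
    then show ?thesis using Fs[of i j k a 1] Fs[of i j k 1 1] F1[of j k] that by (simp add: D_def)
  qed simp
  have D_fst: "D j k a = D i k a" if "j \<noteq> k" "i \<noteq> k" for i j k a
    using D_swap D_snd that by metis
  define \<delta> where "\<delta> = D o' j0"
  have \<delta>: "F i j a = F i j 1 * \<delta> a" if ij: "i \<noteq> j" for i j a
  proof -
    have "D i j a = \<delta> a"
    proof (cases "j = o'")
      case True then show ?thesis unfolding \<delta>_def using D_swap D_snd ij j0 by metis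
    next
      case False then show ?thesis unfolding \<delta>_def using D_fst[of i j o'] D_snd[of o' j j0] ij j0 by metis
    qed
    then show ?thesis using F1[OF ij] by (simp add: D_def field_simps)
  qed
  have oj: "o' \<noteq> j0" using j0 by simp
  have hom\<delta>: "field_hom \<delta>"
  proof -
    have "F o' j0 (x * y) = F o' j0 x * F o' j0 y / F o' j0 1" for x y
      using F_mult[OF oj, of x y] F1[OF oj] by (metis nonzero_eq_divide_eq)
    then show ?thesis
      unfolding field_hom_def \<delta>_def D_def using F1[OF oj] by (simp add: F_add[OF oj] add_divide_distrib)
  qed
  \<comment> \<open>By \<open>Fs\<close> and \<open>inv1\<close> the scalars \<open>F i j 1\<close>
    form a multiplicative cocycle; \<open>d\<close> trivializes it with \<open>o'\<close> as base
    point.\<close>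
  define d where "d i = (if i = o' then 1 else F i o' 1)" for i
  have d0: "d i \<noteq> 0" for i using F1 by (simp add: d_def)
  have Fd: "F i j 1 = d i / d j" if ij: "i \<noteq> j" for i j
  proof -
    consider "j = o'" | "i = o'" "j \<noteq> o'" | "i \<noteq> o'" "j \<noteq> o'" by blast
    then show ?thesis
    proof cases
      case 1 then show ?thesis using ij by (simp add: d_def)
    next
      case 2 then show ?thesis using inv1[OF ij] F1[of j o'] by (simp add: d_def field_simps)
    next
      case 3 then show ?thesis using Fs[of i o' j 1 1] ij inv1[of o' j] F1[of j o'] by (simp add: d_def field_simps)
    qed
  qed
  define M :: "'a^'n^'n" where "M = (\<chi> r s. if r = \<sigma> s then d s else 0)"
  define N :: "'a^'n^'n" where "N = (\<chi> r s. if s = \<sigma> r then 1 / d r else 0)"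
  have "(N ** M) $ r $ s = mat 1 $ r $ s" for r s
  proof -
    have "(N ** M) $ r $ s = (\<Sum>t\<in>UNIV. N $ r $ t * M $ t $ s)" by (simp add: matrix_matrix_mult_def)
    also have "\<dots> = (\<Sum>t\<in>UNIV. if t = \<sigma> r then (if t = \<sigma> s then d s / d r else 0) else 0)"
      by (rule sum.cong) (simp_all add: N_def M_def)
    also have "\<dots> = (if \<sigma> r = \<sigma> s then d s / d r else 0)" by simp
    also have "\<dots> = mat 1 $ r $ s" using inj[of r s] d0[of s] by (cases "r = s") (simp_all add: mat_1_nth)
    finally show ?thesis .
  qed
  then have "N ** M = mat 1" by (simp add: vec_eq_iff)
  then have "det N * det M = 1" by (metis det_I det_mul)
  then have detM: "det M \<noteq> 0" by auto
  have Mel: "elem_mat (\<sigma> i) (\<sigma> j) (d i / d j * x) ** M = M ** elem_mat i j x" if ij: "i \<noteq> j" for i j x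
  proof -
    have "(elem_mat (\<sigma> i) (\<sigma> j) (d i / d j * x) ** M) $ r $ s = (M ** elem_mat i j x) $ r $ s" for r s
      unfolding elem_mat_mult_left elem_mat_mult_right M_def
      using inj[of j s] inj[of s j] d0[of j] ij by (cases "s = j") auto
    then show ?thesis by (simp add: vec_eq_iff)
  qed
  have "g A ** M = M ** map_mat \<delta> A" if "A \<in> elem_gen" for A
    using that
  proof (induction rule: elem_gen.induct)
    case elem_gen_1 show ?case by (simp add: g_one map_mat_1[OF hom\<delta>])
  next
    case (elem_gen_step A i j a)
    have "A \<in> SL" using elem_gen_det[OF elem_gen_step(1)] by (simp add: SL_def)
    then have "g (elem_mat i j a ** A) ** M = g (elem_mat i j a) ** (g A ** M)"
      by (simp add: hom[OF elem_mat_SL[OF elem_gen_step(2)]] matrix_mul_assoc)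
    also have "\<dots> = g (elem_mat i j a) ** M ** map_mat \<delta> A" by (simp add: elem_gen_step matrix_mul_assoc)
    also have "g (elem_mat i j a) = elem_mat (\<sigma> i) (\<sigma> j) (d i / d j * \<delta> a)"
      using root[OF elem_gen_step(2)] rt[OF elem_gen_step(2)] \<delta>[OF elem_gen_step(2), of a] Fd[OF elem_gen_step(2)] by simp
    also have "elem_mat (\<sigma> i) (\<sigma> j) (d i / d j * \<delta> a) ** M = M ** elem_mat i j (\<delta> a)" by (rule Mel[OF elem_gen_step(2)])
    finally show ?case by (simp add: map_mat_mult[OF hom\<delta>] map_mat_elem[OF hom\<delta>] matrix_mul_assoc)
  qed
  then show ?thesis using hom\<delta> detM SL_elem_gen by (auto simp: SL_def)
qed

end

context sl_automorphism_diag
begin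

lemma elem_image_all:
  assumes ij: "i \<noteq> j" and kl: "k \<noteq> l" and u: "g (elem_mat i j 1) = elem_mat k l b"
  shows "\<exists>c. g (elem_mat i j a) = elem_mat k l c"
proof (cases "a = 0")
  case True
  then show ?thesis using g_one by (intro exI[of _ 0]) simp
next
  case False
  obtain s where s: "s ^ 2 = a" using nth_root_exists[of 2 a] by auto
  then have s0: "s \<noteq> 0" using False by auto
  let ?A = "diag2 i j s :: 'a^'n^'n"
  have A: "?A \<in> SL" by (rule diag2_SL[OF ij s0])
  have gA: "diagonal_mat (g ?A)" "g ?A \<in> SL" using diag A g_SL by auto
  have "?A ** elem_mat i j 1 = elem_mat i j a ** ?A"
    using diagonal_elem_conj[of ?A i j 1] ij s s0 by (simp add: diag2_nth power2_eq_square divide_inverse)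
  then have "g ?A ** elem_mat k l b = g (elem_mat i j a) ** g ?A"
    using hom A elem_mat_SL[OF ij] u by metis
  moreover have "g ?A ** elem_mat k l b = elem_mat k l (g ?A $ k $ k / g ?A $ l $ l * b) ** g ?A"
    by (rule diagonal_elem_conj[OF gA(1) kl diagonal_SL_nonzero[OF gA]])
  ultimately show ?thesis using SL_cancel(2)[OF gA(2)] by metis
qed

lemma root_data_exists: "\<exists>\<kappa> \<mu> F. sl_root_data g \<kappa> \<mu> F"
proof -
  have "\<forall>i j. \<exists>k l b. i \<noteq> j \<longrightarrow> k \<noteq> l \<and> b \<noteq> 0 \<and> g (elem_mat i j 1) = elem_mat k l b"
    using elem_image by blast
  then obtain \<kappa> \<mu> b where kl: "\<And>i j. i \<noteq> j \<Longrightarrow> \<kappa> i j \<noteq> \<mu> i j \<and> b i j \<noteq> 0 \<and> g (elem_mat i j 1) = elem_mat (\<kappa> i j) (\<mu> i j) (b i j)"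
    by metis
  have "\<forall>i j a. \<exists>c. i \<noteq> j \<longrightarrow> g (elem_mat i j a) = elem_mat (\<kappa> i j) (\<mu> i j) c"
    using elem_image_all kl by blast
  then obtain F where F: "\<And>i j a. i \<noteq> j \<Longrightarrow> g (elem_mat i j a) = elem_mat (\<kappa> i j) (\<mu> i j) (F i j a)" by metis
  have "F i j 1 \<noteq> 0" if ij: "i \<noteq> j" for i j
    using elem_mat_eq_iff[of "\<kappa> i j" "\<mu> i j" "\<kappa> i j" "\<mu> i j" "b i j" "F i j 1"] kl[OF ij] F[OF ij, of 1] by auto
  then have "sl_root_data g \<kappa> \<mu> F" using kl F by unfold_locales auto
  then show ?thesis by blast
qed

lemma contragredient_diag: "sl_automorphism_diag (\<lambda>A. transpose (matrix_inv (g A)))"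
proof -
  interpret c: sl_automorphism "\<lambda>A. transpose (matrix_inv (g A))" by (rule contragredient)
  show ?thesis
  proof
    fix A :: "'a^'n^'n" assume A: "A \<in> SL"
    then have gA: "g A \<in> SL" by (rule g_SL)
    have inv: "g A ** matrix_inv (g A) = mat 1" "matrix_inv (g A) ** g A = mat 1"
      using matrix_inv_det[of "g A"] gA by (auto simp: SL_def)
    have dinv: "diagonal_mat Y" if X: "diagonal_mat X" "X \<in> SL" "X ** Y = mat 1" for X Y :: "'a^'n^'n"
    proof -
      have "X $ k $ k * Y $ k $ l = mat 1 $ k $ l" for k l
        using X(3) diagonal_matD[OF X(1)] diag_mat_mult_left[of "\<lambda>i. X $ i $ i" Y k l] by simp
      then show ?thesis unfolding diagonal_mat_def using diagonal_SL_nonzero[OF X(1,2)]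
        by (metis mat_1_nth mult_eq_0_iff)
    qed
    have "diagonal_mat (matrix_inv (g A)) \<longleftrightarrow> diagonal_mat (g A)"
      using dinv[OF _ gA inv(1)] dinv[OF _ matrix_inv_SL[OF gA] inv(2)] by blast
    moreover have "diagonal_mat (transpose X) \<longleftrightarrow> diagonal_mat X" for X :: "'a^'n^'n"
      unfolding diagonal_mat_def transpose_def by auto
    ultimately show "diagonal_mat (transpose (matrix_inv (g A))) \<longleftrightarrow> diagonal_mat A" using diag[OF A] by simp
  qed
qed

lemma diag_classification:
  "\<exists>M \<delta>. field_hom \<delta> \<and> det M \<noteq> 0 \<and>
    ((\<forall>A\<in>SL. g A ** M = M ** map_mat \<delta> A) \<or> (\<forall>A\<in>SL. g A ** M ** transpose (map_mat \<delta> A) = M))"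
proof -
  obtain \<kappa> \<mu> F where rd: "sl_root_data g \<kappa> \<mu> F" using root_data_exists by blast
  interpret sl_root_data g \<kappa> \<mu> F by (rule rd)
  fix o' :: 'n
  show ?thesis
  proof (cases "\<forall>j k. j \<noteq> o' \<longrightarrow> k \<noteq> o' \<longrightarrow> \<kappa> o' j = \<kappa> o' k")
    case True
    then show ?thesis using first_type_classification[of o'] by blast
  next
    case False
    then have second: "\<And>j k. j \<noteq> o' \<Longrightarrow> k \<noteq> o' \<Longrightarrow> \<mu> o' j = \<mu> o' k" using root_type[of o'] by blast
    let ?c = "\<lambda>A. transpose (matrix_inv (g A))"
    interpret c: sl_automorphism_diag ?c by (rule contragredient_diag)
    \<comment> \<open>Inverse transpose exchanges row and column of a root element and negates its
      parameter.\<close>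
    interpret c: sl_root_data ?c \<mu> \<kappa> "\<lambda>i j a. - F i j a"
    proof
      fix i j :: 'n and a :: 'a assume ij: "i \<noteq> j"
      show "\<mu> i j \<noteq> \<kappa> i j" "- F i j 1 \<noteq> 0" using neq[OF ij] F1[OF ij] by auto
      have "det (elem_mat (\<kappa> i j) (\<mu> i j) (F i j a)) \<noteq> 0" by (simp add: det_elem_mat[OF neq[OF ij]])
      from matrix_left_cancel[OF this] have "matrix_inv (elem_mat (\<kappa> i j) (\<mu> i j) (F i j a)) = elem_mat (\<kappa> i j) (\<mu> i j) (- F i j a)"
        using elem_mat_inverse[OF neq[OF ij]] matrix_inv_det(1) \<open>det _ \<noteq> 0\<close> by metis
      then show "?c (elem_mat i j a) = elem_mat (\<mu> i j) (\<kappa> i j) (- F i j a)"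
        by (simp add: root[OF ij] transpose_elem_mat)
    qed
    obtain M \<delta> where M: "field_hom \<delta>" "det M \<noteq> 0" "\<And>A. A \<in> SL \<Longrightarrow> ?c A ** M = M ** map_mat \<delta> A"
      using c.first_type_classification[of o'] second by blast
    let ?N = "matrix_inv (transpose M)"
    have dM: "det (transpose M) \<noteq> 0" using M(2) by (simp add: det_transpose)
    note N = matrix_inv_det[OF dM]
    have "det ?N * det (transpose M) = 1" using N(2) by (metis det_I det_mul)
    then have dN: "det ?N \<noteq> 0" by auto
    have "g A ** ?N ** transpose (map_mat \<delta> A) = ?N" if A: "A \<in> SL" for A
    proof -
      let ?D = "transpose (map_mat \<delta> A)"
      have "transpose (?c A ** M) = transpose (M ** map_mat \<delta> A)" using M(3)[OF A] by simp
      then have "transpose M ** matrix_inv (g A) = ?D ** transpose M" by (simp add: matrix_transpose_mul)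
      then have "transpose M ** matrix_inv (g A) ** ?N = ?D"
        using N(1) by (metis matrix_mul_assoc matrix_mul_rid)
      then have "g A ** ?N ** ?D = g A ** (?N ** transpose M) ** matrix_inv (g A) ** ?N"
        by (metis matrix_mul_assoc)
      also have "\<dots> = g A ** matrix_inv (g A) ** ?N" using N(2) by simp
      also have "\<dots> = ?N" using matrix_inv_det(1)[of "g A"] g_SL[OF A] by (simp add: SL_def)
      finally show ?thesis .
    qed
    then show ?thesis using M(1) dN by blast
  qed
qed

end

context sl_automorphism
begin

text \<open>The matrices in \<open>E\<close> commute, have cube one, and are centralized only by
  diagonal matrices, since \<zeta> differs from its inverse. Diagonalizing their images
  simultaneously is enough to make the conjugated automorphism \<open>h\<close> preserve and reflect
  diagonality.\<close>

lemma classification: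
  "\<exists>M \<delta>. field_hom \<delta> \<and> det M \<noteq> 0 \<and>
    ((\<forall>A\<in>SL. g A ** M = M ** map_mat \<delta> A) \<or> (\<forall>A\<in>SL. g A ** M ** transpose (map_mat \<delta> A) = M))"
proof -
  obtain \<zeta> :: 'a where z: "\<zeta> * \<zeta> = - 1 - \<zeta>" by (rule cube_root_of_unity)
  have three: "(3::'a) \<noteq> 0" by (rule numeral_neq_0_char_0[OF char0])
  have z3: "\<zeta> * \<zeta> * \<zeta> = 1" by (simp add: z algebra_simps)
  have z0: "\<zeta> \<noteq> 0" using z3 by auto
  have zne: "\<zeta> \<noteq> inverse \<zeta>"
  proof
    assume "\<zeta> = inverse \<zeta>"
    then have "\<zeta> * \<zeta> = 1" using z0 by (metis right_inverse)
    then have "\<zeta> = 1" using z3 by simp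
    then show False using z three by simp
  qed
  define E where "E = (\<lambda>(i, j). diag2 i j \<zeta>) ` {(i::'n, j). i \<noteq> j}"
  have E_SL: "E \<subseteq> SL" unfolding E_def using diag2_SL z0 by auto
  have E_diag: "diagonal_mat A" if "A \<in> E" for A using that by (auto simp: E_def)
  have E3: "A ** A ** A = mat 1" if AE: "A \<in> E" for A
  proof -
    obtain i j where A: "A = diag2 i j \<zeta>" "i \<noteq> j" using AE by (auto simp: E_def)
    have "inverse \<zeta> * inverse \<zeta> * inverse \<zeta> = 1" using z3 by (metis inverse_1 inverse_mult_distrib)
    then show ?thesis
      unfolding A(1) diag2_def using z3 by (auto simp: vec_eq_iff diag_mat_mult_right diag_mat_nth mat_1_nth)
  qed
  have finE: "finite (g ` E)" by (simp add: E_def)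
  obtain P where P: "det P \<noteq> 0" "\<And>A. A \<in> g ` E \<Longrightarrow> diagonal_mat (matrix_inv P ** A ** P)"
  proof (rule simultaneous_diagonalization[OF three finE])
    fix A B assume "A \<in> g ` E" "B \<in> g ` E"
    then obtain A' B' where "A = g A'" "B = g B'" "A' \<in> E" "B' \<in> E" by auto
    then show "A ** B = B ** A" using g_comm E_SL diagonal_commute E_diag by blast
  next
    fix A assume "A \<in> g ` E"
    then obtain A' where A': "A = g A'" "A' \<in> E" by auto
    then have "A' \<in> SL" using E_SL by blast
    then have "g (A' ** A' ** A') = A ** A ** A" by (simp add: A'(1) hom SL_closed)
    then show "A ** A ** A = mat 1" using E3[OF A'(2)] g_one by simp
  qed blast
  define h where "h A = matrix_inv P ** g A ** P" for A
  interpret h: sl_automorphism h unfolding h_def by (rule conjugate[OF P(1)])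
  have hE: "diagonal_mat (h A)" if "A \<in> E" for A using P(2) that by (simp add: h_def)
  have cent: "diagonal_mat A" if "\<And>B. B \<in> E \<Longrightarrow> B ** A = A ** B" for A
    unfolding diagonal_mat_def
  proof (intro allI impI)
    fix i j :: 'n assume ij: "i \<noteq> j"
    have "diag2 i j \<zeta> \<in> E" using ij by (auto simp: E_def)
    then have "diag2 i j \<zeta> ** A = A ** diag2 i j \<zeta>" by (rule that)
    then have "A $ i $ j \<noteq> 0 \<longrightarrow> (diag2 i j \<zeta> :: 'a^'n^'n) $ i $ i = diag2 i j \<zeta> $ j $ j"
      using commute_diag_iff[of "diag2 i j \<zeta>" A] by simp
    then show "A $ i $ j = 0" using ij zne by (auto simp: diag2_nth)
  qed
  \<comment> \<open>\<open>h A\<close> commutes with the diagonal images of \<open>E\<close>, so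
    \<open>A\<close> commutes with \<open>E\<close>.\<close>
  have bwd: "diagonal_mat A" if A: "A \<in> SL" "diagonal_mat (h A)" for A
  proof (rule cent)
    fix B assume "B \<in> E"
    then show "B ** A = A ** B" using h.g_comm[of B A] E_SL A hE diagonal_commute by blast
  qed
  \<comment> \<open>Elements of \<open>E\<close> are diagonal, so by \<open>bwd\<close> their
    preimages are diagonal and commute with \<open>A\<close>; then apply \<open>h\<close>.\<close>
  have forth: "diagonal_mat (h A)" if A: "A \<in> SL" "diagonal_mat A" for A
  proof (rule cent)
    fix B assume B: "B \<in> E"
    then obtain C where C: "C \<in> SL" "h C = B" using h.g_surj E_SL by blast
    then have "diagonal_mat C" using bwd E_diag B by blast
    then show "B ** h A = h A ** B" using h.g_comm[of C A] C A diagonal_commute by metis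
  qed
  interpret h: sl_automorphism_diag h by unfold_locales (use bwd forth in blast)
  obtain M \<delta> where M: "field_hom \<delta>" "det M \<noteq> 0"
    "(\<forall>A\<in>SL. h A ** M = M ** map_mat \<delta> A) \<or> (\<forall>A\<in>SL. h A ** M ** transpose (map_mat \<delta> A) = M)"
    using h.diag_classification by blast
  have gP: "g A ** P = P ** h A" for A
    unfolding h_def using matrix_inv_det(1)[OF P(1)] by (metis matrix_mul_assoc matrix_mul_lid)
  have "det (P ** M) \<noteq> 0" using P(1) M(2) by (simp add: det_mul)
  moreover have "(\<forall>A\<in>SL. g A ** (P ** M) = P ** M ** map_mat \<delta> A) \<or> (\<forall>A\<in>SL. g A ** (P ** M) ** transpose (map_mat \<delta> A) = P ** M)"
    using M(3) gP by (metis matrix_mul_assoc)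
  ultimately show ?thesis using M(1) by blast
qed

end

section \<open>Eigenvectors of a field endomorphism and transcendence degree\<close>

lemma field_hom_eq_0: "field_hom f \<Longrightarrow> f x = 0 \<longleftrightarrow> x = 0"
  using field_homD(3)[of f x "inverse x"] field_homD(1,4)[of f] by (cases "x = 0") auto

lemma field_hom_inverse:
  assumes "field_hom f" shows "f (inverse x) = inverse (f x)"
proof (cases "x = 0")
  case True then show ?thesis using field_homD(4)[OF assms] by simp
next
  case False
  then have "f x * f (inverse x) = 1" using field_homD(3)[OF assms, of x "inverse x"] field_homD(1)[OF assms] by simp
  then show ?thesis by (metis inverse_unique)
qed

lemma field_hom_divide: "field_hom f \<Longrightarrow> f (x / y) = f x / f y"
  by (simp add: divide_inverse field_homD field_hom_inverse)

lemma field_hom_power: "field_hom f \<Longrightarrow> f (x ^ n) = f x ^ n"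
  by (induction n) (auto simp: field_homD)

lemma field_hom_prod: "field_hom f \<Longrightarrow> f (prod g I) = (\<Prod>i\<in>I. f (g i))"
  by (induction I rule: infinite_finite_induct) (auto simp: field_homD)

lemma field_hom_sum: "field_hom f \<Longrightarrow> f (sum g I) = (\<Sum>i\<in>I. f (g i))"
  by (rule additive_sum) (auto simp: field_homD)

lemma field_hom_minus: "field_hom f \<Longrightarrow> f (- x) = - f x"
  using field_homD(2)[of f x "- x"] field_homD(4)[of f] by (simp add: eq_neg_iff_add_eq_0 add.commute)

lemma field_hom_of_nat: "field_hom f \<Longrightarrow> f (of_nat n) = of_nat n"
  by (induction n) (auto simp: field_homD)

lemma field_hom_of_int: "field_hom f \<Longrightarrow> f (of_int n) = of_int n"
  by (cases n rule: int_cases2) (auto simp: field_hom_of_nat field_hom_minus)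

lemma field_hom_rat_in: "field_hom f \<Longrightarrow> f (rat_in q) = rat_in q"
  by (simp add: rat_in_def field_hom_divide field_hom_of_int split: prod.split)

text \<open>The usual independence of eigenvectors for distinct eigenvalues. As \<open>f\<close> is
  multiplicative, the eigenvalues are required to be fixed by \<open>f\<close>: then the factors
  \<open>E m - E x\<close> arising in the induction leave the eigenvalues unchanged.\<close>

lemma eigenvector_sum_nonzero:
  fixes y :: "'b \<Rightarrow> 'a::field"
  assumes f: "field_hom f" and "finite M" "M \<noteq> {}"
    "\<And>m. m \<in> M \<Longrightarrow> f (y m) = E m * y m" "\<And>m. m \<in> M \<Longrightarrow> f (E m) = E m" "inj_on E M" "\<And>m. m \<in> M \<Longrightarrow> y m \<noteq> 0"
  shows "sum y M \<noteq> 0"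
  using assms(2-)
proof (induction M arbitrary: y rule: finite_induct)
  case empty then show ?case by simp
next
  case (insert x M)
  show ?case
  proof
    assume s: "sum y (insert x M) = 0"
    then have 1: "y x + sum y M = 0" using insert by simp
    have "f (sum y (insert x M)) = 0" using s field_homD(4)[OF f] by simp
    then have "(\<Sum>m\<in>insert x M. E m * y m) = 0" using insert.prems(2) by (simp add: field_hom_sum[OF f])
    then have 2: "E x * y x + (\<Sum>m\<in>M. E m * y m) = 0" using insert by simp
    have "(\<Sum>m\<in>M. (E m - E x) * y m) = (\<Sum>m\<in>M. E m * y m) - E x * sum y M"
      by (simp add: left_diff_distrib sum_subtractf sum_distrib_left)
    also have "\<dots> = - (E x * y x) - E x * (- y x)"
      using add.inverse_unique[OF 1] add.inverse_unique[OF 2] by simp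
    finally have 0: "(\<Sum>m\<in>M. (E m - E x) * y m) = 0" by simp
    have "M = {}"
    proof (rule ccontr)
      assume "M \<noteq> {}"
      have "(\<Sum>m\<in>M. (E m - E x) * y m) \<noteq> 0"
      proof (rule insert.IH[OF \<open>M \<noteq> {}\<close>])
        fix m assume m: "m \<in> M"
        have "f (E m - E x) = E m - E x"
          using insert.prems(3) m field_homD(2)[OF f, of "E m" "- E x"] field_hom_minus[OF f] by simp
        then show "f ((E m - E x) * y m) = E m * ((E m - E x) * y m)"
          using insert.prems(2) m by (simp add: field_homD(3)[OF f] mult.left_commute)
        have "E m \<noteq> E x" using insert.prems(4) insert.hyps(2) m by (auto simp: inj_on_def)
        then show "(E m - E x) * y m \<noteq> 0" using insert.prems(5) m by simp
      qed (use insert.prems in \<open>auto simp: inj_on_def\<close>)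
      then show False using 0 by simp
    qed
    then show False using 1 insert.prems(5)[of x] by simp
  qed
qed

text \<open>Unique factorization with one prime \<open>p'\<close> set apart; it stems from the
  common denominator of the eigenvalues.\<close>

lemma prime_power_products_eq:
  fixes p' :: nat
  assumes "finite P" "\<And>p. p \<in> P \<Longrightarrow> prime p" "prime p'" "p' \<notin> P"
    and "(\<Prod>p\<in>P. p ^ e p) * p' ^ k = (\<Prod>p\<in>P. p ^ e' p) * p' ^ k'" "q \<in> P"
  shows "e q = e' q"
proof -
  have *: "multiplicity q ((\<Prod>p\<in>P. p ^ a p) * p' ^ l) = a q" for a l
  proof -
    have "(\<Prod>p\<in>P. p ^ (if p = p' then l else a p)) = (\<Prod>p\<in>P. p ^ a p)"
      using assms(4) by (intro prod.cong) auto
    then have "(\<Prod>p\<in>P. p ^ a p) * p' ^ l = (\<Prod>p\<in>insert p' P. p ^ (if p = p' then l else a p))"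
      using assms(1,4) by (simp add: mult.commute)
    moreover have "multiplicity q (\<Prod>p\<in>insert p' P. p ^ (if p = p' then l else a p)) = (if q = p' then l else a q)"
      using assms by (subst multiplicity_prod_prime_powers) auto
    ultimately show ?thesis using assms(4,6) by (metis (no_types))
  qed
  show ?thesis using *[of e k] *[of e' k'] assms(5) by simp
qed

text \<open>Dividing by one fixed \<open>u p'\<close> removes the factor \<open>a\<close>, which
  \<open>f\<close> may move, and leaves the rational eigenvalues (p / p')^s. By unique factorization
  distinct monomials in these quotients have distinct eigenvalues, so no polynomial relation holds
  among them.\<close>

theorem eigenvectors_imp_infinite_trdeg:
  fixes f :: "'a::field \<Rightarrow> 'a"
  assumes ch: "CHAR('a) = 0" and f: "field_hom f" and P: "infinite P" "\<And>p. p \<in> P \<Longrightarrow> prime (p::nat)"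
    and s: "s > 0" and u: "\<And>p. p \<in> P \<Longrightarrow> u p \<noteq> 0" "\<And>p. p \<in> P \<Longrightarrow> f (u p) = a * of_nat p ^ s * u p"
  shows "\<not> finite_trdeg_over_Q TYPE('a)"
proof
  assume "finite_trdeg_over_Q TYPE('a)"
  then obtain B :: "'a set" where B: "finite B" "alg_cl B = UNIV" using finite_trdeg_over_Q_iff[OF ch] by blast
  have nat_inj: "(of_nat m :: 'a) = of_nat n \<longleftrightarrow> m = n" for m n
  proof
    assume "(of_nat m :: 'a) = of_nat n"
    then have "(of_int (int m - int n) :: 'a) = 0" by simp
    then have "int m - int n = 0" by (simp only: of_int_eq_0_iff_char_0[OF ch])
    then show "m = n" by simp
  qed simp
  have nat0: "(of_nat m :: 'a) = 0 \<longleftrightarrow> m = 0" for m using nat_inj[of m 0] by simp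
  obtain p' where p': "p' \<in> P" using P(1) by (metis finite.emptyI ex_in_conv)
  have p'0: "(of_nat p' :: 'a) \<noteq> 0" using P(2)[OF p'] by (auto simp: nat0)
  have "infinite (P - {p'})" using P(1) by simp
  \<comment> \<open>One prime more than the finite basis \<open>B\<close> can accommodate.\<close>
  then obtain P0 where P0: "P0 \<subseteq> P - {p'}" "finite P0" "card P0 = Suc (card B)"
    using infinite_arbitrarily_large by metis
  define c where "c p = (of_nat p ^ s / of_nat p' ^ s :: 'a)" for p
  define v where "v p = u p / u p'" for p
  have a0: "a \<noteq> 0" using u[OF p'] field_hom_eq_0[OF f, of "u p'"] by auto
  have fv: "f (v p) = c p * v p" and v0: "v p \<noteq> 0" if "p \<in> P0" for p
  proof -
    have p: "p \<in> P" using that P0 by auto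
    show "v p \<noteq> 0" using u(1)[OF p] u(1)[OF p'] by (simp add: v_def)
    have "f (v p) = (a * of_nat p ^ s * u p) / (a * of_nat p' ^ s * u p')"
      using u(2)[OF p] u(2)[OF p'] by (simp add: v_def field_hom_divide[OF f])
    then show "f (v p) = c p * v p" using a0 by (simp add: c_def v_def)
  qed
  have fc: "f (c p) = c p" for p
    by (simp add: c_def field_hom_divide[OF f] field_hom_power[OF f] field_hom_of_nat[OF f])
  have inj_v: "inj_on v P0"
  proof (rule inj_onI)
    fix p q assume pq: "p \<in> P0" "q \<in> P0" "v p = v q"
    then have "c p * v p = c q * v p" using fv[OF pq(1)] fv[OF pq(2)] by metis
    then have "c p = c q" using v0[OF pq(1)] by simp
    then have "(of_nat (p ^ s) :: 'a) = of_nat (q ^ s)" using p'0 by (simp add: c_def)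
    then have "p ^ s = q ^ s" by (simp only: nat_inj)
    then show "p = q" using s by (simp add: power_eq_iff_eq_base)
  qed
  let ?T = "v ` P0"
  have "alg_independent_over_Q ?T"
    unfolding alg_independent_over_Q_def
  proof (intro allI impI)
    fix p :: "('a \<Rightarrow>\<^sub>0 nat) \<Rightarrow>\<^sub>0 rat" assume p: "p \<noteq> 0" "\<forall>m\<in>ks p. ks m \<subseteq> ?T"
    define E where "E m = (\<Prod>q\<in>P0. c q ^ lu m (v q))" for m :: "'a \<Rightarrow>\<^sub>0 nat"
    have mon: "mon_eval m = (\<Prod>q\<in>P0. v q ^ lu m (v q))" if "m \<in> ks p" for m
      using mon_eval_superset[of ?T m] P0(2) p(2) that inj_v by (simp add: prod.reindex)
    have fE: "f (E m) = E m" for m by (simp add: E_def field_hom_prod[OF f] field_hom_power[OF f] fc)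
    have "sum (\<lambda>m. rat_in (lu p m) * mon_eval m) (ks p) \<noteq> 0"
    proof (rule eigenvector_sum_nonzero[OF f])
      show "finite (ks p)" "ks p \<noteq> {}" using p(1) by auto
      show "inj_on E (ks p)"
      proof (rule inj_onI)
        fix m m' assume m: "m \<in> ks p" "m' \<in> ks p" "E m = E m'"
        define e e' where "e q = lu m (v q)" and "e' q = lu m' (v q)" for q
        define N where "N e = (\<Prod>q\<in>P0. q ^ (s * e q))" for e
        \<comment> \<open>All eigenvalues have the denominator \<open>of_nat p' ^ s\<close>, so a
          product of them has a power of \<open>p'\<close> as denominator.\<close>
        define D where "D e = p' ^ (s * (\<Sum>q\<in>P0. e q))" for e :: "nat \<Rightarrow> nat"
        have E: "(\<Prod>q\<in>P0. c q ^ e q) = of_nat (N e) / of_nat (D e)" for e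
          by (simp add: c_def N_def D_def power_divide prod_dividef power_sum power_mult sum_distrib_left)
        have "of_nat (N e) / of_nat (D e) = (of_nat (N e') / of_nat (D e') :: 'a)"
          using m(3) E[of e] E[of e'] by (simp add: E_def e_def e'_def)
        moreover have "(of_nat (D e) :: 'a) \<noteq> 0" "(of_nat (D e') :: 'a) \<noteq> 0" using p'0 by (simp_all add: D_def)
        ultimately have "(of_nat (N e * D e') :: 'a) = of_nat (N e' * D e)" by (simp add: frac_eq_eq)
        then have "N e * D e' = N e' * D e" by (simp only: nat_inj)
        then have ND: "(\<Prod>q\<in>P0. q ^ (s * e q)) * p' ^ (s * (\<Sum>q\<in>P0. e' q)) = (\<Prod>q\<in>P0. q ^ (s * e' q)) * p' ^ (s * (\<Sum>q\<in>P0. e q))"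
          by (simp add: N_def D_def)
        have ee: "e q = e' q" if "q \<in> P0" for q
        proof -
          have "s * e q = s * e' q"
            by (rule prime_power_products_eq[OF P0(2) _ P(2)[OF p'] _ ND that]) (use P0(1) P(2) in auto)
          then show ?thesis using s by simp
        qed
        show "m = m'"
        proof (rule poly_mapping_eqI)
          fix x
          show "lu m x = lu m' x"
          proof (cases "x \<in> ?T")
            case True then show ?thesis using ee by (auto simp: e_def e'_def)
          next
            case False
            then have "x \<notin> ks m" "x \<notin> ks m'" using p(2) m by auto
            then show ?thesis by (simp add: in_keys_iff)
          qed
        qed
      qed
      fix m assume m: "m \<in> ks p"
      have "f (mon_eval m) = E m * mon_eval m"
        using fv by (simp add: mon[OF m] E_def field_hom_prod[OF f] field_hom_power[OF f] power_mult_distrib prod.distrib)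
      then show "f (rat_in (lu p m) * mon_eval m) = E m * (rat_in (lu p m) * mon_eval m)"
        by (simp add: field_homD(3)[OF f] field_hom_rat_in[OF f] mult.left_commute)
      show "f (E m) = E m" by (rule fE)
      have "mon_eval m \<noteq> 0" using v0 P0(2) by (simp add: mon[OF m])
      then show "rat_in (lu p m) * mon_eval m \<noteq> 0" using m by (simp add: rat_in_hom(4)[OF ch] in_keys_iff)
    qed
    then show "mpoly_eval p \<noteq> 0" by (simp add: mpoly_eval_mon)
  qed
  then have "alg_indep ?T" using alg_independent_over_Q_iff[OF ch] by blast
  then have "card ?T \<le> card B" using P0(2) B by (intro alg_indep_card_le) auto
  then show False using card_image[OF inj_v] P0(3) by simp
qed

text \<open>The factor \<mu> depends on the prime and cancels in the quotient of an entry of column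
  \<open>i\<close> by one of column \<open>j\<close>. Each column has a nonzero entry, and the
  pigeonhole principle makes its row independent of the prime, so the factors
  \<open>\<alpha>\<close> combine to one constant. The parameters \<open>r\<close> and
  \<open>\<epsilon>\<close> let the lemma serve both types of automorphism.\<close>

lemma semi_intertwiners_imp_infinite_trdeg:
  fixes f :: "'a::field \<Rightarrow> 'a" and i j :: "'n::finite"
  assumes ch: "CHAR('a) = 0" and f: "field_hom f" and P: "infinite P" "\<And>p. p \<in> P \<Longrightarrow> prime (p::nat)"
    and r: "r > 0" and \<alpha>: "\<And>k. \<alpha> k \<noteq> 0" and \<epsilon>: "\<epsilon> \<noteq> 0"
    and \<beta>: "\<And>p. \<beta> p i = \<epsilon> * of_nat p ^ r" "\<And>p. \<beta> p j = \<epsilon> * inverse (of_nat p ^ r)"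
    and z: "\<And>p. p \<in> P \<Longrightarrow> \<exists>z :: 'a^'n^'n. \<exists>\<mu>. det z \<noteq> 0 \<and> \<mu> \<noteq> 0 \<and> (\<forall>k l. f (z $ k $ l) = \<mu> * \<alpha> k * \<beta> p l * z $ k $ l)"
  shows "\<not> finite_trdeg_over_Q TYPE('a)"
proof -
  have "\<forall>p. \<exists>z :: 'a^'n^'n. \<exists>\<mu>. p \<in> P \<longrightarrow> det z \<noteq> 0 \<and> \<mu> \<noteq> 0 \<and> (\<forall>k l. f (z $ k $ l) = \<mu> * \<alpha> k * \<beta> p l * z $ k $ l)"
    using z by blast
  then obtain z :: "nat \<Rightarrow> 'a^'n^'n" and \<mu> where z: "\<And>p. p \<in> P \<Longrightarrow> det (z p) \<noteq> 0" "\<And>p. p \<in> P \<Longrightarrow> \<mu> p \<noteq> 0"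
    "\<And>p k l. p \<in> P \<Longrightarrow> f (z p $ k $ l) = \<mu> p * \<alpha> k * \<beta> p l * z p $ k $ l" by metis
  have "\<exists>k. z p $ k $ l \<noteq> 0" if "p \<in> P" for p l
  proof (rule ccontr)
    assume "\<nexists>k. z p $ k $ l \<noteq> 0"
    then have "column l (z p) = 0" by (simp add: column_def vec_eq_iff)
    then show False using det_zero_column(2) z(1)[OF that] by blast
  qed
  then obtain K where K: "\<And>p l. p \<in> P \<Longrightarrow> z p $ K p l $ l \<noteq> 0" by metis
  obtain p0 where p0: "p0 \<in> P" "infinite {p\<in>P. (K p i, K p j) = (K p0 i, K p0 j)}"
    using pigeonhole_infinite[OF P(1), of "\<lambda>p. (K p i, K p j)"] by auto
  let ?P = "{p\<in>P. (K p i, K p j) = (K p0 i, K p0 j)}"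
  show ?thesis
  proof (rule eigenvectors_imp_infinite_trdeg[OF ch f p0(2), of "2 * r" "\<lambda>p. z p $ K p i $ i / z p $ K p j $ j" "\<alpha> (K p0 i) / \<alpha> (K p0 j)"])
    fix p assume p: "p \<in> ?P"
    then have pP: "p \<in> P" by simp
    then show "prime p" using P by blast
    show "z p $ K p i $ i / z p $ K p j $ j \<noteq> 0" using K[OF pP, of i] K[OF pP, of j] by simp
    have p1: "(of_nat p :: 'a) \<noteq> 0"
      using \<open>prime p\<close> of_int_eq_0_iff_char_0[OF ch, of "int p"] by (auto simp: prime_gt_0_nat)
    have "f (z p $ K p i $ i / z p $ K p j $ j)
      = (\<mu> p * \<alpha> (K p i) * \<beta> p i * z p $ K p i $ i) / (\<mu> p * \<alpha> (K p j) * \<beta> p j * z p $ K p j $ j)"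
      using z(3)[OF pP] by (simp add: field_hom_divide[OF f])
    also have "\<dots> = (\<alpha> (K p i) / \<alpha> (K p j)) * (\<beta> p i / \<beta> p j) * (z p $ K p i $ i / z p $ K p j $ j)"
      using z(2)[OF pP] by (simp add: mult.assoc)
    also have "\<beta> p i / \<beta> p j = of_nat p ^ (2 * r)"
      unfolding \<beta> mult_2 power_add using \<epsilon> p1 by (simp add: divide_inverse)
    finally show "f (z p $ K p i $ i / z p $ K p j $ j) = \<alpha> (K p0 i) / \<alpha> (K p0 j) * of_nat p ^ (2 * r) * (z p $ K p i $ i / z p $ K p j $ j)"
      using p by simp
  qed (use r in simp)
qed

section \<open>Test matrices and the infinite family\<close>

abbreviation scalar_mat :: "'a \<Rightarrow> 'a::field^'n^'n" where
  "scalar_mat c \<equiv> diag_mat (\<lambda>_. c)"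

lemma scalar_mat_comm: "scalar_mat c ** A = A ** scalar_mat c"
  by (simp add: vec_eq_iff diag_mat_mult_left diag_mat_mult_right mult.commute)

lemma det_scalar_mat: "det (scalar_mat c :: 'a::field^'n^'n) = c ^ CARD('n)"
  by (simp add: det_diag_mat)

definition weyl_mat :: "'n \<Rightarrow> 'n \<Rightarrow> 'a \<Rightarrow> 'a::field^'n^'n" where
  "weyl_mat i j a = (\<chi> k l. if k = i then (if l = j then a else 0) else if k = j then (if l = i then - inverse a else 0)
     else if k = l then 1 else 0)"

lemma weyl_mat_SL:
  assumes "i \<noteq> j" "a \<noteq> 0"
  shows "weyl_mat i j a \<in> SL"
proof -
  \<comment> \<open>A diagonal matrix times the usual Weyl element, both of determinant one.\<close>
  have "weyl_mat i j a = diag2 i j a ** (elem_mat i j 1 ** elem_mat j i (- 1) ** elem_mat i j 1)"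
    using assms by (auto simp: vec_eq_iff diag2_def diag_mat_mult_left weyl_mat_def elem_mat_mult_left elem_mat_mult_right elem_mat_nth)
  then show ?thesis using assms by (simp add: SL_closed diag2_SL elem_mat_SL)
qed

text \<open>The diagonal of \<open>W\<^sup>-\<^sup>1 W\<^sup>T\<close> for \<open>W = weyl_mat i j a\<close>. Diagonal test matrices are useless in the inverse
  transpose case because they are symmetric.\<close>

definition weyl_cosquare :: "'n \<Rightarrow> 'n \<Rightarrow> 'a \<Rightarrow> 'n \<Rightarrow> 'a::field" where
  "weyl_cosquare i j a k = (if k = i then - (a ^ 2) else if k = j then - inverse (a ^ 2) else 1)"

lemma weyl_mat_transpose:
  assumes "i \<noteq> j" "a \<noteq> 0"
  shows "transpose (weyl_mat i j a) = weyl_mat i j a ** diag_mat (weyl_cosquare i j a)"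
  using assms by (auto simp: vec_eq_iff transpose_def diag_mat_mult_right weyl_mat_def weyl_cosquare_def power2_eq_square)

lemma map_mat_transpose: "map_mat f (transpose A) = transpose (map_mat f A)"
  by (simp add: map_mat_def transpose_def vec_eq_iff)

lemma det_map_mat:
  assumes "field_hom f" shows "det (map_mat f A) = f (det A)"
  unfolding det_def by (simp add: field_hom_sum[OF assms] field_homD(3)[OF assms] field_hom_of_int[OF assms]
    field_hom_prod[OF assms] map_mat_def)

lemma map_mat_diag: "field_hom f \<Longrightarrow> map_mat f (diag_mat t) = diag_mat (\<lambda>k. f (t k))"
  by (simp add: vec_eq_iff map_mat_def diag_mat_def field_homD)

lemma map_mat_weyl: "field_hom f \<Longrightarrow> f a = a \<Longrightarrow> map_mat f (weyl_mat i j a) = weyl_mat i j a"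
  by (auto simp: vec_eq_iff map_mat_def weyl_mat_def field_homD field_hom_minus field_hom_inverse)

context sl_automorphism
begin

text \<open>An n-th root of the inverse determinant rescales \<open>M\<close>, so that its inverse
  lies in \<open>SL\<close> and can be a factor of the test elements.\<close>

lemma normalized_classification:
  "\<exists>M \<delta>. field_hom \<delta> \<and> det M = 1 \<and>
    ((\<forall>A\<in>SL. g A ** M = M ** map_mat \<delta> A) \<or> (\<forall>A\<in>SL. g A ** M ** transpose (map_mat \<delta> A) = M))"
proof -
  obtain M \<delta> where M: "field_hom \<delta>" "det M \<noteq> 0"
    "(\<forall>A\<in>SL. g A ** M = M ** map_mat \<delta> A) \<or> (\<forall>A\<in>SL. g A ** M ** transpose (map_mat \<delta> A) = M)"
    using classification by blast
  obtain c where c: "c ^ CARD('n) = inverse (det M)" using nth_root_exists[of "CARD('n)" "inverse (det M)"] by auto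
  let ?M = "M ** scalar_mat c"
  have "det ?M = 1" using c M(2) by (simp add: det_mul det_scalar_mat)
  moreover have "(\<forall>A\<in>SL. g A ** ?M = ?M ** map_mat \<delta> A) \<or> (\<forall>A\<in>SL. g A ** ?M ** transpose (map_mat \<delta> A) = ?M)"
  proof -
    have *: "X ** scalar_mat c ** Y = X ** Y ** scalar_mat c" for X Y :: "'a^'n^'n"
      using scalar_mat_comm[of c Y] by (simp add: matrix_mul_assoc[symmetric])
    show ?thesis using M(3) by (simp only: * matrix_mul_assoc) metis
  qed
  ultimately show ?thesis using M(1) by blast
qed

text \<open>Allowing a scalar \<mu> makes the result applicable to \<open>GL\<close>. The factor
  \<open>matrix_inv M\<close> in the test elements absorbs the inner part of the automorphism, so
  that only the field homomorphism and possibly inverse transpose remain.\<close>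

theorem infinite_family:
  assumes tr: "finite_trdeg_over_Q TYPE('a)"
  shows "\<exists>x. (\<forall>p::nat. prime p \<longrightarrow> x p \<in> SL) \<and>
    (\<forall>P p0. infinite P \<longrightarrow> (\<forall>p\<in>P. prime p) \<longrightarrow> prime p0 \<longrightarrow>
      \<not> (\<forall>p\<in>P. \<exists>z\<in>SL. \<exists>\<mu>. \<mu> \<noteq> 0 \<and> x p0 ** g z = scalar_mat \<mu> ** (z ** x p)))"
proof -
  obtain M \<delta> where \<delta>: "field_hom \<delta>" and M: "det M = 1"
    "(\<forall>A\<in>SL. g A ** M = M ** map_mat \<delta> A) \<or> (\<forall>A\<in>SL. g A ** M ** transpose (map_mat \<delta> A) = M)"
    using normalized_classification by blast
  let ?N = "matrix_inv M"
  have MN: "M ** ?N = mat 1" "?N ** M = mat 1" using matrix_inv_det[of M] M(1) by auto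
  have NSL: "?N \<in> SL" using matrix_inv_SL[of M] M(1) by (simp add: SL_def)
  obtain i j :: 'n where ij: "i \<noteq> j" using ex_other by metis
  have pn0: "(of_nat p :: 'a) \<noteq> 0" if "prime p" for p
    using that of_int_eq_0_iff_char_0[OF char0, of "int p"] by (auto simp: prime_gt_0_nat)
  consider "\<forall>A\<in>SL. g A ** M = M ** map_mat \<delta> A" | "\<forall>A\<in>SL. g A ** M ** transpose (map_mat \<delta> A) = M"
    using M(2) by blast
  then show ?thesis
  proof cases
    case 1
    define x where "x p = diag2 i j (of_nat p) ** ?N" for p
    have "x p \<in> SL" if "prime p" for p by (simp add: x_def SL_closed diag2_SL[OF ij pn0[OF that]] NSL)
    moreover have False
      if P: "infinite P" "\<forall>p\<in>P. prime p" "prime p0" "\<forall>p\<in>P. \<exists>z\<in>SL. \<exists>\<mu>. \<mu> \<noteq> 0 \<and> x p0 ** g z = scalar_mat \<mu> ** (z ** x p)" for P p0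
    proof -
      define t where "t p l = (if l = i then of_nat p else if l = j then inverse (of_nat p) else (1::'a))" for p l
      have dt: "diag2 i j (of_nat p) = diag_mat (t p)" for p by (simp add: diag2_def t_def[abs_def])
      have t0: "t p0 k \<noteq> 0" for k using pn0[OF P(3)] by (simp add: t_def)
      have "\<not> finite_trdeg_over_Q TYPE('a)"
      proof (rule semi_intertwiners_imp_infinite_trdeg[OF char0 \<delta> P(1), of 1 "\<lambda>k. inverse (t p0 k)" 1 t i j])
        fix p assume p: "p \<in> P"
        then obtain z \<mu> where z: "z \<in> SL" "\<mu> \<noteq> 0" "x p0 ** g z = scalar_mat \<mu> ** (z ** x p)" using P(4) by blast
        have "x p0 ** g z ** M = diag_mat (t p0) ** (?N ** (g z ** M))" by (simp add: x_def dt matrix_mul_assoc)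
        also have "\<dots> = diag_mat (t p0) ** (?N ** M) ** map_mat \<delta> z" using 1 z(1) by (simp add: matrix_mul_assoc)
        also have "\<dots> = diag_mat (t p0) ** map_mat \<delta> z" by (simp add: MN)
        finally have l: "x p0 ** g z ** M = diag_mat (t p0) ** map_mat \<delta> z" .
        have "x p0 ** g z ** M = scalar_mat \<mu> ** z ** diag_mat (t p) ** (?N ** M)"
          by (subst z(3)) (simp add: x_def dt matrix_mul_assoc)
        then have e: "diag_mat (t p0) ** map_mat \<delta> z = scalar_mat \<mu> ** z ** diag_mat (t p)" using l MN by simp
        have "t p0 k * \<delta> (z $ k $ l) = \<mu> * z $ k $ l * t p l" for k l
          using arg_cong[OF e, of "\<lambda>A. A $ k $ l"] by (simp add: diag_mat_mult_left diag_mat_mult_right map_mat_def)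
        then have "\<delta> (z $ k $ l) = \<mu> * inverse (t p0 k) * t p l * z $ k $ l" for k l
          using t0[of k] by (simp add: field_simps)
        moreover have "det z \<noteq> 0" using z(1) by (simp add: SL_def)
        ultimately show "\<exists>z :: 'a^'n^'n. \<exists>\<mu>. det z \<noteq> 0 \<and> \<mu> \<noteq> 0 \<and> (\<forall>k l. \<delta> (z $ k $ l) = \<mu> * inverse (t p0 k) * t p l * z $ k $ l)"
          using z(2) by blast
      qed (use P t0 ij in \<open>auto simp: t_def\<close>)
      then show False using tr by blast
    qed
    ultimately show ?thesis by blast
  next
    case 2
    define W where "W p = (weyl_mat i j (of_nat p) :: 'a^'n^'n)" for p
    define x where "x p = W p ** ?N" for p
    have WSL: "W p \<in> SL" if "prime p" for p using weyl_mat_SL[OF ij pn0[OF that]] by (simp add: W_def)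
    have "x p \<in> SL" if "prime p" for p by (simp add: x_def SL_closed WSL[OF that] NSL)
    moreover have False
      if P: "infinite P" "\<forall>p\<in>P. prime p" "prime p0" "\<forall>p\<in>P. \<exists>z\<in>SL. \<exists>\<mu>. \<mu> \<noteq> 0 \<and> x p0 ** g z = scalar_mat \<mu> ** (z ** x p)" for P p0
    proof -
      define t where "t p = weyl_cosquare i j (of_nat p :: 'a)" for p
      have t0: "t p0 k \<noteq> 0" for k using pn0[OF P(3)] by (simp add: t_def weyl_cosquare_def)
      have WT: "transpose (W p) = W p ** diag_mat (t p)" if "prime p" for p
        using weyl_mat_transpose[OF ij pn0[OF that]] by (simp add: W_def t_def)
      have fW: "map_mat \<delta> (W p) = W p" for p
        unfolding W_def by (rule map_mat_weyl[OF \<delta> field_hom_of_nat[OF \<delta>]])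
      have \<delta>2: "field_hom (\<lambda>x. \<delta> (\<delta> x))" using \<delta> by (auto simp: field_hom_def)
      \<comment> \<open>The two nontrivial entries of the cosquare are - p^2 and - p^(-2), which
        explains the exponent 2 and the sign -1.\<close>
      have "\<not> finite_trdeg_over_Q TYPE('a)"
      proof (rule semi_intertwiners_imp_infinite_trdeg[OF char0 \<delta>2 P(1), of 2 "\<lambda>k. inverse (t p0 k)" "-1" t i j])
        fix p assume p: "p \<in> P"
        then obtain z \<mu> where z: "z \<in> SL" "\<mu> \<noteq> 0" "x p0 ** g z = scalar_mat \<mu> ** (z ** x p)" using P(4) by blast
        have pp: "prime p" using p P(2) by blast
        let ?y = "map_mat \<delta> z"
        have "x p0 ** g z ** M ** transpose ?y = W p0 ** (?N ** (g z ** M ** transpose ?y))" by (simp add: x_def matrix_mul_assoc)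
        then have l: "x p0 ** g z ** M ** transpose ?y = W p0" using 2 z(1) by (simp add: MN)
        have "x p0 ** g z ** M ** transpose ?y = scalar_mat \<mu> ** z ** W p ** (?N ** M) ** transpose ?y"
          by (subst z(3)) (simp add: x_def matrix_mul_assoc)
        then have R1: "W p0 = scalar_mat \<mu> ** z ** W p ** transpose ?y" using l MN by simp
        \<comment> \<open>Applying \<open>\<delta>\<close> brings in the second iterate of
          \<open>\<delta>\<close> on \<open>z\<close>. Comparison with the transpose of
          \<open>R1\<close> then eliminates \<open>W p0\<close> and leaves an equation between this
          iterate and \<open>z\<close>.\<close>
        have R2: "W p0 = scalar_mat (\<delta> \<mu>) ** ?y ** W p ** transpose (map_mat \<delta> ?y)"
          using arg_cong[OF R1, of "map_mat \<delta>"]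
          by (simp add: map_mat_mult[OF \<delta>] map_mat_transpose map_mat_diag[OF \<delta>] fW)
        have "transpose (W p0) = ?y ** transpose (W p) ** transpose z ** transpose (scalar_mat \<mu>)"
          by (subst R1) (simp add: matrix_transpose_mul matrix_mul_assoc)
        moreover have "transpose (scalar_mat \<mu>) = (scalar_mat \<mu> :: 'a^'n^'n)" by (simp add: transpose_def vec_eq_iff diag_mat_def)
        ultimately have "W p0 ** diag_mat (t p0) = ?y ** W p ** (diag_mat (t p) ** transpose z ** scalar_mat \<mu>)"
          using WT[OF P(3)] WT[OF pp] by (simp add: matrix_mul_assoc)
        moreover have "W p0 ** diag_mat (t p0) = ?y ** W p ** (transpose (map_mat \<delta> ?y) ** diag_mat (t p0) ** scalar_mat (\<delta> \<mu>))"
        proof -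
          have "W p0 ** diag_mat (t p0) = scalar_mat (\<delta> \<mu>) ** (?y ** W p ** transpose (map_mat \<delta> ?y) ** diag_mat (t p0))"
            by (subst R2) (simp add: matrix_mul_assoc)
          also have "\<dots> = ?y ** W p ** transpose (map_mat \<delta> ?y) ** diag_mat (t p0) ** scalar_mat (\<delta> \<mu>)"
            by (rule scalar_mat_comm)
          finally show ?thesis by (simp add: matrix_mul_assoc)
        qed
        ultimately have "?y ** W p ** (transpose (map_mat \<delta> ?y) ** diag_mat (t p0) ** scalar_mat (\<delta> \<mu>))
          = ?y ** W p ** (diag_mat (t p) ** transpose z ** scalar_mat \<mu>)" by simp
        moreover have "det (?y ** W p) \<noteq> 0"
          using z(1) WSL[OF pp] field_homD(1)[OF \<delta>] by (simp add: SL_def det_mul det_map_mat[OF \<delta>])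
        ultimately have e: "transpose (map_mat \<delta> ?y) ** diag_mat (t p0) ** scalar_mat (\<delta> \<mu>) = diag_mat (t p) ** transpose z ** scalar_mat \<mu>"
          using matrix_left_cancel by blast
        have \<delta>\<mu>: "\<delta> \<mu> \<noteq> 0" using z(2) field_hom_eq_0[OF \<delta>] by simp
        have "\<delta> (\<delta> (z $ k $ l)) * t p0 k * \<delta> \<mu> = t p l * z $ k $ l * \<mu>" for k l
          using arg_cong[OF e, of "\<lambda>A. A $ l $ k"]
          by (simp add: diag_mat_mult_left diag_mat_mult_right map_mat_def transpose_def)
        then have "\<delta> (\<delta> (z $ k $ l)) = (\<mu> / \<delta> \<mu>) * inverse (t p0 k) * t p l * z $ k $ l" for k l
          using t0[of k] \<delta>\<mu> by (simp add: field_simps)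
        moreover have "det z \<noteq> 0" using z(1) by (simp add: SL_def)
        moreover have "\<mu> / \<delta> \<mu> \<noteq> 0" using \<delta>\<mu> z(2) by simp
        ultimately show "\<exists>z :: 'a^'n^'n. \<exists>\<mu>. det z \<noteq> 0 \<and> \<mu> \<noteq> 0 \<and> (\<forall>k l. \<delta> (\<delta> (z $ k $ l)) = \<mu> * inverse (t p0 k) * t p l * z $ k $ l)"
          by blast
      qed (use P t0 ij in \<open>auto simp: t_def weyl_cosquare_def\<close>)
      then show False using tr by blast
    qed
    ultimately show ?thesis by blast
  qed
qed

end

section \<open>Twisted conjugacy in SL and GL\<close>

lemma carrier_SL_group [simp]: "carrier SL_group = SL"
  and mult_SL_group [simp]: "A \<otimes>\<^bsub>SL_group\<^esub> B = A ** B"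
  and one_SL_group [simp]: "\<one>\<^bsub>SL_group\<^esub> = mat 1"
  by (simp_all add: SL_group_def SL_def)

lemma carrier_GL_group [simp]: "carrier GL_group = {A. det A \<noteq> 0}"
  and mult_GL_group [simp]: "A \<otimes>\<^bsub>GL_group\<^esub> B = A ** B"
  and one_GL_group [simp]: "\<one>\<^bsub>GL_group\<^esub> = mat 1"
  by (simp_all add: GL_group_def)

lemma det_matrix_inv: "det (A::'a::field^'n^'n) \<noteq> 0 \<Longrightarrow> det (matrix_inv A) \<noteq> 0"
  using matrix_inv_det(1)[of A] by (metis det_I det_mul mult_zero_right zero_neq_one)

lemma group_SL: "group (SL_group :: ('a::field^'n^'n) monoid)"
proof (rule groupI)
  fix A :: "'a^'n^'n" assume "A \<in> carrier SL_group"
  then show "\<exists>B\<in>carrier SL_group. B \<otimes>\<^bsub>SL_group\<^esub> A = \<one>\<^bsub>SL_group\<^esub>"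
    using matrix_inv_SL[of A] matrix_inv_det(2)[of A] by (auto simp: SL_def)
qed (auto simp: SL_closed matrix_mul_assoc)

lemma group_GL: "group (GL_group :: ('a::field^'n^'n) monoid)"
proof (rule groupI)
  fix A :: "'a^'n^'n" assume "A \<in> carrier GL_group"
  then show "\<exists>B\<in>carrier GL_group. B \<otimes>\<^bsub>GL_group\<^esub> A = \<one>\<^bsub>GL_group\<^esub>"
    using det_matrix_inv[of A] matrix_inv_det(2)[of A] by (intro bexI[of _ "matrix_inv A"]) auto
qed (auto simp: det_mul matrix_mul_assoc det_I)

lemma twisted_conj_iff:
  assumes "group G" "\<phi> \<in> hom G G" "x \<in> carrier G" "y \<in> carrier G"
  shows "twisted_conj G \<phi> x y \<longleftrightarrow> (\<exists>z\<in>carrier G. x \<otimes>\<^bsub>G\<^esub> \<phi> z = z \<otimes>\<^bsub>G\<^esub> y)"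
proof -
  interpret group G by fact
  have "x = z \<otimes>\<^bsub>G\<^esub> y \<otimes>\<^bsub>G\<^esub> inv\<^bsub>G\<^esub> (\<phi> z) \<longleftrightarrow> x \<otimes>\<^bsub>G\<^esub> \<phi> z = z \<otimes>\<^bsub>G\<^esub> y" if "z \<in> carrier G" for z
    using inv_solve_right[of x "z \<otimes>\<^bsub>G\<^esub> y" "\<phi> z"] that assms hom_in_carrier by (metis m_closed)
  then show ?thesis unfolding twisted_conj_def by blast
qed

lemma R_infinity_property_iff:
  assumes "group G"
  shows "R_infinity_property G \<longleftrightarrow> (\<forall>\<phi>\<in>iso G G. infinite (twisted_classes G \<phi>))"
proof -
  have "reidemeister_number G \<phi> = \<infinity> \<longleftrightarrow> infinite (twisted_classes G \<phi>)" for \<phi>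
    by (simp add: reidemeister_number_def)
  moreover have "iso G G \<noteq> {}" using id_iso by blast
  ultimately show ?thesis
    unfolding R_infinity_property_def reidemeister_spectrum_def set_eq_iff image_iff by (metis ex_in_conv singleton_iff)
qed

lemma finite_twisted_classes_pigeonhole:
  fixes x :: "nat \<Rightarrow> 'g"
  assumes G: "group G" and \<phi>: "\<phi> \<in> hom G G" and fin: "finite (twisted_classes G \<phi>)"
    and x: "\<And>p. prime p \<Longrightarrow> x p \<in> carrier G"
  obtains P p0 where "infinite P" "\<forall>p\<in>P. prime p" "prime p0"
    "\<And>p. p \<in> P \<Longrightarrow> \<exists>z\<in>carrier G. x p0 \<otimes>\<^bsub>G\<^esub> \<phi> z = z \<otimes>\<^bsub>G\<^esub> x p"
proof -
  interpret group G by fact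
  let ?r = "{(x, y). x \<in> carrier G \<and> y \<in> carrier G \<and> twisted_conj G \<phi> x y}"
  have "(\<lambda>p. ?r `` {x p}) ` {p. prime p} \<subseteq> twisted_classes G \<phi>"
    unfolding twisted_classes_def by (intro image_subsetI quotientI) (use x in auto)
  then have f: "finite ((\<lambda>p. ?r `` {x p}) ` {p. prime p})" using fin finite_subset by blast
  obtain p0 where p0: "prime p0" "infinite {p\<in>{p. prime p}. ?r `` {x p} = ?r `` {x p0}}"
    using pigeonhole_infinite[OF primes_infinite f] by auto
  have "\<exists>z\<in>carrier G. x p0 \<otimes>\<^bsub>G\<^esub> \<phi> z = z \<otimes>\<^bsub>G\<^esub> x p" if p: "prime p" "?r `` {x p} = ?r `` {x p0}" for p
  proof -
    have "twisted_conj G \<phi> (x p) (x p)"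
      unfolding twisted_conj_iff[OF G \<phi> x[OF p(1)] x[OF p(1)]]
      using x[OF p(1)] hom_one[OF \<phi> G G] by (intro bexI[of _ "\<one>\<^bsub>G\<^esub>"]) auto
    then have "x p \<in> ?r `` {x p}" using x[OF p(1)] by auto
    then have "twisted_conj G \<phi> (x p0) (x p)" using p(2) by auto
    then show ?thesis using twisted_conj_iff[OF G \<phi> x[OF p0(1)] x[OF p(1)]] by blast
  qed
  then show ?thesis using that[OF p0(2) _ p0(1)] by auto
qed

lemma iso_SL_group_automorphism:
  fixes \<phi> :: "'a::alg_closed_field^'n^'n \<Rightarrow> 'a^'n^'n"
  assumes "CHAR('a) = 0" "CARD('n) \<ge> 2" "\<phi> \<in> iso SL_group SL_group"
  shows "sl_automorphism \<phi>"
  using assms by unfold_locales (auto simp: iso_def hom_def)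

lemma R_infinity_SL:
  assumes "CHAR('a::alg_closed_field) = 0" "CARD('n::finite) \<ge> 2" "finite_trdeg_over_Q TYPE('a)"
  shows "R_infinity_property (SL_group :: ('a^'n^'n) monoid)"
  unfolding R_infinity_property_iff[OF group_SL]
proof (intro ballI notI)
  fix \<phi> :: "'a^'n^'n \<Rightarrow> 'a^'n^'n"
  assume \<phi>: "\<phi> \<in> iso SL_group SL_group" and fin: "finite (twisted_classes SL_group \<phi>)"
  interpret sl_automorphism \<phi> by (rule iso_SL_group_automorphism[OF assms(1,2) \<phi>])
  obtain x where x: "\<And>p::nat. prime p \<Longrightarrow> x p \<in> SL" and
    n: "\<And>P p0. infinite P \<Longrightarrow> \<forall>p\<in>P. prime p \<Longrightarrow> prime p0 \<Longrightarrow>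
      \<not> (\<forall>p\<in>P. \<exists>z\<in>SL. \<exists>\<mu>. \<mu> \<noteq> 0 \<and> x p0 ** \<phi> z = scalar_mat \<mu> ** (z ** x p))"
    using infinite_family[OF assms(3)] by blast
  have h: "\<phi> \<in> hom SL_group SL_group" using \<phi> by (simp add: iso_def)
  have xG: "x p \<in> carrier SL_group" if "prime p" for p using x[OF that] by simp
  obtain P p0 where P: "infinite P" "\<forall>p\<in>P. prime p" "prime p0"
    "\<And>p. p \<in> P \<Longrightarrow> \<exists>z\<in>carrier SL_group. x p0 \<otimes>\<^bsub>SL_group\<^esub> \<phi> z = z \<otimes>\<^bsub>SL_group\<^esub> x p"
    by (rule finite_twisted_classes_pigeonhole[where x=x, OF group_SL h fin xG]) blast+
  have one: "scalar_mat 1 = (mat 1 :: 'a^'n^'n)" by (simp add: vec_eq_iff diag_mat_nth mat_1_nth)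
  have "\<exists>z\<in>SL. \<exists>\<mu>. \<mu> \<noteq> 0 \<and> x p0 ** \<phi> z = scalar_mat \<mu> ** (z ** x p)" if p: "p \<in> P" for p
  proof -
    obtain z where "z \<in> SL" "x p0 ** \<phi> z = z ** x p" using P(4)[OF p] by auto
    then show ?thesis by (intro bexI[of _ z] exI[of _ 1]) (simp_all add: one)
  qed
  then have "\<forall>p\<in>P. \<exists>z\<in>SL. \<exists>\<mu>. \<mu> \<noteq> 0 \<and> x p0 ** \<phi> z = scalar_mat \<mu> ** (z ** x p)" ..
  with n[OF P(1-3)] show False ..
qed

text \<open>Conjugation by a diagonal matrix with ratio 2 squares an elementary matrix, so the
  determinant d of its image satisfies d = d^2 and is 1. Elementary matrices generate
  \<open>SL\<close>.\<close>

lemma hom_GL_preserves_SL: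
  fixes \<phi> :: "'a::field^'n^'n \<Rightarrow> 'a^'n^'n"
  assumes ch: "CHAR('a) = 0" and \<phi>: "\<phi> \<in> hom GL_group GL_group" and A: "A \<in> SL"
  shows "\<phi> A \<in> SL"
proof -
  have mult: "\<phi> (X ** Y) = \<phi> X ** \<phi> Y" if "det X \<noteq> 0" "det Y \<noteq> 0" for X Y
    using \<phi> that by (auto simp: hom_def)
  have nz: "det (\<phi> X) \<noteq> 0" if "det X \<noteq> 0" for X using \<phi> that by (auto simp: hom_def)
  have two: "(2::'a) \<noteq> 0" by (rule numeral_neq_0_char_0[OF ch])
  have el: "det (\<phi> (elem_mat i j a)) = 1" if ij: "i \<noteq> j" for i j a
  proof -
    define t where "t = (\<lambda>k. if k = i then 2 else 1 :: 'a)"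
    let ?u = "elem_mat i j a"
    have dt: "det (diag_mat t :: 'a^'n^'n) \<noteq> 0" using two by (simp add: det_diag_mat t_def)
    have du: "det ?u \<noteq> 0" using det_elem_mat[OF ij, of a] by simp
    have "t i / t j * a = 2 * a" "t j \<noteq> 0" using ij by (simp_all add: t_def)
    then have "diag_mat t ** ?u = elem_mat i j (a + a) ** diag_mat t"
      using diag_mat_elem_conj[OF ij, of t a] by (metis mult_2)
    then have "diag_mat t ** ?u = ?u ** ?u ** diag_mat t" by (simp only: elem_mat_add[OF ij])
    then have "\<phi> (diag_mat t) ** \<phi> ?u = \<phi> ?u ** \<phi> ?u ** \<phi> (diag_mat t)"
      using mult[OF dt du] mult[OF du du] mult[of "?u ** ?u" "diag_mat t"] dt du by (simp add: det_mul)
    then have "det (\<phi> (diag_mat t)) * det (\<phi> ?u) = det (\<phi> ?u) * det (\<phi> ?u) * det (\<phi> (diag_mat t))"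
      by (metis det_mul)
    then show ?thesis using nz[OF dt] nz[OF du] by simp
  qed
  have "det (\<phi> X) = 1" if "X \<in> elem_gen" for X
    using that
  proof (induction rule: elem_gen.induct)
    case elem_gen_1
    have "\<phi> (mat 1) ** \<phi> (mat 1) = \<phi> (mat 1) ** mat 1" using mult[of "mat 1" "mat 1"] by (simp add: det_I)
    then have "\<phi> (mat 1) = mat 1" using matrix_left_cancel[OF nz] by (metis det_I zero_neq_one)
    then show ?case by (simp add: det_I)
  next
    case (elem_gen_step X i j a)
    then show ?case using mult[of "elem_mat i j a" X] el det_elem_mat[OF elem_gen_step(2), of a] elem_gen_det[OF elem_gen_step(1)]
      by (simp add: det_mul)
  qed
  then show ?thesis using SL_elem_gen A by (auto simp: SL_def)
qed

text \<open>Preservation of \<open>SL\<close> by the inverse automorphism gives surjectivity onto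
  \<open>SL\<close>.\<close>

lemma iso_GL_group_automorphism:
  fixes \<phi> :: "'a::alg_closed_field^'n^'n \<Rightarrow> 'a^'n^'n"
  assumes ch: "CHAR('a) = 0" and "CARD('n) \<ge> 2" and \<phi>: "\<phi> \<in> iso GL_group GL_group"
  shows "sl_automorphism \<phi>"
proof
  interpret G: group "GL_group :: ('a^'n^'n) monoid" by (rule group_GL)
  let ?\<psi> = "inv_into (carrier GL_group) \<phi>"
  have h: "\<phi> \<in> hom GL_group GL_group" "bij_betw \<phi> (carrier GL_group) (carrier GL_group)" using \<phi> by (auto simp: iso_def)
  have \<psi>: "?\<psi> \<in> hom GL_group GL_group" using G.iso_set_sym[OF \<phi>] by (simp add: iso_def)
  have SLGL: "(SL :: ('a^'n^'n) set) \<subseteq> carrier GL_group" by (auto simp: SL_def)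
  show "bij_betw \<phi> SL SL"
    unfolding bij_betw_def
  proof
    show "inj_on \<phi> SL" using h(2) SLGL by (auto simp: bij_betw_def intro: inj_on_subset)
    show "\<phi> ` SL = SL"
    proof
      show "\<phi> ` SL \<subseteq> SL" using hom_GL_preserves_SL[OF ch h(1)] by blast
      show "SL \<subseteq> \<phi> ` SL"
      proof
        fix B :: "'a^'n^'n" assume B: "B \<in> SL"
        then have "?\<psi> B \<in> SL" using hom_GL_preserves_SL[OF ch \<psi>] by blast
        moreover have "\<phi> (?\<psi> B) = B" using h(2) B SLGL by (metis bij_betw_inv_into_right subsetD)
        ultimately show "B \<in> \<phi> ` SL" by (metis imageI)
      qed
    qed
  qed
  fix A B :: "'a^'n^'n" assume "A \<in> SL" "B \<in> SL"
  then show "\<phi> (A ** B) = \<phi> A ** \<phi> B" using h(1) by (auto simp: hom_def SL_def)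
qed (rule assms)+

lemma commute_elem_imp_scalar:
  fixes A :: "'a::field^'n^'n"
  assumes c: "\<And>i j. i \<noteq> j \<Longrightarrow> elem_mat i j 1 ** A = A ** elem_mat i j 1" and "CARD('n) \<ge> 2"
  shows "\<exists>c. A = scalar_mat c"
proof -
  have e: "(if l = j then A $ i $ i else 0) = A $ j $ l" if "i \<noteq> j" for i j l
    using arg_cong[OF c[OF that], of "\<lambda>M. M $ i $ l"] by (auto simp: elem_mat_mult_left elem_mat_mult_right split: if_splits)
  have ex: "\<exists>i. i \<noteq> (j::'n)" for j
  proof (rule ccontr)
    assume "\<nexists>i. i \<noteq> j"
    then have "(UNIV :: 'n set) = {j}" by auto
    then have "CARD('n) = 1" by (metis card_1_singleton_iff One_nat_def)
    then show False using assms(2) by simp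
  qed
  fix o' :: 'n
  have "A $ j $ l = scalar_mat (A $ o' $ o') $ j $ l" for j l
  proof (cases "j = l")
    case True
    then show ?thesis using e[of o' j l] by (cases "o' = j") (auto simp: diag_mat_nth)
  next
    case False
    obtain i where "i \<noteq> j" using ex by blast
    then show ?thesis using e[of i j l] False by (simp add: diag_mat_nth)
  qed
  then have "A = scalar_mat (A $ o' $ o')" unfolding vec_eq_iff by blast
  then show ?thesis ..
qed

text \<open>The image of a scalar matrix commutes with everything and is again scalar. Dividing a
  conjugating matrix by an n-th root of its determinant therefore moves it into \<open>SL\<close> at
  the price of a scalar factor, which \<open>infinite_family\<close> tolerates.\<close>

lemma R_infinity_GL:
  assumes ch: "CHAR('a::alg_closed_field) = 0" and n2: "CARD('n::finite) \<ge> 2" and tr: "finite_trdeg_over_Q TYPE('a)"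
  shows "R_infinity_property (GL_group :: ('a^'n^'n) monoid)"
  unfolding R_infinity_property_iff[OF group_GL]
proof (intro ballI notI)
  fix \<phi> :: "'a^'n^'n \<Rightarrow> 'a^'n^'n"
  assume \<phi>: "\<phi> \<in> iso GL_group GL_group" and fin: "finite (twisted_classes GL_group \<phi>)"
  interpret sl_automorphism \<phi> by (rule iso_GL_group_automorphism[OF ch n2 \<phi>])
  obtain x where x: "\<And>p::nat. prime p \<Longrightarrow> x p \<in> SL" and
    n: "\<And>P p0. infinite P \<Longrightarrow> \<forall>p\<in>P. prime p \<Longrightarrow> prime p0 \<Longrightarrow>
      \<not> (\<forall>p\<in>P. \<exists>z\<in>SL. \<exists>\<mu>. \<mu> \<noteq> 0 \<and> x p0 ** \<phi> z = scalar_mat \<mu> ** (z ** x p))"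
    using infinite_family[OF tr] by blast
  have h: "\<phi> \<in> hom GL_group GL_group" "bij_betw \<phi> (carrier GL_group) (carrier GL_group)" using \<phi> by (auto simp: iso_def)
  have mult: "\<phi> (X ** Y) = \<phi> X ** \<phi> Y" if "det X \<noteq> 0" "det Y \<noteq> 0" for X Y
    using h(1) that by (auto simp: hom_def)
  have nz: "det (\<phi> X) \<noteq> 0" if "det X \<noteq> 0" for X using h(1) that by (auto simp: hom_def)
  have xG: "x p \<in> carrier GL_group" if "prime p" for p using x[OF that] by (simp add: SL_def)
  obtain P p0 where P: "infinite P" "\<forall>p\<in>P. prime p" "prime p0"
    "\<And>p. p \<in> P \<Longrightarrow> \<exists>z\<in>carrier GL_group. x p0 \<otimes>\<^bsub>GL_group\<^esub> \<phi> z = z \<otimes>\<^bsub>GL_group\<^esub> x p"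
    by (rule finite_twisted_classes_pigeonhole[where x=x, OF group_GL h(1) fin xG]) blast+
  have scal: "\<exists>c'. c' \<noteq> 0 \<and> \<phi> (scalar_mat c) = scalar_mat c'" if c: "c \<noteq> 0" for c
  proof -
    have dc: "det (scalar_mat c :: 'a^'n^'n) \<noteq> 0" using c by (simp add: det_scalar_mat)
    have "B ** \<phi> (scalar_mat c) = \<phi> (scalar_mat c) ** B" if B: "det B \<noteq> 0" for B
    proof -
      have "B \<in> \<phi> ` carrier GL_group" using h(2) B by (auto simp: bij_betw_def)
      then obtain C where C: "det C \<noteq> 0" "B = \<phi> C" by auto
      then show ?thesis using mult[OF C(1) dc] mult[OF dc C(1)] scalar_mat_comm[of c C] by simp
    qed
    then have "\<exists>c'. \<phi> (scalar_mat c) = scalar_mat c'"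
      by (intro commute_elem_imp_scalar n2) (simp add: det_elem_mat)
    then obtain c' where c': "\<phi> (scalar_mat c) = scalar_mat c'" by blast
    then have "c' \<noteq> 0" using nz[OF dc] by (auto simp: det_scalar_mat power_0_left)
    then show ?thesis using c' by blast
  qed
  have "\<exists>z\<in>SL. \<exists>\<mu>. \<mu> \<noteq> 0 \<and> x p0 ** \<phi> z = scalar_mat \<mu> ** (z ** x p)" if p: "p \<in> P" for p
  proof -
    obtain z where z: "det z \<noteq> 0" "x p0 ** \<phi> z = z ** x p" using P(4)[OF p] by auto
    obtain c where c: "c ^ CARD('n) = det z" using nth_root_exists[of "CARD('n)" "det z"] by auto
    have c0: "c \<noteq> 0" using c z(1) by (auto simp: power_0_left)
    define s where "s = scalar_mat (inverse c) ** z"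
    have "s \<in> SL" using c z(1) by (simp add: s_def SL_def det_mul det_scalar_mat power_inverse)
    moreover have "scalar_mat a ** (scalar_mat b ** Y) = scalar_mat (a * b) ** Y" for a b and Y :: "'a^'n^'n"
      by (simp add: vec_eq_iff diag_mat_mult_left)
    note ss = this
    have one: "scalar_mat 1 ** Y = Y" for Y :: "'a^'n^'n" by (simp add: vec_eq_iff diag_mat_mult_left)
    have zs: "z = scalar_mat c ** s" using c0 by (simp add: s_def ss one)
    obtain c' where c': "c' \<noteq> 0" "\<phi> (scalar_mat c) = scalar_mat c'" using scal[OF c0] by blast
    have "\<phi> z = scalar_mat c' ** \<phi> s"
      using mult[of "scalar_mat c" s] c0 \<open>s \<in> SL\<close> c'(2) zs by (simp add: det_scalar_mat SL_def)
    then have "x p0 ** (scalar_mat c' ** \<phi> s) = scalar_mat c ** s ** x p" using z(2) zs by simp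
    then have "scalar_mat c' ** (x p0 ** \<phi> s) = scalar_mat c ** (s ** x p)"
      using scalar_mat_comm[of c' "x p0"] by (simp add: matrix_mul_assoc)
    then have "scalar_mat (inverse c') ** (scalar_mat c' ** (x p0 ** \<phi> s)) = scalar_mat (inverse c') ** (scalar_mat c ** (s ** x p))"
      by simp
    then have "x p0 ** \<phi> s = scalar_mat (inverse c' * c) ** (s ** x p)" using c'(1) by (simp add: ss one)
    moreover have "inverse c' * c \<noteq> 0" using c' c0 by simp
    ultimately show ?thesis by blast
  qed
  then have "\<forall>p\<in>P. \<exists>z\<in>SL. \<exists>\<mu>. \<mu> \<noteq> 0 \<and> x p0 ** \<phi> z = scalar_mat \<mu> ** (z ** x p)" ..
  with n[OF P(1-3)] show False ..
qed

lemma field_aut_hom: "field_aut f \<Longrightarrow> field_hom f"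
  by (simp add: field_aut_def field_hom_def)

text \<open>The last hypothesis says that every \<open>x\<close> is twisted conjugate to the
  identity. Two elements with solutions \<open>z\<close> and \<open>w\<close> are linked by the
  product of \<open>z\<close> with the inverse of \<open>w\<close>.\<close>

lemma finite_twisted_classes_if_trivial:
  fixes G :: "('a::field^'n^'n) monoid"
  assumes G: "group G" and \<phi>: "\<phi> \<in> hom G G" and t: "\<And>x. x \<in> carrier G \<Longrightarrow> \<exists>z\<in>carrier G. x \<otimes>\<^bsub>G\<^esub> \<phi> z = z"
  shows "finite (twisted_classes G \<phi>)"
proof -
  interpret group G by fact
  have tc: "twisted_conj G \<phi> x y" if xy: "x \<in> carrier G" "y \<in> carrier G" for x y
  proof -
    obtain z w where z: "z \<in> carrier G" "x \<otimes>\<^bsub>G\<^esub> \<phi> z = z" and w: "w \<in> carrier G" "y \<otimes>\<^bsub>G\<^esub> \<phi> w = w"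
      using t[OF xy(1)] t[OF xy(2)] by blast
    note cl = hom_in_carrier[OF \<phi>]
    have iw: "\<phi> (inv\<^bsub>G\<^esub> w) = inv\<^bsub>G\<^esub> (\<phi> w)" using group_hom.hom_inv[of G G \<phi> w] G \<phi> w(1) by (simp add: group_hom_def group_hom_axioms_def)
    have "y = w \<otimes>\<^bsub>G\<^esub> inv\<^bsub>G\<^esub> (\<phi> w)" using inv_solve_right[of y w "\<phi> w"] w cl[OF w(1)] xy by simp
    then have "inv\<^bsub>G\<^esub> w \<otimes>\<^bsub>G\<^esub> y = inv\<^bsub>G\<^esub> (\<phi> w)" using w(1) cl[OF w(1)] by (simp add: m_assoc[symmetric])
    then have "z \<otimes>\<^bsub>G\<^esub> inv\<^bsub>G\<^esub> w \<otimes>\<^bsub>G\<^esub> y = z \<otimes>\<^bsub>G\<^esub> inv\<^bsub>G\<^esub> (\<phi> w)" using z(1) w(1) xy(2) by (simp add: m_assoc)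
    moreover have "x \<otimes>\<^bsub>G\<^esub> \<phi> (z \<otimes>\<^bsub>G\<^esub> inv\<^bsub>G\<^esub> w) = z \<otimes>\<^bsub>G\<^esub> inv\<^bsub>G\<^esub> (\<phi> w)"
      using z w(1) xy(1) cl hom_mult[OF \<phi>, of z "inv\<^bsub>G\<^esub> w"] iw by (simp add: m_assoc[symmetric])
    ultimately show ?thesis using twisted_conj_iff[OF G \<phi> xy] z(1) w(1) by (metis inv_closed m_closed)
  qed
  have "twisted_classes G \<phi> \<subseteq> {carrier G}"
    unfolding twisted_classes_def quotient_def using tc by auto
  then show ?thesis using finite_subset by blast
qed

lemma map_mat_iso:
  fixes f :: "'a::field \<Rightarrow> 'a"
  assumes f: "field_aut f"
  shows "map_mat f \<in> iso (GL_group :: ('a^'n^'n) monoid) GL_group" "map_mat f \<in> iso (SL_group :: ('a^'n^'n) monoid) SL_group"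
proof -
  note h = field_aut_hom[OF f]
  have fi: "bij f" using f by (simp add: field_aut_def)
  have bij: "bij (map_mat f :: 'a^'n^'n \<Rightarrow> _)"
  proof (rule o_bij[of "map_mat (inv_into UNIV f)"])
    show "map_mat (inv_into UNIV f) \<circ> map_mat f = (id :: 'a^'n^'n \<Rightarrow> _)" "map_mat f \<circ> map_mat (inv_into UNIV f) = (id :: 'a^'n^'n \<Rightarrow> _)"
      using fi by (auto simp: fun_eq_iff map_mat_def vec_eq_iff bij_def surj_f_inv_f)
  qed
  have bb: "bij_betw (map_mat f) S S" if S: "\<And>A. A \<in> S \<longleftrightarrow> map_mat f A \<in> S" for S :: "('a^'n^'n) set"
    unfolding bij_betw_def
  proof
    show "inj_on (map_mat f) S" using bij by (auto simp: bij_def intro: inj_on_subset)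
    show "map_mat f ` S = S"
    proof
      show "map_mat f ` S \<subseteq> S" using S by blast
      show "S \<subseteq> map_mat f ` S"
      proof
        fix B assume B: "B \<in> S"
        obtain A where "B = map_mat f A" using bij by (metis bij_pointE)
        then show "B \<in> map_mat f ` S" using S B by blast
      qed
    qed
  qed
  have f1: "f x = 1 \<longleftrightarrow> x = 1" for x using fi field_homD(1)[OF h] by (metis bij_is_inj injD)
  show "map_mat f \<in> iso (GL_group :: ('a^'n^'n) monoid) GL_group"
  proof -
    have "bij_betw (map_mat f) (carrier GL_group) (carrier GL_group :: ('a^'n^'n) set)"
      by (rule bb) (simp add: det_map_mat[OF h] field_hom_eq_0[OF h])
    then show ?thesis
      by (simp add: iso_def hom_def Pi_iff det_map_mat[OF h] field_hom_eq_0[OF h] map_mat_mult[OF h])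
  qed
  show "map_mat f \<in> iso (SL_group :: ('a^'n^'n) monoid) SL_group"
  proof -
    have "bij_betw (map_mat f) (carrier SL_group) (carrier SL_group :: ('a^'n^'n) set)"
      by (rule bb) (simp add: SL_def det_map_mat[OF h] f1)
    then show ?thesis
      by (simp add: iso_def hom_def Pi_iff SL_def det_map_mat[OF h] f1 map_mat_mult[OF h])
  qed
qed

text \<open>The Lang property applied to the inverse of \<open>x\<close> links \<open>x\<close> to
  the identity, so there is only one class; in \<open>SL\<close> the determinant of the solution has
  to be corrected.\<close>

lemma lang_imp_not_R_infinity:
  fixes f :: "'a::field \<Rightarrow> 'a"
  assumes f: "field_aut f" and lang: "lang_property f TYPE('n::finite)"
  shows "\<not> R_infinity_property (SL_group :: ('a^'n^'n) monoid)" "\<not> R_infinity_property (GL_group :: ('a^'n^'n) monoid)"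
proof -
  note h = field_aut_hom[OF f]
  have sol: "\<exists>z. det z \<noteq> 0 \<and> x ** map_mat f z = z" if x: "det x \<noteq> 0" for x :: "'a^'n^'n"
  proof -
    obtain z :: "'a^'n^'n" where z: "det z \<noteq> 0" "map_mat f z = matrix_inv x ** z"
      using lang det_matrix_inv[OF x] unfolding lang_property_def map_mat_def by blast
    then have "x ** map_mat f z = z" by (simp add: matrix_mul_assoc matrix_inv_det[OF x])
    then show ?thesis using z by blast
  qed
  have "finite (twisted_classes (GL_group :: ('a^'n^'n) monoid) (map_mat f))"
  proof (rule finite_twisted_classes_if_trivial[OF group_GL])
    show "map_mat f \<in> hom GL_group (GL_group :: ('a^'n^'n) monoid)" using map_mat_iso(1)[OF f, where 'n='n] by (simp add: iso_def)
    fix x :: "'a^'n^'n" assume "x \<in> carrier GL_group"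
    then show "\<exists>z\<in>carrier GL_group. x \<otimes>\<^bsub>GL_group\<^esub> map_mat f z = z" using sol[of x] by auto
  qed
  then show "\<not> R_infinity_property (GL_group :: ('a^'n^'n) monoid)"
    unfolding R_infinity_property_iff[OF group_GL] using map_mat_iso(1)[OF f, where 'n='n] by blast
  have "finite (twisted_classes (SL_group :: ('a^'n^'n) monoid) (map_mat f))"
  proof (rule finite_twisted_classes_if_trivial[OF group_SL])
    show "map_mat f \<in> hom SL_group (SL_group :: ('a^'n^'n) monoid)" using map_mat_iso(2)[OF f, where 'n='n] by (simp add: iso_def)
    fix x :: "'a^'n^'n" assume "x \<in> carrier SL_group"
    then have x: "det x = 1" by (simp add: SL_def)
    then obtain z where z: "det z \<noteq> 0" "x ** map_mat f z = z" using sol[of x] by auto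
    have fd: "f (det z) = det z" using arg_cong[OF z(2), of det] x by (simp add: det_mul det_map_mat[OF h])
    fix o' :: 'n
    \<comment> \<open>The determinant of \<open>z\<close> is fixed by \<open>f\<close> because
      \<open>det x = 1\<close>. So dividing one column by it gives a solution in
      \<open>SL\<close>.\<close>
    define t where "t = (\<lambda>k. if k = o' then inverse (det z) else 1)"
    have ft: "map_mat f (diag_mat t) = diag_mat t"
      by (simp add: map_mat_diag[OF h] t_def if_distrib[of f] field_homD[OF h] field_hom_inverse[OF h] fd cong: if_cong)
    have "det (z ** diag_mat t) = 1" using z(1) by (simp add: det_mul det_diag_mat t_def)
    moreover have "x ** map_mat f (z ** diag_mat t) = z ** diag_mat t"
      using z(2) by (simp add: map_mat_mult[OF h] ft matrix_mul_assoc)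
    ultimately show "\<exists>z\<in>carrier SL_group. x \<otimes>\<^bsub>SL_group\<^esub> map_mat f z = z"
      by (intro bexI[of _ "z ** diag_mat t"]) (auto simp: SL_def)
  qed
  then show "\<not> R_infinity_property (SL_group :: ('a^'n^'n) monoid)"
    unfolding R_infinity_property_iff[OF group_SL] using map_mat_iso(2)[OF f, where 'n='n] by blast
qed

lemma lang_automorphism_exists:
  assumes "\<not> (CHAR('a::alg_closed_field) = 0 \<and> finite_trdeg_over_Q TYPE('a))"
  shows "\<exists>f :: 'a \<Rightarrow> 'a. field_aut f \<and> lang_property f TYPE('n::finite)"
proof (cases "CHAR('a) = 0")
  case False
  then show ?thesis using frobenius_lang(1)[where 'a='a] frobenius_lang(2)[where 'a='a and 'n='n] by auto
next
  case True
  obtain B :: "'a set" where B: "alg_indep B" "alg_cl B = UNIV" using alg_basis_exists by blast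
  then have "infinite B" using assms True finite_trdeg_over_Q_iff[OF True] by blast
  then show ?thesis using generic_lang_automorphism B by blast
qed

theorem mainTheorem1:
  assumes "CARD('n::finite) \<ge> 2"
  shows "(R_infinity_property (SL_group :: ('a::alg_closed_field ^'n ^'n) monoid)
            \<longleftrightarrow> CHAR('a) = 0 \<and> finite_trdeg_over_Q TYPE('a))
       \<and> (R_infinity_property (GL_group :: ('a ^'n ^'n) monoid)
            \<longleftrightarrow> CHAR('a) = 0 \<and> finite_trdeg_over_Q TYPE('a))"
  using R_infinity_SL[where 'a='a and 'n='n] R_infinity_GL[where 'a='a and 'n='n] assms
    lang_automorphism_exists[where 'a='a and 'n='n] lang_imp_not_R_infinity[where 'a='a and 'n='n] by blast

end
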